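(* Let $a:\mathbb{R}\to\mathbb{R}^d$ satisfy the genuine nonlinearity condition (GN). Let $\Omega\subset\mathbb{R}^d$ be open, let $u\in L^\infty(\Omega)$ be an entropy solution of $\operatorname{div}[A(u)]=0$ in $\Omega$, and let $x_0$ be a point of its jump set $J$ at which the blow up limit is a single shock, i.e. there exist a unit vector $n$ and real numbers $u^+>u^-$ such that, with the limit taken in $L^1_{loc}$, $$u_\infty(x)=\lim_{r\to0}u(rx+x_0)=\begin{cases}u^+&\text{when }x\cdot n>0,\\ u^-&\text{when }x\cdot n<0.\end{cases}$$ Then $u^+=\overline u(x_0)$ and $u^-=\underline u(x_0)$. The limit is uniform in the set $B_1\cap\{|x\cdot n|>\delta\}$ for any $\delta>0$. Moreover, for any $\delta>0$, $$\lim_{\substack{y\to x_0\\ (y-x_0)\cdot n>\delta|y-x_0|}}u(y)=\overline u(x_0)\qquad\text{and}\qquad \lim_{\substack{y\to x_0\\ (y-x_0)\cdot n<-\delta|y-x_0|}}u(y)=\underline u(x_0).$$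
   Context: $A:\mathbb{R}\to\mathbb{R}^d$ and $a=A'$. The equation is $\operatorname{div}[A(u)]=a(u)\cdot\nabla u=0$. Since $u$ is defined only up to null sets, uniform convergence and pointwise limits of $u$ are understood up to sets of Lebesgue measure zero (essential uniform convergence, essential limits). Entropy solution: $u\in L^\infty(\Omega)$ is an entropy solution in $\Omega$ if for every convex $\eta:\mathbb{R}\to\mathbb{R}$, with $q:\mathbb{R}\to\mathbb{R}^d$ such that $q_i'(v)=\eta'(v)a_i(v)$ for $i=1,\dots,d$, and every smooth compactly supported $\varphi\ge 0$ in $\Omega$, one has $\int_\Omega q(u)\cdot\nabla\varphi\,dx\ge 0$. (GN): $a$ is $C^1$ and there exist $\alpha\in(0,1]$ and $C>0$ such that for every $\xi\in\mathbb{R}^d$ with $|\xi|=1$ and every $\delta>0$, $|\{v\in I: |a(v)\cdot\xi|<\delta\}|\le C\delta^\alpha$, where $I$ is a closed interval containing the image of $u$. Semicontinuous envelopes: $\underline u(x)=\lim_{r\to0}\operatorname{ess\,inf}_{\Omega\cap B_r(x)}u$ and $\overline u(x)=\lim_{r\to0}\operatorname{ess\,sup}_{\Omega\cap B_r(x)}u$. Kinetic measure: let $f(x,v)=1$ if $0<v<u(x)$, $f(x,v)=-1$ if $u(x)<v<0$, and $f(x,v)=0$ otherwise. It is known that $u$ is an entropy solution if and only if there is a nonnegative measure $\mu$ on $\Omega\times\mathbb{R}$ with $a(v)\cdot\nabla_x f=\partial_v\mu$ in the sense of distributions. Jump set: $J=\left\{x\in\Omega:\limsup_{r\to0}\frac{\mu(B_r(x)\times\mathbb{R})}{r^{d-1}}>0\right\}$.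 *)

theory Defs
  imports "HOL-Analysis.Analysis" "HOL-Probability.Essential_Supremum"
begin

text \<open>
  Throughout, the Euclidean space \<open>'a\<close> plays the role of \<open>\<real>\<^sup>d\<close>, with \<open>d = DIM('a)\<close>. Functions on an
  open set \<open>\<Omega>\<close> are total functions whose values outside \<open>\<Omega>\<close> are irrelevant.
\<close>

subsection \<open>Test functions\<close>

primrec C_k :: "nat \<Rightarrow> ('b::real_normed_vector \<Rightarrow> real) \<Rightarrow> bool" where
  "C_k 0 f \<longleftrightarrow> continuous_on UNIV f"
| "C_k (Suc k) f \<longleftrightarrow> (\<forall>x. f differentiable at x) \<and> (\<forall>h. C_k k (\<lambda>x. frechet_derivative f (at x) h))"

definition test_function :: "'b::real_normed_vector set \<Rightarrow> ('b \<Rightarrow> real) \<Rightarrow> bool" where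
  "test_function U \<phi> \<longleftrightarrow> (\<forall>k. C_k k \<phi>) \<and>
     compact (closure {x. \<phi> x \<noteq> 0}) \<and> closure {x. \<phi> x \<noteq> 0} \<subseteq> U"

definition grad :: "('a::euclidean_space \<Rightarrow> real) \<Rightarrow> 'a \<Rightarrow> 'a" where
  "grad \<phi> x = (\<Sum>b\<in>Basis. frechet_derivative \<phi> (at x) b *\<^sub>R b)"

subsection \<open>Entropy solutions\<close>

definition L_infinity :: "'a::euclidean_space set \<Rightarrow> ('a \<Rightarrow> real) \<Rightarrow> bool" where
  "L_infinity \<Omega> u \<longleftrightarrow> u \<in> borel_measurable (lebesgue_on \<Omega>) \<and>
     (\<exists>M. AE x in lebesgue_on \<Omega>. \<bar>u x\<bar> \<le> M)"

text \<open>
  A convex \<open>\<eta>\<close> is differentiable off a countable set, and there \<open>\<eta>'\<close> is continuous. Continuity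
  of \<open>q\<close> together with \<open>q' = \<eta>' a\<close> wherever \<open>\<eta>'\<close> exists therefore determines \<open>q\<close> up to an additive
  constant: it is a primitive of \<open>\<eta>' a\<close>.
\<close>

definition entropy_flux :: "(real \<Rightarrow> 'a::euclidean_space) \<Rightarrow> (real \<Rightarrow> real) \<Rightarrow> (real \<Rightarrow> 'a) \<Rightarrow> bool" where
  "entropy_flux a \<eta> q \<longleftrightarrow> continuous_on UNIV q \<and>
     (\<forall>v. \<eta> differentiable at v \<longrightarrow> (q has_vector_derivative deriv \<eta> v *\<^sub>R a v) (at v))"

definition entropy_solution ::
  "(real \<Rightarrow> 'a::euclidean_space) \<Rightarrow> 'a set \<Rightarrow> ('a \<Rightarrow> real) \<Rightarrow> bool" where
  "entropy_solution a \<Omega> u \<longleftrightarrow> L_infinity \<Omega> u \<and>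
     (\<forall>\<eta> q \<phi>. convex_on UNIV \<eta> \<longrightarrow> entropy_flux a \<eta> q \<longrightarrow>
        test_function \<Omega> \<phi> \<longrightarrow> (\<forall>x. \<phi> x \<ge> 0) \<longrightarrow>
        (LINT x|lebesgue_on \<Omega>. q (u x) \<bullet> grad \<phi> x) \<ge> 0)"

subsection \<open>Genuine nonlinearity\<close>

definition genuinely_nonlinear :: "real set \<Rightarrow> (real \<Rightarrow> 'a::euclidean_space) \<Rightarrow> bool" where
  "genuinely_nonlinear I a \<longleftrightarrow> a C1_differentiable_on UNIV \<and>
     (\<exists>\<alpha>::real. 0 < \<alpha> \<and> \<alpha> \<le> 1 \<and> (\<exists>C::real. C > 0 \<and>
        (\<forall>\<xi>. norm \<xi> = 1 \<longrightarrow> (\<forall>\<delta>>0.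
           emeasure lborel {v \<in> I. \<bar>a v \<bullet> \<xi>\<bar> < \<delta>} \<le> ennreal (C * \<delta> powr \<alpha>)))))"

subsection \<open>Kinetic formulation and jump set\<close>

definition kinetic_fun :: "('a \<Rightarrow> real) \<Rightarrow> 'a \<Rightarrow> real \<Rightarrow> real" where
  "kinetic_fun u x v = (if 0 < v \<and> v < u x then 1 else if u x < v \<and> v < 0 then - 1 else 0)"

text \<open>
  The equation \<open>a(v) \<sqdot> \<nabla>\<^sub>x f = \<partial>\<^sub>v \<mu>\<close> is tested against \<open>\<psi>\<close>; the minus signs from the integrations by
  parts cancel. It determines \<open>\<mu>\<close> only up to measures \<open>\<nu>(dx) \<otimes> dv\<close>; requiring, as usual, that \<open>\<mu>\<close> be
  finite on \<open>K \<times> \<real>\<close> for compact \<open>K \<subseteq> \<Omega>\<close> makes it unique, so that the jump set depends on \<open>u\<close> only.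
\<close>

definition kinetic_measure ::
  "(real \<Rightarrow> 'a::euclidean_space) \<Rightarrow> 'a set \<Rightarrow> ('a \<Rightarrow> real) \<Rightarrow> ('a \<times> real) measure \<Rightarrow> bool" where
  "kinetic_measure a \<Omega> u \<mu> \<longleftrightarrow>
     space \<mu> = \<Omega> \<times> UNIV \<and> sets \<mu> = sets (restrict_space borel (\<Omega> \<times> UNIV)) \<and>
     (\<forall>K. compact K \<longrightarrow> K \<subseteq> \<Omega> \<longrightarrow> emeasure \<mu> (K \<times> UNIV) < \<infinity>) \<and>
     (\<forall>\<psi>. test_function (\<Omega> \<times> UNIV) \<psi> \<longrightarrow>
        (LINT (x, v)|lebesgue_on (\<Omega> \<times> UNIV). kinetic_fun u x v * (a v \<bullet> grad (\<lambda>y. \<psi> (y, v)) x))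
        = (LINT (x, v)|\<mu>. deriv (\<lambda>w. \<psi> (x, w)) v))"

definition jump_set :: "'a::euclidean_space set \<Rightarrow> ('a \<times> real) measure \<Rightarrow> 'a set" where
  "jump_set \<Omega> \<mu> = {x \<in> \<Omega>.
     Limsup (at_right 0) (\<lambda>r. emeasure \<mu> (ball x r \<times> UNIV) / ennreal (r ^ (DIM('a) - 1))) > 0}"

subsection \<open>Semicontinuous envelopes\<close>

definition essinf :: "'b measure \<Rightarrow> ('b \<Rightarrow> ereal) \<Rightarrow> ereal" where
  "essinf M f = - esssup M (\<lambda>x. - f x)"

definition upper_envelope :: "'a::euclidean_space set \<Rightarrow> ('a \<Rightarrow> real) \<Rightarrow> 'a \<Rightarrow> ereal" where
  "upper_envelope \<Omega> u x =
     Lim (at_right 0) (\<lambda>r. esssup (lebesgue_on (\<Omega> \<inter> ball x r)) (\<lambda>y. ereal (u y)))"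

definition lower_envelope :: "'a::euclidean_space set \<Rightarrow> ('a \<Rightarrow> real) \<Rightarrow> 'a \<Rightarrow> ereal" where
  "lower_envelope \<Omega> u x =
     Lim (at_right 0) (\<lambda>r. essinf (lebesgue_on (\<Omega> \<inter> ball x r)) (\<lambda>y. ereal (u y)))"

subsection \<open>Essential limits and blow-up limits\<close>

text \<open>
  A property holds eventually in this filter iff it holds for almost every \<open>y \<in> S\<close> in some
  neighbourhood of \<open>x\<close>.
\<close>

definition ess_at_within :: "'a::euclidean_space \<Rightarrow> 'a set \<Rightarrow> 'a filter" where
  "ess_at_within x S = inf (at x within S) (ae_filter lebesgue)"

definition ess_uniform_limit ::
  "'a::euclidean_space set \<Rightarrow> ('i \<Rightarrow> 'a \<Rightarrow> real) \<Rightarrow> ('a \<Rightarrow> real) \<Rightarrow> 'i filter \<Rightarrow> bool" where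
  "ess_uniform_limit S f l F \<longleftrightarrow>
     (\<forall>e>0. \<forall>\<^sub>F i in F. AE x in lebesgue_on S. \<bar>f i x - l x\<bar> < e)"

text \<open>
  The functions need to be defined on a given compact set only eventually, as is the case for
  \<open>x \<mapsto> u (r x + x\<^sub>0)\<close> with \<open>x\<^sub>0 \<in> \<Omega>\<close> as \<open>r\<close> tends to \<open>0\<close>.
\<close>

definition L1_loc_limit ::
  "('i \<Rightarrow> 'a::euclidean_space \<Rightarrow> real) \<Rightarrow> ('a \<Rightarrow> real) \<Rightarrow> 'i filter \<Rightarrow> bool" where
  "L1_loc_limit f l F \<longleftrightarrow> (\<forall>K. compact K \<longrightarrow>
     ((\<lambda>i. \<integral>\<^sup>+x. ennreal \<bar>f i x - l x\<bar> \<partial>lebesgue_on K) \<longlongrightarrow> 0) F)"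

definition blow_up :: "('a::euclidean_space \<Rightarrow> real) \<Rightarrow> 'a \<Rightarrow> real \<Rightarrow> 'a \<Rightarrow> real" where
  "blow_up u x0 r x = u (r *\<^sub>R x + x0)"

text \<open>The value on the null set \<open>x \<bullet> n = 0\<close> is immaterial.\<close>

definition shock :: "'a::euclidean_space \<Rightarrow> real \<Rightarrow> real \<Rightarrow> 'a \<Rightarrow> real" where
  "shock n up um x = (if x \<bullet> n > 0 then up else um)"

end

theory Submission
  imports Defs "HOL-Real_Asymp.Real_Asymp"
begin

text \<open>
  Everything rests on a De Giorgi type bound: if an entropy solution exceeds a level \<open>k0\<close> only on a
  small fraction of a ball, then it is at most \<open>k1 > k0\<close> on a smaller ball. Applied to the blow-ups
  and to \<open>-u\<close>, it turns the convergence in \<open>L\<^sup>1\<close> into one-sided essential bounds.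

  The required gain of regularity comes from a real-variable velocity averaging argument. Testing
  with the entropies \<open>(s - v)\<^sup>+\<close> shows that the indicator of \<open>{u > v}\<close>, averaged over a short window
  of levels and mollified at scale \<open>\<delta>\<close>, is almost invariant under translations along \<open>a(v)\<close>. Since
  \<open>{u > v}\<close> decreases in \<open>v\<close>, one may translate successively along \<open>a(v\<^sub>1), \<dots>, a(v\<^sub>d)\<close> at slightly
  decreasing levels, and (GN) makes these directions span the space with a quantitative bound. Hence
  the mollified indicator of \<open>{u > v + \<delta> powr \<sigma>}\<close> is dominated, up to an error of order
  \<open>\<delta> powr (1/4)\<close> times the measure of \<open>{u > v}\<close>, by every translate of that of \<open>{u > v}\<close> by a vector
  of length at most \<open>2 \<delta>\<close>. Summing over dyadic scales and iterating over levels gives the bound.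
\<close>

subsection \<open>Smooth functions and a bump function\<close>

text \<open>A De Giorgi iteration needs a gain that is superlinear in the volume of {u > v}, but the
  averaging estimate is only linear in it. The scale supplies the nonlinearity: a volume below a
  multiple of \<delta> ^ d forces the indicator mollified at scale \<delta> under 1/2, so small
  volumes permit small \<delta>, and a factor \<delta> powr (1/4) is then a power of the volume
  itself. The error is proportional to the volume at all because the flux of (s - k)^+ vanishes
  where u \<le> k.

  Drops in level are unavoidable. At one level only the single direction a(v) is available, and (GN)
  bounds the measure of the bad levels for a direction without naming a good one. Since the drops
  \<delta> powr \<sigma> are summable over dyadic scales, they fit into any gap k1 - k0.

  Two further points shape the end of the proof. The equation is invariant under dilations and the
  smallness threshold depends only on the law, the levels and a sup bound, so one threshold serves
  all blow-up radii. And (GN) holds on I only, so the levels used must be shown to lie in I.\<close>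

definition smooth :: "('a::euclidean_space \<Rightarrow> real) \<Rightarrow> bool" where
  "smooth f \<longleftrightarrow> (\<forall>k. C_k k f)"

text \<open>\<open>C_k\<close> unfolds one derivative at a time, so smoothness is the largest
  property inherited by all directional derivatives. Each closure lemma below only has to name a
  class of functions that differentiation does not leave.\<close>

lemma smooth_coinduct:
  assumes "P f"
    and diff: "\<And>f x. P f \<Longrightarrow> f differentiable at x"
    and step: "\<And>f h. P f \<Longrightarrow> P (\<lambda>x. frechet_derivative f (at x) h)"
  shows "smooth f"
proof -
  have "C_k k f" if "P f" for k f
    using that
  proof (induction k arbitrary: f)
    case 0
    then have "continuous (at x) f" for x
      using diff differentiable_imp_continuous_within by blast
    then show ?case by (simp add: continuous_on_eq_continuous_within)
  next
    case (Suc k)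
    then show ?case using diff step by auto
  qed
  with assms(1) show ?thesis by (simp add: smooth_def)
qed

lemma smooth_differentiable: "smooth f \<Longrightarrow> f differentiable at x"
  unfolding smooth_def by (metis C_k.simps(2))

lemma smooth_frechet_derivative: "smooth f \<Longrightarrow> smooth (\<lambda>x. frechet_derivative f (at x) h)"
  unfolding smooth_def by (metis C_k.simps(2))

lemma smooth_continuous_on: "smooth f \<Longrightarrow> continuous_on S f"
  unfolding smooth_def by (metis C_k.simps(1) continuous_on_subset subset_UNIV)

lemma smooth_has_derivative: "smooth f \<Longrightarrow> (f has_derivative frechet_derivative f (at x)) (at x)"
  using smooth_differentiable frechet_derivative_works by blast

section \<open>Gradients and closure properties of smooth functions\<close>

lemma grad_inner_eq:
  assumes "f differentiable at x"
  shows "grad f x \<bullet> h = frechet_derivative f (at x) h"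
proof -
  have "linear (frechet_derivative f (at x))"
    using assms by (simp add: linear_frechet_derivative)
  then have "frechet_derivative f (at x) (\<Sum>b\<in>Basis. (h \<bullet> b) *\<^sub>R b) =
     (\<Sum>b\<in>Basis. (h \<bullet> b) * frechet_derivative f (at x) b)"
    by (simp add: linear_sum linear_scale)
  then have "frechet_derivative f (at x) h = (\<Sum>b\<in>Basis. (h \<bullet> b) * frechet_derivative f (at x) b)"
    unfolding euclidean_representation .
  then show ?thesis
    unfolding grad_def inner_sum_left
    by (auto intro!: sum.cong simp: inner_commute mult.commute)
qed

lemma has_derivative_imp_grad_inner:
  assumes "(f has_derivative f') (at x)"
  shows "grad f x \<bullet> h = f' h"
  using assms grad_inner_eq frechet_derivative_at by (metis differentiableI)

lemma smooth_grad_inner: "smooth f \<Longrightarrow> grad f x \<bullet> h = frechet_derivative f (at x) h"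
  by (simp add: grad_inner_eq smooth_differentiable)

lemma smooth_grad_has_derivative: "smooth f \<Longrightarrow> (f has_derivative (\<lambda>h. grad f x \<bullet> h)) (at x)"
  using smooth_has_derivative by (simp add: smooth_grad_inner)

lemma smooth_continuous_on_grad: "smooth f \<Longrightarrow> continuous_on S (grad f)"
  unfolding grad_def
  by (intro continuous_intros smooth_continuous_on smooth_frechet_derivative)

text \<open>A zero of a nonnegative function is a minimum. This gives vanishing gradients on the
  boundary of a support too, with no argument about interiors.\<close>

lemma grad_eq_0:
  assumes "f x = 0" "\<And>y. f y \<ge> (0::real)" "f differentiable at x"
  shows "grad f x = 0"
proof -
  have "(f has_derivative frechet_derivative f (at x)) (at x)"
    using assms(3) frechet_derivative_works by blast
  then have "frechet_derivative f (at x) = (\<lambda>h. 0)"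
    using assms(1,2) by (intro differential_zero_maxmin[of x UNIV f]) auto
  then show ?thesis
    by (simp add: grad_def)
qed

lemma smooth_affine:
  assumes "smooth f"
  shows "smooth (\<lambda>x. k * f (c *\<^sub>R x + b))"
    and "grad (\<lambda>x. k * f (c *\<^sub>R x + b)) x = (k * c) *\<^sub>R grad f (c *\<^sub>R x + b)"
proof -
  have D: "((\<lambda>x. k * f (c *\<^sub>R x + b)) has_derivative
      (\<lambda>h. k * frechet_derivative f (at (c *\<^sub>R x + b)) (c *\<^sub>R h))) (at x)"
    if "smooth f" for f k x
    by (rule has_derivative_mult_right, rule has_derivative_compose[OF _ smooth_has_derivative[OF that]])
      (auto intro!: derivative_eq_intros)
  show "smooth (\<lambda>x. k * f (c *\<^sub>R x + b))"
  proof (rule smooth_coinduct[where P="\<lambda>g. \<exists>f k. smooth f \<and> g = (\<lambda>x. k * f (c *\<^sub>R x + b))"])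
    fix g :: "'a \<Rightarrow> real" and h assume "\<exists>f k. smooth f \<and> g = (\<lambda>x. k * f (c *\<^sub>R x + b))"
    then obtain f k where f: "smooth f" "g = (\<lambda>x. k * f (c *\<^sub>R x + b))" by blast
    have "(\<lambda>x. frechet_derivative g (at x) h) =
       (\<lambda>x. k * (\<lambda>y. frechet_derivative f (at y) (c *\<^sub>R h)) (c *\<^sub>R x + b))"
      using frechet_derivative_at[OF D[OF f(1)]] f(2) by metis
    then show "\<exists>f k. smooth f \<and> (\<lambda>x. frechet_derivative g (at x) h) = (\<lambda>x. k * f (c *\<^sub>R x + b))"
      using smooth_frechet_derivative[OF f(1)] by blast
  qed (use assms in \<open>auto intro!: differentiableI[OF D]\<close>)
  show "grad (\<lambda>x. k * f (c *\<^sub>R x + b)) x = (k * c) *\<^sub>R grad f (c *\<^sub>R x + b)"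
  proof (rule vector_eq_rdot[THEN iffD1], rule allI)
    fix h
    have "grad (\<lambda>x. k * f (c *\<^sub>R x + b)) x \<bullet> h = k * (grad f (c *\<^sub>R x + b) \<bullet> (c *\<^sub>R h))"
      using has_derivative_imp_grad_inner[OF D[OF assms]]
      unfolding smooth_grad_inner[OF assms, symmetric] .
    then show "grad (\<lambda>x. k * f (c *\<^sub>R x + b)) x \<bullet> h = ((k * c) *\<^sub>R grad f (c *\<^sub>R x + b)) \<bullet> h"
      by simp
  qed
qed

lemma smooth_diff:
  assumes "smooth f" "smooth g"
  shows "smooth (\<lambda>x. f x - g x)" and "grad (\<lambda>x. f x - g x) x = grad f x - grad g x"
proof -
  have D: "((\<lambda>x. f x - g x) has_derivative
      (\<lambda>h. frechet_derivative f (at x) h - frechet_derivative g (at x) h)) (at x)"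
    if "smooth f" "smooth g" for f g :: "'a \<Rightarrow> real" and x
    using that by (intro has_derivative_diff smooth_has_derivative)
  show "smooth (\<lambda>x. f x - g x)"
  proof (rule smooth_coinduct[where P="\<lambda>e. \<exists>f g. smooth f \<and> smooth g \<and> e = (\<lambda>x. f x - g x)"])
    fix e :: "'a \<Rightarrow> real" and h assume "\<exists>f g. smooth f \<and> smooth g \<and> e = (\<lambda>x. f x - g x)"
    then obtain f g where f: "smooth f" "smooth g" "e = (\<lambda>x. f x - g x)" by blast
    have "(\<lambda>x. frechet_derivative e (at x) h) =
       (\<lambda>x. frechet_derivative f (at x) h - frechet_derivative g (at x) h)"
      using frechet_derivative_at[OF D[OF f(1,2)]] f(3) by metis
    then show "\<exists>f g. smooth f \<and> smooth g \<and> (\<lambda>x. frechet_derivative e (at x) h) = (\<lambda>x. f x - g x)"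
      using smooth_frechet_derivative f by blast
  qed (use assms in \<open>auto intro!: differentiableI[OF D]\<close>)
  show "grad (\<lambda>x. f x - g x) x = grad f x - grad g x"
  proof (rule vector_eq_rdot[THEN iffD1], rule allI)
    fix h
    show "grad (\<lambda>x. f x - g x) x \<bullet> h = (grad f x - grad g x) \<bullet> h"
      using has_derivative_imp_grad_inner[OF D[OF assms]]
      unfolding smooth_grad_inner[OF assms(1), symmetric] smooth_grad_inner[OF assms(2), symmetric]
      by (simp add: inner_diff_left)
  qed
qed

text \<open>Differentiation under the integral. The coinductive class consists of the box averages
  of all smooth functions, because the derivative of an average is the average of a
  derivative.\<close>

lemma smooth_box_average:
  fixes f :: "'a::euclidean_space \<Rightarrow> real"
  assumes "smooth f"
  shows "smooth (\<lambda>y. integral (cbox l r) (\<lambda>x. f (y - x)))" (is ?A)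
    and "grad (\<lambda>y. integral (cbox l r) (\<lambda>x. f (y - x))) y \<bullet> h
      = integral (cbox l r) (\<lambda>x. grad f (y - x) \<bullet> h)" (is ?B)
proof -
  have D: "((\<lambda>y. integral (cbox l r) (\<lambda>x. f (y - x))) has_derivative
      (\<lambda>h. integral (cbox l r) (\<lambda>x. frechet_derivative f (at (y - x)) h))) (at y)"
    if f: "smooth f" for f :: "'a \<Rightarrow> real" and y
  proof -
    \<comment> \<open>The derivative is packaged as a bounded linear functional, jointly continuous
      in both variables, which is the form that \<open>leibniz_rule\<close> asks for.\<close>
    define fx where "fx y x = blinfun_inner_left (grad f (y - x))" for y x :: 'a
    have cont: "continuous_on (UNIV \<times> cbox l r) (\<lambda>(y, x). fx y x)"
      unfolding fx_def case_prod_beta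
      by (intro continuous_intros bounded_linear.continuous_on[OF bounded_linear_blinfun_inner_left]
          continuous_on_compose2[OF smooth_continuous_on_grad[OF f, of UNIV]]) auto
    have ch: "((\<lambda>y. f (y - x)) has_derivative blinfun_apply (fx y x)) (at y within UNIV)" for y x
    proof -
      have "((\<lambda>y. f (y - x)) has_derivative (\<lambda>h. grad f (y - x) \<bullet> h)) (at y)"
        by (rule has_derivative_compose[OF _ smooth_grad_has_derivative[OF f]])
          (auto intro!: derivative_eq_intros)
      then show ?thesis by (simp add: fx_def blinfun_inner_left.rep_eq inner_commute)
    qed
    have "((\<lambda>y. integral (cbox l r) (\<lambda>x. f (y - x))) has_derivative
       integral (cbox l r) (fx y)) (at y within UNIV)"
      by (rule leibniz_rule[OF ch _ cont])
        (auto intro!: integrable_continuous continuous_on_compose2[OF smooth_continuous_on[OF f, of UNIV]]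
          continuous_intros)
    moreover have "blinfun_apply (integral (cbox l r) (fx y)) h =
        integral (cbox l r) (\<lambda>x. frechet_derivative f (at (y - x)) h)" for h
    proof -
      have "fx y integrable_on cbox l r"
        by (rule integrable_continuous, rule continuous_on_compose2[OF cont, where f="\<lambda>x. (y, x)", simplified])
          (auto intro!: continuous_intros)
      then have "blinfun_apply (integral (cbox l r) (fx y)) h = integral (cbox l r) (\<lambda>x. blinfun_apply (fx y x) h)"
        by (subst blinfun_apply_integral) auto
      then show ?thesis
        by (simp add: fx_def blinfun_inner_left.rep_eq inner_commute smooth_grad_inner[OF f, symmetric])
    qed
    then have "blinfun_apply (integral (cbox l r) (fx y)) =
        (\<lambda>h. integral (cbox l r) (\<lambda>x. frechet_derivative f (at (y - x)) h))" by blast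
    ultimately show ?thesis by simp
  qed
  show ?A
  proof (rule smooth_coinduct[where P="\<lambda>g. \<exists>f. smooth f \<and> g = (\<lambda>y. integral (cbox l r) (\<lambda>x. f (y - x)))"])
    fix g :: "'a \<Rightarrow> real" and h
    assume "\<exists>f. smooth f \<and> g = (\<lambda>y. integral (cbox l r) (\<lambda>x. f (y - x)))"
    then obtain f where f: "smooth f" "g = (\<lambda>y. integral (cbox l r) (\<lambda>x. f (y - x)))" by blast
    have "(\<lambda>x. frechet_derivative g (at x) h) =
       (\<lambda>y. integral (cbox l r) (\<lambda>x. (\<lambda>z. frechet_derivative f (at z) h) (y - x)))"
      using frechet_derivative_at[OF D[OF f(1)]] f(2) by metis
    then show "\<exists>f. smooth f \<and> (\<lambda>x. frechet_derivative g (at x) h) = (\<lambda>y. integral (cbox l r) (\<lambda>x. f (y - x)))"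
      using smooth_frechet_derivative[OF f(1)] by blast
  qed (use assms in \<open>auto intro!: differentiableI[OF D]\<close>)
  show ?B
    using has_derivative_imp_grad_inner[OF D[OF assms]] by (simp add: smooth_grad_inner[OF assms])
qed

text \<open>The powers of \<open>s\<close> in the denominator make the family closed, up to linear
  combinations, under differentiation of exp (- 1 / s). The member \<open>n = 0\<close> gives the
  bump function.\<close>

definition flat_exp :: "nat \<Rightarrow> real \<Rightarrow> real" where
  "flat_exp n s = (if s > 0 then exp (- 1 / s) / s ^ n else 0)"

lemma flat_exp_has_derivative:
  "(flat_exp n has_real_derivative flat_exp (n + 2) s - n * flat_exp (n + 1) s) (at s)"
proof -
  consider "s > 0" | "s < 0" | "s = 0" by linarith
  then show ?thesis
  proof cases
    case 1
    have "((\<lambda>s. exp (- 1 / s) / s ^ n) has_real_derivative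
        flat_exp (n + 2) s - n * flat_exp (n + 1) s) (at s)"
      using 1 by (auto intro!: derivative_eq_intros simp: flat_exp_def field_simps power2_eq_square)
        (cases n; simp add: field_simps power2_eq_square)
    then show ?thesis
      by (rule has_field_derivative_transform_within_open[where S="{0<..}"]) (use 1 in \<open>auto simp: flat_exp_def\<close>)
  next
    case 2
    have "((\<lambda>s. 0) has_real_derivative flat_exp (n + 2) s - n * flat_exp (n + 1) s) (at s)"
      using 2 by (auto simp: flat_exp_def)
    then show ?thesis
      by (rule has_field_derivative_transform_within_open[where S="{..<0}"]) (use 2 in \<open>auto simp: flat_exp_def\<close>)
  next
    case 3
    \<comment> \<open>The origin is the only delicate point: the exponential decays faster than the
      power \<open>n + 1\<close> of \<open>h\<close> that the difference quotient produces.\<close>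
    have "((\<lambda>h. exp (- 1 / h) / h ^ n / h) \<longlongrightarrow> 0) (at_right (0::real))"
    proof -
      have "((\<lambda>h. exp (- 1 / h) / h powr real (n + 1)) \<longlongrightarrow> 0) (at_right (0::real))"
        by real_asymp
      then show ?thesis
        by (rule Lim_transform_eventually)
          (auto intro!: eventually_at_rightI[of 0 1] simp: powr_realpow[of _ "n+1", symmetric] powr_add powr_realpow field_simps)
    qed
    then have "((\<lambda>h. (flat_exp n (0 + h) - flat_exp n 0) / h) \<longlongrightarrow> 0) (at_right 0)"
      by (rule Lim_transform_eventually) (auto intro!: eventually_at_rightI[of 0 1] simp: flat_exp_def)
    moreover have "((\<lambda>h. (flat_exp n (0 + h) - flat_exp n 0) / h) \<longlongrightarrow> 0) (at_left 0)"
      by (rule Lim_transform_eventually[OF tendsto_const])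
        (auto intro!: eventually_at_leftI[of "-1"] simp: flat_exp_def)
    ultimately have "((\<lambda>h. (flat_exp n (0 + h) - flat_exp n 0) / h) \<longlongrightarrow> 0) (at 0)"
      by (simp add: filterlim_split_at)
    then show ?thesis
      using 3 by (simp add: DERIV_def flat_exp_def)
  qed
qed

text \<open>
  This class is closed under directional derivatives, so its members are smooth by coinduction.
\<close>

inductive flat_exp_algebra :: "('a::euclidean_space \<Rightarrow> real) \<Rightarrow> bool" where
  const: "flat_exp_algebra (\<lambda>x. c)"
| inner: "flat_exp_algebra (\<lambda>x. x \<bullet> h)"
| flat: "flat_exp_algebra (\<lambda>x. flat_exp n (1 - x \<bullet> x))"
| add: "flat_exp_algebra f \<Longrightarrow> flat_exp_algebra g \<Longrightarrow> flat_exp_algebra (\<lambda>x. f x + g x)"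
| mult: "flat_exp_algebra f \<Longrightarrow> flat_exp_algebra g \<Longrightarrow> flat_exp_algebra (\<lambda>x. f x * g x)"

lemma flat_exp_algebra_derivative:
  assumes "flat_exp_algebra f"
  shows "\<exists>f'. (\<forall>x. (f has_derivative f' x) (at x)) \<and> (\<forall>h. flat_exp_algebra (\<lambda>x. f' x h))"
  using assms
proof induction
  case (const c)
  show ?case
    by (rule exI[of _ "\<lambda>x h. 0"]) (auto intro: flat_exp_algebra.const)
next
  case (inner h)
  have "((\<lambda>x. x \<bullet> h) has_derivative (\<lambda>k. k \<bullet> h)) (at x)" for x
    by (auto intro!: derivative_eq_intros)
  then show ?case
    by (intro exI[of _ "\<lambda>x k. k \<bullet> h"]) (auto intro: flat_exp_algebra.const)
next
  case (flat n)
  let ?f' = "\<lambda>x k. (flat_exp (n + 2) (1 - x \<bullet> x) + (- real n) * flat_exp (n + 1) (1 - x \<bullet> x)) * ((-2) * (x \<bullet> k))"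
  have "((\<lambda>x. flat_exp n (1 - x \<bullet> x)) has_derivative ?f' x) (at x)" for x :: 'a
  proof -
    have "((\<lambda>x. 1 - x \<bullet> x) has_derivative (\<lambda>k. (-2) * (x \<bullet> k))) (at x)"
      by (auto intro!: derivative_eq_intros simp: inner_commute)
    from has_derivative_compose[OF this flat_exp_has_derivative[unfolded has_field_derivative_def]]
    show ?thesis by simp
  qed
  moreover have "flat_exp_algebra (\<lambda>x. ?f' x k)" for k
    by (intro flat_exp_algebra.intros)
  ultimately show ?case by (intro exI[of _ ?f']) blast
next
  case (add f g)
  then obtain f' g' where
    "\<forall>x. (f has_derivative f' x) (at x)" "\<forall>h. flat_exp_algebra (\<lambda>x. f' x h)"
    "\<forall>x. (g has_derivative g' x) (at x)" "\<forall>h. flat_exp_algebra (\<lambda>x. g' x h)" by blast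
  then show ?case
    by (intro exI[of _ "\<lambda>x h. f' x h + g' x h"]) (auto intro: has_derivative_add flat_exp_algebra.add)
next
  case (mult f g)
  then obtain f' g' where
    "\<forall>x. (f has_derivative f' x) (at x)" "\<forall>h. flat_exp_algebra (\<lambda>x. f' x h)"
    "\<forall>x. (g has_derivative g' x) (at x)" "\<forall>h. flat_exp_algebra (\<lambda>x. g' x h)" by blast
  with mult.hyps show ?case
    by (intro exI[of _ "\<lambda>x h. f x * g' x h + f' x h * g x"])
      (intro conjI allI has_derivative_mult flat_exp_algebra.add flat_exp_algebra.mult; blast)
qed

lemma flat_exp_algebra_smooth:
  assumes "flat_exp_algebra f"
  shows "smooth f"
  using assms
proof (rule smooth_coinduct)
  fix f :: "'a \<Rightarrow> real" and x h assume f: "flat_exp_algebra f"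
  obtain f' where f': "\<forall>x. (f has_derivative f' x) (at x)" "\<forall>h. flat_exp_algebra (\<lambda>x. f' x h)"
    using flat_exp_algebra_derivative[OF f] by blast
  show "f differentiable at x" using f'(1) differentiableI by blast
  have "(\<lambda>x. frechet_derivative f (at x) h) = (\<lambda>x. f' x h)"
    using f'(1) frechet_derivative_at by metis
  then show "flat_exp_algebra (\<lambda>x. frechet_derivative f (at x) h)"
    using f'(2) by simp
qed

lemma smooth_bump_exists:
  obtains f :: "'a::euclidean_space \<Rightarrow> real"
  where "smooth f" "\<And>x. f x \<ge> 0" "\<And>x. f x > 0 \<longleftrightarrow> norm x < 1" "\<And>x. f x \<le> 1"
proof
  let ?f = "\<lambda>x::'a. flat_exp 0 (1 - x \<bullet> x)"
  show "smooth ?f" by (intro flat_exp_algebra_smooth flat_exp_algebra.flat)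
  have "1 - x \<bullet> x > 0 \<longleftrightarrow> norm x < 1" for x :: 'a
    by (simp add: norm_eq_sqrt_inner real_sqrt_lt_1_iff)
  then show "?f x > 0 \<longleftrightarrow> norm x < 1" for x
    by (auto simp: flat_exp_def)
qed (auto simp: flat_exp_def)

subsection \<open>Mollifiers\<close>

lemma nn_integral_lborel_affine:
  fixes t :: "'a::euclidean_space"
  assumes [measurable]: "f \<in> borel_measurable borel" and c: "c \<noteq> 0"
  shows "(\<integral>\<^sup>+x. f x \<partial>lborel) = ennreal (\<bar>c\<bar> ^ DIM('a)) * (\<integral>\<^sup>+x. f (t + c *\<^sub>R x) \<partial>lborel)"
  by (subst lborel_affine[OF c, of t])
    (simp add: nn_integral_density nn_integral_distr nn_integral_cmult)

lemma nn_integral_lborel_translate: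
  fixes t :: "'a::euclidean_space"
  assumes "f \<in> borel_measurable borel"
  shows "(\<integral>\<^sup>+x. f (t + x) \<partial>lborel) = (\<integral>\<^sup>+x. f x \<partial>lborel)"
  using nn_integral_lborel_affine[OF assms, of 1 t] by simp

lemma nn_integral_lborel_reflect:
  fixes t :: "'a::euclidean_space"
  assumes "f \<in> borel_measurable borel"
  shows "(\<integral>\<^sup>+x. f (t - x) \<partial>lborel) = (\<integral>\<^sup>+x. f x \<partial>lborel)"
  using nn_integral_lborel_affine[OF assms, of "-1" t] by simp

lemma integral_lborel_affine:
  fixes t :: "'a::euclidean_space" and f :: "'a \<Rightarrow> 'b::{banach, second_countable_topology}"
  assumes [measurable]: "f \<in> borel_measurable borel" and c: "c \<noteq> 0"
  shows "(\<integral>x. f x \<partial>lborel) = \<bar>c\<bar> ^ DIM('a) *\<^sub>R (\<integral>x. f (t + c *\<^sub>R x) \<partial>lborel)"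
  by (subst lborel_affine[OF c, of t])
    (simp add: integral_density integral_distr)

text \<open>Cubes take the place of balls because \<open>smooth_box_average\<close> differentiates
  averages over boxes. Enlarging the half side by \<open>s\<close> still absorbs translations of
  Euclidean length \<open>s\<close>.\<close>

definition cube :: "real \<Rightarrow> 'a::euclidean_space set" where
  "cube r = cbox (- (r *\<^sub>R One)) (r *\<^sub>R One)"

lemma mem_cube: "x \<in> cube r \<longleftrightarrow> (\<forall>b\<in>Basis. \<bar>x \<bullet> b\<bar> \<le> r)"
  by (auto simp: cube_def mem_box abs_le_iff minus_le_iff)

lemma cube_mono: "r \<le> s \<Longrightarrow> cube r \<subseteq> cube s"
  by (fastforce simp: mem_cube)

lemma sets_cube [measurable, simp]: "cube r \<in> sets borel"
  by (simp add: cube_def)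

lemma cube_add: "x \<in> cube r \<Longrightarrow> norm z \<le> s \<Longrightarrow> x + z \<in> cube (r + s)"
  unfolding mem_cube inner_add_left by (meson Basis_le_norm abs_triangle_ineq add_mono order_trans)

lemma cube_subset_box: "r < s \<Longrightarrow> cube r \<subseteq> box (- (s *\<^sub>R One)) (s *\<^sub>R One)"
  by (fastforce simp: mem_cube mem_box abs_le_iff)

lemma emeasure_cube_finite: "emeasure lborel (cube r) < \<infinity>"
  unfolding cube_def by (rule emeasure_lborel_cbox_finite)

locale mollifier =
  fixes K :: "'a::euclidean_space \<Rightarrow> real"
  assumes smooth_K: "smooth K" and K_nonneg: "K x \<ge> 0"
    and K_zero: "norm x \<ge> 1 \<Longrightarrow> K x = 0" and K_integral: "(\<integral>\<^sup>+x. K x \<partial>lborel) = 1"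
    and K_bounded: "bounded (range K)"
begin

definition Ker :: "real \<Rightarrow> 'a \<Rightarrow> real" where
  "Ker \<delta> z = (1 / \<delta> ^ DIM('a)) * K ((1 / \<delta>) *\<^sub>R z)"

definition Kmax :: real where "Kmax = (SOME B. B > 0 \<and> (\<forall>x. K x \<le> B))"

lemma Kmax: "Kmax > 0" "K x \<le> Kmax"
proof -
  obtain B where "B > 0" "\<And>x. norm (K x) \<le> B"
    using K_bounded unfolding bounded_pos by auto
  then have "\<exists>B. B > 0 \<and> (\<forall>x. K x \<le> B)"
    by (intro exI[of _ B]) (auto simp: abs_le_iff)
  then have "Kmax > 0 \<and> (\<forall>x. K x \<le> Kmax)"
    unfolding Kmax_def by (rule someI_ex)
  then show "Kmax > 0" "K x \<le> Kmax" by auto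
qed

lemma borel_K [measurable]: "K \<in> borel_measurable borel"
  by (simp add: borel_measurable_continuous_onI smooth_K smooth_continuous_on)

lemma borel_grad_K [measurable]: "grad K \<in> borel_measurable borel"
  by (simp add: borel_measurable_continuous_onI smooth_K smooth_continuous_on_grad)

lemma grad_K_zero: "norm x \<ge> 1 \<Longrightarrow> grad K x = 0"
  by (intro grad_eq_0 K_nonneg K_zero smooth_differentiable smooth_K)

lemma grad_K_bounded: "\<exists>B. \<forall>x. norm (grad K x) \<le> B"
proof -
  have "compact (grad K ` cball 0 1)"
    by (intro compact_continuous_image smooth_continuous_on_grad smooth_K) simp
  then obtain B where "\<And>x. x \<in> cball 0 1 \<Longrightarrow> norm (grad K x) \<le> B"
    by (meson compact_imp_bounded bounded_iff imageI)
  then have "norm (grad K x) \<le> max B 0" for x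
    using grad_K_zero[of x] by (cases "norm x \<ge> 1") (fastforce simp: le_max_iff_disj)+
  then show ?thesis by blast
qed

lemma grad_K_integrable: "(\<integral>\<^sup>+x. norm (grad K x) \<partial>lborel) < \<infinity>"
proof -
  obtain B where B: "\<And>x. norm (grad K x) \<le> B" using grad_K_bounded by blast
  have "(\<integral>\<^sup>+x. norm (grad K x) \<partial>lborel) \<le> (\<integral>\<^sup>+x. ennreal B * indicator (cball (0::'a) 1) x \<partial>lborel)"
    by (rule nn_integral_mono) (use B grad_K_zero in \<open>auto simp: indicator_def ennreal_leI\<close>)
  also have "\<dots> = ennreal B * emeasure lborel (cball (0::'a) 1)"
    by (simp add: nn_integral_cmult_indicator)
  also have "\<dots> < \<infinity>"
    using emeasure_lborel_cball_finite[of "0::'a" 1] by (simp add: ennreal_mult_less_top)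
  finally show ?thesis .
qed

definition CK :: real where "CK = enn2real (\<integral>\<^sup>+x. norm (grad K x) \<partial>lborel)"

lemma CK: "CK \<ge> 0" "(\<integral>\<^sup>+x. norm (grad K x) \<partial>lborel) = ennreal CK"
  using grad_K_integrable by (auto simp: CK_def)

lemma Ker_nonneg: "\<delta> > 0 \<Longrightarrow> Ker \<delta> z \<ge> 0"
  by (simp add: Ker_def K_nonneg)

lemma Ker_zero: "\<delta> > 0 \<Longrightarrow> norm z \<ge> \<delta> \<Longrightarrow> Ker \<delta> z = 0"
  by (simp add: Ker_def K_zero)

lemma Ker_le: "\<delta> > 0 \<Longrightarrow> Ker \<delta> z \<le> Kmax / \<delta> ^ DIM('a)"
  using Kmax(2) by (simp add: Ker_def divide_right_mono)

lemma smooth_Ker: "smooth (Ker \<delta>)"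
  and grad_Ker: "grad (Ker \<delta>) z = (1 / \<delta> ^ DIM('a) * (1 / \<delta>)) *\<^sub>R grad K ((1 / \<delta>) *\<^sub>R z)"
  using smooth_affine[OF smooth_K, of "1 / \<delta> ^ DIM('a)" "1 / \<delta>" 0] by (simp_all add: Ker_def[abs_def])

lemma smooth_Ker_shift: "smooth (\<lambda>y. Ker \<delta> (y - x))"
  and grad_Ker_shift: "grad (\<lambda>y. Ker \<delta> (y - x)) y = grad (Ker \<delta>) (y - x)"
  using smooth_affine[OF smooth_Ker[of \<delta>], of 1 1 "- x"] by simp_all

lemma grad_Ker_zero: "\<delta> > 0 \<Longrightarrow> norm z \<ge> \<delta> \<Longrightarrow> grad (Ker \<delta>) z = 0"
  by (simp add: grad_Ker grad_K_zero)

lemma continuous_on_Ker: "continuous_on S (Ker \<delta>)"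
  by (simp add: smooth_Ker smooth_continuous_on)

lemma continuous_on_grad_Ker: "continuous_on S (grad (Ker \<delta>))"
  by (simp add: smooth_Ker smooth_continuous_on_grad)

lemma borel_Ker [measurable]: "Ker \<delta> \<in> borel_measurable borel"
  by (simp add: borel_measurable_continuous_onI continuous_on_Ker)

lemma borel_grad_Ker [measurable]: "grad (Ker \<delta>) \<in> borel_measurable borel"
  by (simp add: borel_measurable_continuous_onI continuous_on_grad_Ker)

lemma nn_integral_Ker:
  assumes "\<delta> > 0"
  shows "(\<integral>\<^sup>+y. Ker \<delta> (y - x) \<partial>lborel) = 1" "(\<integral>\<^sup>+y. Ker \<delta> (x - y) \<partial>lborel) = 1" "(\<integral>\<^sup>+y. Ker \<delta> y \<partial>lborel) = 1"
proof -
  have "(\<integral>\<^sup>+y. Ker \<delta> y \<partial>lborel) = ennreal (\<bar>\<delta>\<bar> ^ DIM('a)) * (\<integral>\<^sup>+y. Ker \<delta> (0 + \<delta> *\<^sub>R y) \<partial>lborel)"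
    using assms by (intro nn_integral_lborel_affine) auto
  also have "\<dots> = ennreal (\<delta> ^ DIM('a)) * (\<integral>\<^sup>+y. ennreal (1 / \<delta> ^ DIM('a)) * ennreal (K y) \<partial>lborel)"
    using assms by (simp add: Ker_def ennreal_mult'[symmetric])
  also have "\<dots> = 1"
    using assms by (subst nn_integral_cmult) (auto simp: K_integral ennreal_mult'[symmetric])
  finally show *: "(\<integral>\<^sup>+y. Ker \<delta> y \<partial>lborel) = 1" .
  show "(\<integral>\<^sup>+y. Ker \<delta> (y - x) \<partial>lborel) = 1"
    using nn_integral_lborel_translate[of "\<lambda>y. ennreal (Ker \<delta> y)" "- x"] * by (simp add: algebra_simps)
  show "(\<integral>\<^sup>+y. Ker \<delta> (x - y) \<partial>lborel) = 1"
    using nn_integral_lborel_reflect[of "\<lambda>y. ennreal (Ker \<delta> y)" x] * by simp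
qed

lemma integrable_Ker:
  assumes "\<delta> > 0"
  shows "integrable lborel (\<lambda>y. Ker \<delta> (y - x))" "integrable lborel (\<lambda>y. Ker \<delta> (x - y))"
    "integrable lborel (Ker \<delta>)"
  using nn_integral_Ker[OF assms] Ker_nonneg[OF assms]
  by (auto intro!: integrableI_nonneg)

lemma integral_Ker:
  assumes "\<delta> > 0"
  shows "(\<integral>y. Ker \<delta> (y - x) \<partial>lborel) = 1" "(\<integral>y. Ker \<delta> (x - y) \<partial>lborel) = 1" "(\<integral>y. Ker \<delta> y \<partial>lborel) = 1"
  using nn_integral_Ker[OF assms] Ker_nonneg[OF assms]
  by (auto simp: integral_eq_nn_integral)

lemma nn_integral_grad_Ker:
  assumes "\<delta> > 0"
  shows "(\<integral>\<^sup>+y. norm (grad (Ker \<delta>) (y - x)) \<partial>lborel) = ennreal (CK / \<delta>)"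
    and "(\<integral>\<^sup>+y. norm (grad (Ker \<delta>) (x - y)) \<partial>lborel) = ennreal (CK / \<delta>)"
proof -
  have "(\<integral>\<^sup>+y. norm (grad (Ker \<delta>) y) \<partial>lborel)
      = ennreal (\<bar>\<delta>\<bar> ^ DIM('a)) * (\<integral>\<^sup>+y. norm (grad (Ker \<delta>) (0 + \<delta> *\<^sub>R y)) \<partial>lborel)"
    using assms by (intro nn_integral_lborel_affine) auto
  also have "\<dots> = ennreal (\<delta> ^ DIM('a)) *
      (\<integral>\<^sup>+y. ennreal (1 / \<delta> ^ DIM('a) * (1 / \<delta>)) * ennreal (norm (grad K y)) \<partial>lborel)"
    using assms by (simp add: grad_Ker ennreal_mult'[symmetric])
  also have "\<dots> = ennreal (CK / \<delta>)"
    using assms CK by (subst nn_integral_cmult) (auto simp: ennreal_mult'[symmetric])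
  finally have *: "(\<integral>\<^sup>+y. norm (grad (Ker \<delta>) y) \<partial>lborel) = ennreal (CK / \<delta>)" .
  show "(\<integral>\<^sup>+y. norm (grad (Ker \<delta>) (y - x)) \<partial>lborel) = ennreal (CK / \<delta>)"
    using nn_integral_lborel_translate[of "\<lambda>y. ennreal (norm (grad (Ker \<delta>) y))" "- x"] *
    by (simp add: algebra_simps)
  show "(\<integral>\<^sup>+y. norm (grad (Ker \<delta>) (x - y)) \<partial>lborel) = ennreal (CK / \<delta>)"
    using nn_integral_lborel_reflect[of "\<lambda>y. ennreal (norm (grad (Ker \<delta>) y))" x] * by simp
qed

lemma integrable_grad_Ker:
  assumes "\<delta> > 0"
  shows "integrable lborel (\<lambda>y. grad (Ker \<delta>) (y - x))" "integrable lborel (\<lambda>y. grad (Ker \<delta>) (x - y))"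
  using nn_integral_grad_Ker[OF assms, of x] by (auto simp: integrable_iff_bounded)

text \<open>The indicator of \<open>cube r\<close> mollified at scale \<delta>. It has two roles in
  \<open>entropy_prod_average\<close>: it is the superposition of all kernels centred in the cube,
  and, at a coarser scale, the cutoff function that dominates this superposition.\<close>

definition mol :: "real \<Rightarrow> real \<Rightarrow> 'a \<Rightarrow> real" where
  "mol \<delta> r y = integral (cube r) (\<lambda>x. Ker \<delta> (y - x))"

lemma smooth_mol: "smooth (mol \<delta> r)"
  unfolding mol_def[abs_def] cube_def by (rule smooth_box_average(1)[OF smooth_Ker])

lemma integrable_on_Ker: "(\<lambda>x. Ker \<delta> (y - x)) integrable_on cube r"
  unfolding cube_def
  by (intro integrable_continuous continuous_on_compose2[OF continuous_on_Ker[of UNIV]]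
    continuous_intros) auto

lemma mol_lebesgue: "\<delta> > 0 \<Longrightarrow> mol \<delta> r y = (\<integral>x. indicator (cube r) x * Ker \<delta> (y - x) \<partial>lborel)"
proof -
  assume "\<delta> > 0"
  then have "set_integrable lborel (cube r) (\<lambda>x. Ker \<delta> (y - x))"
    unfolding set_integrable_def
    by (intro integrable_mult_indicator integrable_Ker) auto
  from set_borel_integral_eq_integral(2)[OF this] show ?thesis
    by (simp add: mol_def set_lebesgue_integral_def)
qed

lemma mol_nonneg: "\<delta> > 0 \<Longrightarrow> mol \<delta> r y \<ge> 0"
  unfolding mol_def by (intro integral_nonneg integrable_on_Ker Ker_nonneg)

lemma mol_le_1: "\<delta> > 0 \<Longrightarrow> mol \<delta> r y \<le> 1"
proof -
  assume d: "\<delta> > 0"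
  have "mol \<delta> r y \<le> (\<integral>x. Ker \<delta> (y - x) \<partial>lborel)"
    unfolding mol_lebesgue[OF d]
    using integrable_Ker(2)[OF d] Ker_nonneg[OF d]
    by (intro integral_mono') (auto simp: indicator_def)
  then show ?thesis using integral_Ker(2)[OF d] by simp
qed

lemma mol_eq_1:
  assumes d: "\<delta> > 0" and y: "y \<in> cube (r - \<delta>)"
  shows "mol \<delta> r y = 1"
proof -
  have *: "indicator (cube r) x * Ker \<delta> (y - x) = Ker \<delta> (y - x)" for x
  proof (cases "norm (y - x) \<ge> \<delta>")
    case False
    then have "y + (x - y) \<in> cube ((r - \<delta>) + \<delta>)"
      by (intro cube_add y) (simp add: norm_minus_commute)
    then show ?thesis by simp
  qed (simp add: Ker_zero d)
  show ?thesis
    unfolding mol_lebesgue[OF d] * by (rule integral_Ker(2)[OF d])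
qed

lemma mol_eq_0:
  assumes d: "\<delta> > 0" and y: "y \<notin> cube (r + \<delta>)"
  shows "mol \<delta> r y = 0"
proof -
  have *: "indicator (cube r) x * Ker \<delta> (y - x) = 0" for x
  proof (cases "norm (y - x) \<ge> \<delta> \<or> x \<notin> cube r")
    case False
    then have "x + (y - x) \<in> cube (r + \<delta>)"
      by (intro cube_add) auto
    then show ?thesis using y by simp
  qed (auto simp: Ker_zero d)
  show ?thesis
    unfolding mol_lebesgue[OF d] * by simp
qed

lemma grad_mol_inner:
  assumes d: "\<delta> > 0"
  shows "grad (mol \<delta> r) y \<bullet> h = (\<integral>x. indicator (cube r) x * (grad (Ker \<delta>) (y - x) \<bullet> h) \<partial>lborel)"
proof -
  have "set_integrable lborel (cube r) (\<lambda>x. grad (Ker \<delta>) (y - x) \<bullet> h)"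
    unfolding set_integrable_def
    by (intro integrable_mult_indicator integrable_inner_left integrable_grad_Ker d) auto
  from set_borel_integral_eq_integral(2)[OF this] show ?thesis
    using smooth_box_average(2)[OF smooth_Ker, of "- (r *\<^sub>R One)" "r *\<^sub>R One" \<delta> y h]
    by (simp add: mol_def[abs_def] cube_def set_lebesgue_integral_def)
qed

lemma norm_grad_mol:
  assumes d: "\<delta> > 0"
  shows "norm (grad (mol \<delta> r) y) \<le> CK / \<delta>"
proof -
  let ?g = "grad (mol \<delta> r) y"
  have i: "integrable lborel (\<lambda>x. norm (grad (Ker \<delta>) (y - x)))"
    using integrable_grad_Ker(2)[OF d, of y] by simp
  \<comment> \<open>The norm is read off by pairing the gradient with itself, so that only scalar
    integrals have to be estimated.\<close>
  have "norm ?g * norm ?g = (\<integral>x. indicator (cube r) x * (grad (Ker \<delta>) (y - x) \<bullet> ?g) \<partial>lborel)"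
    using grad_mol_inner[OF d, of r y ?g] by (simp add: dot_square_norm power2_eq_square)
  also have "\<dots> \<le> (\<integral>x. norm (grad (Ker \<delta>) (y - x)) * norm ?g \<partial>lborel)"
  proof (rule integral_mono')
    show "indicator (cube r) x * (grad (Ker \<delta>) (y - x) \<bullet> ?g) \<le> norm (grad (Ker \<delta>) (y - x)) * norm ?g" for x
      by (auto simp: indicator_def norm_cauchy_schwarz)
  qed (use i in auto)
  also have "\<dots> = CK / \<delta> * norm ?g"
  proof -
    have "(\<integral>x. norm (grad (Ker \<delta>) (y - x)) \<partial>lborel) = CK / \<delta>"
      using nn_integral_grad_Ker(2)[OF d, of y] CK(1) d by (simp add: integral_eq_nn_integral)
    then show ?thesis by simp
  qed
  finally show ?thesis
    using CK(1) d by (cases "?g = 0") (auto dest!: mult_right_le_imp_le simp del: times_divide_eq_left)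
qed

lemma grad_mol_zero: "\<delta> > 0 \<Longrightarrow> y \<notin> cube (r + \<delta>) \<Longrightarrow> grad (mol \<delta> r) y = 0"
  by (intro grad_eq_0 mol_eq_0 mol_nonneg smooth_differentiable smooth_mol)

lemma borel_mol [measurable]: "mol \<delta> r \<in> borel_measurable borel" "grad (mol \<delta> r) \<in> borel_measurable borel"
  by (auto simp: borel_measurable_continuous_onI smooth_mol smooth_continuous_on smooth_continuous_on_grad)

end

section \<open>Compactly supported test functions and existence of a mollifier\<close>

lemma test_function_cube:
  assumes "smooth f" "\<And>y. y \<notin> cube r \<Longrightarrow> f y = 0" "cube r \<subseteq> U"
  shows "test_function U f"
proof -
  have "closed (cube r :: 'a set)" by (simp add: cube_def closed_cbox)
  then have "closure {x. f x \<noteq> 0} \<subseteq> cube r"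
    using assms(2) by (intro closure_minimal) auto
  moreover have "bounded (closure {x. f x \<noteq> 0})"
    using calculation bounded_cbox bounded_subset unfolding cube_def by blast
  ultimately show ?thesis
    using assms unfolding test_function_def smooth_def by (auto simp: compact_eq_bounded_closed)
qed

lemma mollifier_exists: "\<exists>K :: 'a::euclidean_space \<Rightarrow> real. mollifier K"
proof -
  obtain f :: "'a \<Rightarrow> real" where f: "smooth f" "\<And>x. f x \<ge> 0" "\<And>x. f x > 0 \<longleftrightarrow> norm x < 1" "\<And>x. f x \<le> 1"
    using smooth_bump_exists by blast
  have [measurable]: "f \<in> borel_measurable borel"
    by (simp add: borel_measurable_continuous_onI f(1) smooth_continuous_on)
  define I where "I = enn2real (\<integral>\<^sup>+x. f x \<partial>lborel)"
  have "(\<integral>\<^sup>+x. f x \<partial>lborel) \<le> (\<integral>\<^sup>+x. indicator (ball (0::'a) 1) x \<partial>lborel)"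
    by (rule nn_integral_mono)
      (use f in \<open>auto simp: indicator_def not_less less_le intro: antisym\<close>)
  also have "\<dots> < \<infinity>"
    using emeasure_lborel_ball_finite[of "0::'a" 1] by (simp add: less_top)
  finally have fin: "(\<integral>\<^sup>+x. f x \<partial>lborel) = ennreal I"
    by (simp add: I_def)
  have "(\<integral>\<^sup>+x. f x \<partial>lborel) \<noteq> 0"
  proof
    assume "(\<integral>\<^sup>+x. f x \<partial>lborel) = 0"
    then have "AE x in lborel. f x = 0"
      using f(2) by (simp add: nn_integral_0_iff_AE antisym_conv)
    then have "AE x in lborel. x \<notin> ball (0::'a) 1"
      by eventually_elim (use f(3) in \<open>auto simp: order_less_le\<close>)
    moreover have "{x. norm x < 1} = ball (0::'a) 1" by auto
    ultimately have "emeasure lborel (ball (0::'a) 1) = 0"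
      by (subst (asm) AE_iff_measurable[OF _ refl]) auto
    then show False
      using content_ball_pos[of 1 "0::'a"] by (simp add: measure_def)
  qed
  then have I: "I > 0"
    using fin by (cases "I > 0") (auto simp: not_less ennreal_neg)
  define K where "K x = (1 / I) * f (1 *\<^sub>R x + 0)" for x
  have "mollifier K"
  proof
    show "smooth K" unfolding K_def[abs_def] by (rule smooth_affine[OF f(1)])
    show "K x \<ge> 0" for x using f(2) I by (simp add: K_def)
    show "K x = 0" if "norm x \<ge> 1" for x
      using f(2)[of x] f(3)[of x] that by (simp add: K_def)
    have "(\<integral>\<^sup>+x. K x \<partial>lborel) = ennreal (1 / I) * (\<integral>\<^sup>+x. f x \<partial>lborel)"
      unfolding K_def using I f(2)
      by (subst nn_integral_cmult[symmetric]) (auto simp: ennreal_mult'[symmetric])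
    also have "\<dots> = 1"
      using I by (simp add: fin ennreal_mult'[symmetric])
    finally show "(\<integral>\<^sup>+x. K x \<partial>lborel) = 1" .
    have "norm (K x) \<le> 1 / I" for x
      using f(2,4) I by (simp add: K_def divide_right_mono)
    then show "bounded (range K)" by (auto simp: bounded_iff)
  qed
  then show ?thesis by blast
qed

subsection \<open>Entropy production\<close>

text \<open>\<open>M\<close> bounds the solutions and the levels at once. The later constants depend
  on the law and the kernel, never on the particular solution; this uniformity is what a blow-up
  needs.\<close>

locale scalar_law = mollifier K for K :: "'a::euclidean_space \<Rightarrow> real" +
  fixes A a :: "real \<Rightarrow> 'a" and M A0 L :: real
  assumes A_deriv: "\<And>v. (A has_vector_derivative a v) (at v)"
    and M_pos: "M > 0" and A0_pos: "A0 > 0" and L_nonneg: "L \<ge> 0"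
    and a_bound: "\<And>v. \<bar>v\<bar> \<le> M \<Longrightarrow> norm (a v) \<le> A0"
    and a_lipschitz: "\<And>v v'. \<bar>v\<bar> \<le> M \<Longrightarrow> \<bar>v'\<bar> \<le> M \<Longrightarrow> norm (a v - a v') \<le> L * \<bar>v - v'\<bar>"
begin

text \<open>
  \<open>flux k\<close> is the entropy flux of \<open>(s - k)\<^sup>+\<close>. Test functions are supported in a fixed cube; other
  scales are reduced to this one by \<open>kruzhkov_affine\<close> below.
\<close>

definition flux :: "real \<Rightarrow> real \<Rightarrow> 'a" where
  "flux k s = A (max s k) - A k"

definition sol :: "('a \<Rightarrow> real) \<Rightarrow> bool" where
  "sol w \<longleftrightarrow> w \<in> borel_measurable borel \<and> (\<forall>x. \<bar>w x\<bar> \<le> M) \<and>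
    (\<forall>k \<phi>. test_function (box (- (2 *\<^sub>R One)) (2 *\<^sub>R One)) \<phi> \<longrightarrow> (\<forall>x. \<phi> x \<ge> 0) \<longrightarrow>
       (\<integral>x. flux k (w x) \<bullet> grad \<phi> x \<partial>lborel) \<ge> 0)"

definition vol_above :: "('a \<Rightarrow> real) \<Rightarrow> real \<Rightarrow> real \<Rightarrow> ennreal" where
  "vol_above w v r = emeasure lborel (cube r \<inter> {x. w x > v})"

text \<open>The mean of the indicators of s > k over k in [v, v + e]; equivalently, the difference
  quotient ((s - v)^+ - (s - v - e)^+) / e of the Kruzhkov entropies.\<close>

definition ramp :: "real \<Rightarrow> real \<Rightarrow> real \<Rightarrow> real" where
  "ramp v e s = (min (max s v) (v + e) - v) / e"

definition flux_max :: real where "flux_max = 2 * M * A0"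

lemma flux_max_nonneg: "flux_max \<ge> 0" using M_pos A0_pos by (simp add: flux_max_def)

lemma sol_borel: "sol w \<Longrightarrow> w \<in> borel_measurable borel"
  and sol_bound: "sol w \<Longrightarrow> \<bar>w x\<bar> \<le> M"
  by (simp_all add: sol_def)

lemma continuous_on_A: "continuous_on S A"
  by (intro continuous_at_imp_continuous_on ballI has_vector_derivative_continuous[OF A_deriv])

lemma borel_flux [measurable]: "flux k \<in> borel_measurable borel"
  unfolding flux_def
  by (intro borel_measurable_continuous_onI continuous_intros continuous_on_compose2[OF continuous_on_A[of UNIV]]) auto

lemma borel_ramp [measurable]: "ramp v e \<in> borel_measurable borel"
  unfolding ramp_def by measurable

lemma ramp_nonneg: "e > 0 \<Longrightarrow> ramp v e s \<ge> 0"
  and ramp_le_1: "e > 0 \<Longrightarrow> ramp v e s \<le> 1"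
  and ramp_le_indicator: "e > 0 \<Longrightarrow> ramp v e s \<le> indicator {v<..} s"
  and indicator_le_ramp: "e > 0 \<Longrightarrow> indicator {v + e<..} s \<le> ramp v e s"
  by (auto simp: ramp_def indicator_def field_simps)

lemma A_diff_bound:
  assumes "\<And>x. x \<in> closed_segment v s \<Longrightarrow> norm (a x - a v) \<le> B"
  shows "norm (A s - A v - (s - v) *\<^sub>R a v) \<le> \<bar>s - v\<bar> * B"
proof -
  have "norm (A s - A v - (s - v) *\<^sub>R a v) \<le> norm (s - v) * B"
    by (rule vector_differentiable_bound_linearization[where S="closed_segment v s"])
      (use assms A_deriv in \<open>auto intro: has_vector_derivative_at_within\<close>)
  then show ?thesis by simp
qed

text \<open>The indicator on the right is the point: the flux vanishes below the level
  \<open>k\<close>, and this makes every later error proportional to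
  \<open>vol_above\<close>.\<close>

lemma norm_flux_le:
  assumes "\<bar>k\<bar> \<le> M" "\<bar>s\<bar> \<le> M"
  shows "norm (flux k s) \<le> flux_max * indicator {k<..} s"
proof (cases "s > k")
  case True
  have "norm (A s - A k) \<le> A0 * norm (s - k)"
  proof (rule differentiable_bound[where S="{-M..M}" and f'="\<lambda>v h. h *\<^sub>R a v"])
    fix v assume "v \<in> {-M..M}"
    then show "onorm (\<lambda>h. h *\<^sub>R a v) \<le> A0"
      using a_bound[of v] by (intro onorm_le) (auto simp: abs_le_iff mult.commute[of A0] intro!: mult_left_mono)
  qed (use assms A_deriv in \<open>auto simp: has_vector_derivative_def abs_le_iff intro: has_derivative_at_withinI\<close>)
  also have "\<dots> \<le> A0 * (2 * M)"
    using assms A0_pos by (intro mult_left_mono) auto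
  finally show ?thesis
    using True by (simp add: flux_def flux_max_def max_def mult_ac)
qed (simp add: flux_def max_def)

text \<open>
  The kinetic equation averaged over the levels in \<open>[v, v + e]\<close>: freezing \<open>a\<close> at \<open>v\<close> costs \<open>O(e)\<close>,
  and the divergence of the frozen flux is a difference of two entropy productions divided by \<open>e\<close>.
\<close>

lemma ramp_flux:
  assumes "e > 0" "\<bar>v\<bar> \<le> M" "\<bar>v + e\<bar> \<le> M" "\<bar>s\<bar> \<le> M"
  shows "norm (ramp v e s *\<^sub>R a v - (1 / e) *\<^sub>R (flux v s - flux (v + e) s)) \<le> L * e * indicator {v<..} s"
proof (cases "s > v")
  case True
  define t where "t = min s (v + e)"
  have t: "v < t" "t \<le> v + e" "\<bar>t\<bar> \<le> M" using True assms by (auto simp: t_def)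
  have seg: "norm (a x - a v) \<le> L * e" if "x \<in> closed_segment v t" for x
  proof -
    have x: "v \<le> x" "x \<le> t" using that t by (auto simp: closed_segment_eq_real_ivl)
    then have "norm (a x - a v) \<le> L * \<bar>x - v\<bar>"
      using t assms by (intro a_lipschitz) auto
    also have "\<dots> \<le> L * e" using x t L_nonneg by (intro mult_left_mono) auto
    finally show ?thesis .
  qed
  have "norm (A t - A v - (t - v) *\<^sub>R a v) \<le> \<bar>t - v\<bar> * (L * e)"
    by (rule A_diff_bound) (use seg t assms in auto)
  also have "\<dots> \<le> e * (L * e)" using t L_nonneg assms by (intro mult_right_mono) auto
  finally have *: "norm (A t - A v - (t - v) *\<^sub>R a v) \<le> e * (L * e)" .
  have "flux v s - flux (v + e) s = A t - A v"
    using True by (auto simp: flux_def t_def max_def min_def)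
  moreover have "ramp v e s = (t - v) / e"
    using True by (simp add: ramp_def t_def max_def)
  ultimately have "ramp v e s *\<^sub>R a v - (1 / e) *\<^sub>R (flux v s - flux (v + e) s)
     = - ((1 / e) *\<^sub>R (A t - A v - (t - v) *\<^sub>R a v))"
    by (simp only:) (simp add: scaleR_diff_right)
  then have "norm (ramp v e s *\<^sub>R a v - (1 / e) *\<^sub>R (flux v s - flux (v + e) s))
     = (1 / e) * norm (A t - A v - (t - v) *\<^sub>R a v)"
    using assms(1) by (simp only: norm_minus_cancel norm_scaleR) simp
  also have "\<dots> \<le> (1 / e) * (e * (L * e))"
    using assms(1) by (intro mult_left_mono *) auto
  finally show ?thesis using True assms(1) by simp
next
  case False
  then show ?thesis using assms by (simp add: flux_def ramp_def max_def)
qed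

lemma integrable_bounded_inner:
  fixes f g :: "'a \<Rightarrow> 'a"
  assumes [measurable]: "g \<in> borel_measurable borel" and "integrable lborel f" "\<And>x. norm (g x) \<le> B"
  shows "integrable lborel (\<lambda>x. g x \<bullet> f x)"
proof (rule Bochner_Integration.integrable_bound)
  show "integrable lborel (\<lambda>x. B * norm (f x))" using assms(2) by simp
  show "AE x in lborel. norm (g x \<bullet> f x) \<le> norm (B * norm (f x))"
  proof (rule AE_I2)
    fix x
    have "norm (g x \<bullet> f x) \<le> norm (g x) * norm (f x)" by (simp add: Cauchy_Schwarz_ineq2)
    also have "\<dots> \<le> B * norm (f x)" by (intro mult_right_mono assms) auto
    finally show "norm (g x \<bullet> f x) \<le> norm (B * norm (f x))" by simp
  qed
qed (use assms(2) borel_measurable_integrable in \<open>auto\<close>)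

text \<open>The distribution - div (flux k (w)) tested against \<phi>. For a solution it is
  nonnegative on nonnegative test functions supported in the fixed box.\<close>

definition entropy_prod :: "('a \<Rightarrow> real) \<Rightarrow> real \<Rightarrow> ('a \<Rightarrow> real) \<Rightarrow> real" where
  "entropy_prod w k \<phi> = (\<integral>y. flux k (w y) \<bullet> grad \<phi> y \<partial>lborel)"

lemma norm_flux_sol: "sol w \<Longrightarrow> \<bar>k\<bar> \<le> M \<Longrightarrow> norm (flux k (w y)) \<le> flux_max"
  using norm_flux_le[of k "w y"] sol_bound[of w y] flux_max_nonneg
  by (cases "k < w y") auto

lemma integrable_flux_grad:
  assumes "sol w" "\<bar>k\<bar> \<le> M" "integrable lborel (grad \<phi>)"
  shows "integrable lborel (\<lambda>y. flux k (w y) \<bullet> grad \<phi> y)"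
proof -
  have [measurable]: "w \<in> borel_measurable borel" using assms(1) by (rule sol_borel)
  show ?thesis
    by (rule integrable_bounded_inner[OF _ assms(3) norm_flux_sol[OF assms(1,2)]]) measurable
qed

lemma ramp_grad_bound:
  assumes w: "sol w" and e: "e > 0" and v: "\<bar>v\<bar> \<le> M" "\<bar>v + e\<bar> \<le> M"
    and \<phi>: "integrable lborel (grad \<phi>)"
    and pos: "entropy_prod w v \<phi> \<ge> 0" "entropy_prod w (v + e) \<phi> \<ge> 0"
  shows "ennreal \<bar>\<integral>y. ramp v e (w y) * (a v \<bullet> grad \<phi> y) \<partial>lborel\<bar>
    \<le> ennreal (1 / e) * (ennreal (entropy_prod w v \<phi>) + ennreal (entropy_prod w (v + e) \<phi>))
      + ennreal (L * e) * (\<integral>\<^sup>+y. indicator {x. w x > v} y * ennreal (norm (grad \<phi> y)) \<partial>lborel)"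
proof -
  have [measurable]: "w \<in> borel_measurable borel" using w by (rule sol_borel)
  have [measurable]: "grad \<phi> \<in> borel_measurable borel"
    using borel_measurable_integrable[OF \<phi>] by simp
  let ?g = "\<lambda>y. ramp v e (w y) *\<^sub>R a v - (1 / e) *\<^sub>R (flux v (w y) - flux (v + e) (w y))"
  have g: "norm (?g y) \<le> L * e * indicator {x. w x > v} y" for y
    using ramp_flux[OF e v sol_bound[OF w, of y]] by (simp add: indicator_def)
  have i1: "integrable lborel (\<lambda>y. (ramp v e (w y) *\<^sub>R a v) \<bullet> grad \<phi> y)"
  proof (rule integrable_bounded_inner[OF _ \<phi>, where B="norm (a v)"])
    show "norm (ramp v e (w y) *\<^sub>R a v) \<le> norm (a v)" for y
      using ramp_nonneg[OF e, of v "w y"] ramp_le_1[OF e, of v "w y"]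
      by (simp add: mult_left_le_one_le)
  qed measurable
  note i2 = integrable_flux_grad[OF w v(1) \<phi>] integrable_flux_grad[OF w v(2) \<phi>]
  have i3: "integrable lborel (\<lambda>y. L * e * (indicator {x. w x > v} y * norm (grad \<phi> y)))"
    using integrable_norm[OF \<phi>]
    by (intro integrable_mult_right integrable_mult_indicator[of _ lborel "\<lambda>y. norm (grad \<phi> y)", simplified]) auto
  have eq: "ramp v e (w y) * (a v \<bullet> grad \<phi> y) = ?g y \<bullet> grad \<phi> y
      + (1 / e) * (flux v (w y) \<bullet> grad \<phi> y - flux (v + e) (w y) \<bullet> grad \<phi> y)" for y
    by (simp add: algebra_simps inner_diff_left)
  have ig: "integrable lborel (\<lambda>y. ?g y \<bullet> grad \<phi> y)"
    using i1 i2 by (simp add: inner_diff_left)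
  have "(\<integral>y. ramp v e (w y) * (a v \<bullet> grad \<phi> y) \<partial>lborel) = (\<integral>y. ?g y \<bullet> grad \<phi> y \<partial>lborel)
      + (1 / e) * (entropy_prod w v \<phi> - entropy_prod w (v + e) \<phi>)"
    unfolding entropy_prod_def eq using ig i2 by simp
  moreover have "\<bar>\<integral>y. ?g y \<bullet> grad \<phi> y \<partial>lborel\<bar> \<le> (\<integral>y. L * e * (indicator {x. w x > v} y * norm (grad \<phi> y)) \<partial>lborel)"
  proof -
    have "norm (\<integral>y. ?g y \<bullet> grad \<phi> y \<partial>lborel) \<le> (\<integral>y. norm (?g y \<bullet> grad \<phi> y) \<partial>lborel)"
      by (rule integral_norm_bound)
    also have "\<dots> \<le> (\<integral>y. L * e * (indicator {x. w x > v} y * norm (grad \<phi> y)) \<partial>lborel)"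
    proof (rule integral_mono[OF integrable_norm[OF ig] i3])
      fix y
      have "norm (?g y \<bullet> grad \<phi> y) \<le> norm (?g y) * norm (grad \<phi> y)" by (simp add: Cauchy_Schwarz_ineq2)
      also have "\<dots> \<le> L * e * indicator {x. w x > v} y * norm (grad \<phi> y)"
        by (intro mult_right_mono g) auto
      finally show "norm (?g y \<bullet> grad \<phi> y) \<le> L * e * (indicator {x. w x > v} y * norm (grad \<phi> y))"
        by (simp add: mult.assoc)
    qed
    finally show ?thesis by simp
  qed
  \<comment> \<open>Only the signs of the two productions enter; no cancellation between
    neighbouring levels is exploited. This is why a factor 1 / e remains.\<close>
  moreover have "\<bar>(1 / e) * (entropy_prod w v \<phi> - entropy_prod w (v + e) \<phi>)\<bar>
     \<le> (1 / e) * (entropy_prod w v \<phi> + entropy_prod w (v + e) \<phi>)"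
    using e pos by (simp add: abs_mult divide_right_mono)
  ultimately have "\<bar>\<integral>y. ramp v e (w y) * (a v \<bullet> grad \<phi> y) \<partial>lborel\<bar>
     \<le> (1 / e) * (entropy_prod w v \<phi> + entropy_prod w (v + e) \<phi>)
       + (\<integral>y. L * e * (indicator {x. w x > v} y * norm (grad \<phi> y)) \<partial>lborel)" by linarith
  then have "ennreal \<bar>\<integral>y. ramp v e (w y) * (a v \<bullet> grad \<phi> y) \<partial>lborel\<bar>
     \<le> ennreal ((1 / e) * (entropy_prod w v \<phi> + entropy_prod w (v + e) \<phi>)
       + (\<integral>y. L * e * (indicator {x. w x > v} y * norm (grad \<phi> y)) \<partial>lborel))" by (rule ennreal_leI)
  also have "\<dots> = ennreal (1 / e) * (ennreal (entropy_prod w v \<phi>) + ennreal (entropy_prod w (v + e) \<phi>))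
       + ennreal (\<integral>y. L * e * (indicator {x. w x > v} y * norm (grad \<phi> y)) \<partial>lborel)"
  proof -
    have "0 \<le> (\<integral>y. L * e * (indicator {x. w x > v} y * norm (grad \<phi> y)) \<partial>lborel)"
      using e L_nonneg by (intro integral_nonneg_AE) auto
    then show ?thesis
      using e pos by (subst ennreal_plus) (auto simp: ennreal_plus ennreal_mult simp del: times_divide_eq_left)
  qed
  also have "ennreal (\<integral>y. L * e * (indicator {x. w x > v} y * norm (grad \<phi> y)) \<partial>lborel)
    = (\<integral>\<^sup>+y. ennreal (L * e * (indicator {x. w x > v} y * norm (grad \<phi> y))) \<partial>lborel)"
    using e L_nonneg by (intro nn_integral_eq_integral[OF i3, symmetric] AE_I2) auto
  also have "\<dots> = (\<integral>\<^sup>+y. ennreal (L * e) * (indicator {x. w x > v} y * ennreal (norm (grad \<phi> y))) \<partial>lborel)"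
    using e L_nonneg by (intro nn_integral_cong) (auto simp: ennreal_mult indicator_def)
  also have "\<dots> = ennreal (L * e) * (\<integral>\<^sup>+y. indicator {x. w x > v} y * ennreal (norm (grad \<phi> y)) \<partial>lborel)"
    by (rule nn_integral_cmult) measurable
  finally show ?thesis .
qed

text \<open>By Fubini the centre \<open>x\<close> can be integrated out first. A kernel centred in
  the cube only sees points of \<open>cube (r + \<delta>)\<close>, and its gradient has L1 norm
  \<open>CK / \<delta>\<close>.\<close>

lemma grad_Ker_double:
  assumes "\<delta> > 0" and [measurable]: "S \<in> sets borel"
  shows "(\<integral>\<^sup>+x. indicator (cube r) x * (\<integral>\<^sup>+y. indicator S y * ennreal (norm (grad (Ker \<delta>) (y - x))) \<partial>lborel) \<partial>lborel)
     \<le> ennreal (CK / \<delta>) * emeasure lborel (cube (r + \<delta>) \<inter> S)"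
proof -
  have "(\<integral>\<^sup>+x. indicator (cube r) x * (\<integral>\<^sup>+y. indicator S y * ennreal (norm (grad (Ker \<delta>) (y - x))) \<partial>lborel) \<partial>lborel)
     = (\<integral>\<^sup>+x. (\<integral>\<^sup>+y. indicator (cube r) x * (indicator S y * ennreal (norm (grad (Ker \<delta>) (y - x)))) \<partial>lborel) \<partial>lborel)"
    by (simp add: nn_integral_cmult)
  also have "\<dots> = (\<integral>\<^sup>+y. (\<integral>\<^sup>+x. indicator (cube r) x * (indicator S y * ennreal (norm (grad (Ker \<delta>) (y - x)))) \<partial>lborel) \<partial>lborel)"
    by (rule lborel_pair.Fubini') measurable
  also have "\<dots> \<le> (\<integral>\<^sup>+y. (\<integral>\<^sup>+x. indicator (cube (r + \<delta>) \<inter> S) y * ennreal (norm (grad (Ker \<delta>) (y - x))) \<partial>lborel) \<partial>lborel)"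
  proof (intro nn_integral_mono)
    fix x y :: 'a
    show "indicator (cube r) x * (indicator S y * ennreal (norm (grad (Ker \<delta>) (y - x))))
      \<le> indicator (cube (r + \<delta>) \<inter> S) y * ennreal (norm (grad (Ker \<delta>) (y - x)))"
    proof (cases "norm (y - x) \<ge> \<delta>")
      case True
      then show ?thesis by (simp add: grad_Ker_zero assms)
    next
      case False
      then show ?thesis
        using cube_add[of x r "y - x" \<delta>] by (auto simp: indicator_def)
    qed
  qed
  also have "\<dots> = (\<integral>\<^sup>+y. indicator (cube (r + \<delta>) \<inter> S) y * ennreal (CK / \<delta>) \<partial>lborel)"
    by (simp add: nn_integral_cmult nn_integral_grad_Ker(2)[OF assms(1)])
  also have "\<dots> = ennreal (CK / \<delta>) * emeasure lborel (cube (r + \<delta>) \<inter> S)"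
    by (subst mult.commute, subst nn_integral_cmult_indicator) auto
  finally show ?thesis .
qed

lemma test_function_Ker:
  assumes d: "\<delta> > 0" and x: "x \<in> cube r" and r: "r + \<delta> < 2"
  shows "test_function (box (- (2 *\<^sub>R One)) (2 *\<^sub>R One)) (\<lambda>y. Ker \<delta> (y - x))"
proof (rule test_function_cube[where r="r + \<delta>"])
  show "Ker \<delta> (y - x) = 0" if "y \<notin> cube (r + \<delta>)" for y
    using that cube_add[OF x, of "y - x" \<delta>] Ker_zero[OF d, of "y - x"] by fastforce
qed (use cube_subset_box[OF r] smooth_Ker_shift in auto)

lemma entropy_prod_nonneg:
  assumes "sol w" "test_function (box (- (2 *\<^sub>R One)) (2 *\<^sub>R One)) \<phi>" "\<And>x. \<phi> x \<ge> 0"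
  shows "entropy_prod w k \<phi> \<ge> 0"
  using assms by (simp add: sol_def entropy_prod_def)

lemma integrable_grad_mol: "\<delta> > 0 \<Longrightarrow> integrable lborel (grad (mol \<delta> r))"
proof -
  assume d: "\<delta> > 0"
  have "(\<integral>\<^sup>+y. norm (grad (mol \<delta> r) y) \<partial>lborel) \<le> (\<integral>\<^sup>+y. ennreal (CK / \<delta>) * indicator (cube (r + \<delta>)) (y :: 'a) \<partial>lborel)"
    using norm_grad_mol[OF d, of r] grad_mol_zero[OF d, of _ r]
    by (intro nn_integral_mono) (auto simp: indicator_def ennreal_leI)
  also have "\<dots> < \<infinity>"
    using emeasure_cube_finite[of "r + \<delta>", where 'a='a]
    by (simp add: nn_integral_cmult_indicator ennreal_mult_less_top)
  finally show ?thesis by (simp add: integrable_iff_bounded)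
qed

lemma integrable_double:
  assumes d: "\<delta> > 0" and [measurable]: "g \<in> borel_measurable borel" and g: "\<And>y. norm (g y) \<le> B"
  shows "integrable (lborel \<Otimes>\<^sub>M lborel) (\<lambda>(x, y). indicator (cube r) x * (g y \<bullet> grad (Ker \<delta>) (y - x)))"
proof -
  have B: "B \<ge> 0" using order_trans[OF norm_ge_zero g] .
  have "(\<integral>\<^sup>+p. norm (case p of (x, y) \<Rightarrow> indicator (cube r) x * (g y \<bullet> grad (Ker \<delta>) (y - x))) \<partial>(lborel \<Otimes>\<^sub>M lborel))
     = (\<integral>\<^sup>+x. (\<integral>\<^sup>+y. norm (indicator (cube r) x * (g y \<bullet> grad (Ker \<delta>) (y - x))) \<partial>lborel) \<partial>lborel)"
    by (subst lborel.nn_integral_fst[symmetric]) auto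
  also have "\<dots> \<le> (\<integral>\<^sup>+x. (\<integral>\<^sup>+y. indicator (cube r) x * (ennreal B * norm (grad (Ker \<delta>) (y - x))) \<partial>lborel) \<partial>lborel)"
  proof (intro nn_integral_mono)
    fix x y
    have "\<bar>g y \<bullet> grad (Ker \<delta>) (y - x)\<bar> \<le> norm (g y) * norm (grad (Ker \<delta>) (y - x))"
      by (rule Cauchy_Schwarz_ineq2)
    also have "\<dots> \<le> B * norm (grad (Ker \<delta>) (y - x))" by (intro mult_right_mono g) auto
    finally show "ennreal (norm (indicator (cube r) x * (g y \<bullet> grad (Ker \<delta>) (y - x))))
       \<le> indicator (cube r) x * (ennreal B * norm (grad (Ker \<delta>) (y - x)))"
      using B by (auto simp: indicator_def ennreal_mult[symmetric] intro: ennreal_leI)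
  qed
  also have "\<dots> = (\<integral>\<^sup>+x. ennreal (B * (CK / \<delta>)) * indicator (cube r) (x :: 'a) \<partial>lborel)"
    using B CK(1) d
    by (simp add: nn_integral_cmult nn_integral_grad_Ker(1) ennreal_mult mult.commute
      del: times_divide_eq_right times_divide_eq_left)
  also have "\<dots> < \<infinity>"
    using emeasure_cube_finite[of r, where 'a='a]
    by (simp add: nn_integral_cmult_indicator ennreal_mult_less_top)
  finally show ?thesis
    by (subst integrable_iff_bounded) auto
qed

text \<open>
  The entropy production is a positive functional, so its average over the kernels centred in the
  cube is at most its value at a cutoff function whose gradient is of order \<open>1 / \<rho>\<close>.
\<close>

lemma entropy_prod_average:
  assumes w: "sol w" and k: "\<bar>k\<bar> \<le> M" and d: "\<delta> > 0" and rho: "\<rho> > 0" and r: "r + \<delta> + 2 * \<rho> < 2"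
  shows "(\<integral>\<^sup>+x. indicator (cube r) x * ennreal (entropy_prod w k (\<lambda>y. Ker \<delta> (y - x))) \<partial>lborel)
     \<le> ennreal (flux_max * CK / \<rho>) * vol_above w k (r + \<delta> + 2 * \<rho>)"
proof -
  have [measurable]: "w \<in> borel_measurable borel" using w by (rule sol_borel)
  let ?U = "box (- (2 *\<^sub>R One)) (2 *\<^sub>R One :: 'a)"
  \<comment> \<open>The radius makes \<zeta> equal to 1 on \<open>cube (r + \<delta>)\<close>, off
    which \<open>mol \<delta> r\<close> vanishes, and equal to 0 off
    \<open>cube (r + \<delta> + 2 * \<rho>)\<close>. The difference of the two is then an admissible
    nonnegative test function.\<close>
  define \<zeta> where "\<zeta> = mol \<rho> (r + \<delta> + \<rho>)"
  let ?g = "\<lambda>y. flux k (w y)"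
  let ?F = "\<lambda>x y. indicator (cube r) x * (?g y \<bullet> grad (Ker \<delta>) (y - x)) :: real"
  have int: "integrable (lborel \<Otimes>\<^sub>M lborel) (\<lambda>(x, y). ?F x y)"
    by (rule integrable_double[OF d _ norm_flux_sol[OF w k]]) measurable
  have prod_eq: "indicator (cube r) x * entropy_prod w k (\<lambda>y. Ker \<delta> (y - x)) = (\<integral>y. ?F x y \<partial>lborel)" for x
    by (simp add: entropy_prod_def grad_Ker_shift)
  have nonneg: "indicator (cube r) x * entropy_prod w k (\<lambda>y. Ker \<delta> (y - x)) \<ge> 0" for x
    using entropy_prod_nonneg[OF w test_function_Ker[OF d, of x r]] Ker_nonneg[OF d] r rho
    by (auto simp: indicator_def)
  have "(\<integral>\<^sup>+x. indicator (cube r) x * ennreal (entropy_prod w k (\<lambda>y. Ker \<delta> (y - x))) \<partial>lborel)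
     = (\<integral>\<^sup>+x. ennreal (\<integral>y. ?F x y \<partial>lborel) \<partial>lborel)"
    unfolding prod_eq[symmetric] by (intro nn_integral_cong) (auto simp: indicator_def)
  also have "\<dots> = ennreal (\<integral>x. (\<integral>y. ?F x y \<partial>lborel) \<partial>lborel)"
    using lborel_pair.integrable_fst'[OF int] nonneg
    by (intro nn_integral_eq_integral) (auto simp: prod_eq)
  also have "(\<integral>x. (\<integral>y. ?F x y \<partial>lborel) \<partial>lborel) = (\<integral>y. (\<integral>x. ?F x y \<partial>lborel) \<partial>lborel)"
    by (rule lborel_pair.Fubini_integral[OF int, symmetric])
  also have "\<dots> = entropy_prod w k (mol \<delta> r)"
    unfolding entropy_prod_def
  proof (rule Bochner_Integration.integral_cong[OF refl])
    fix y
    show "(\<integral>x. ?F x y \<partial>lborel) = ?g y \<bullet> grad (mol \<delta> r) y"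
      using grad_mol_inner[OF d, of r y "?g y"] by (simp add: inner_commute)
  qed
  also have "\<dots> \<le> entropy_prod w k \<zeta>"
  proof -
    have "entropy_prod w k (\<lambda>y. \<zeta> y - mol \<delta> r y) \<ge> 0"
    proof (rule entropy_prod_nonneg[OF w])
      show "\<zeta> y - mol \<delta> r y \<ge> 0" for y
      proof (cases "y \<in> cube (r + \<delta>)")
        case True
        then have "\<zeta> y = 1" unfolding \<zeta>_def by (intro mol_eq_1 rho) simp
        then show ?thesis using mol_le_1[OF d] by simp
      next
        case False
        then show ?thesis using mol_eq_0[OF d False] mol_nonneg[OF rho] by (simp add: \<zeta>_def)
      qed
      show "test_function ?U (\<lambda>y. \<zeta> y - mol \<delta> r y)"
      proof (rule test_function_cube[where r="r + \<delta> + 2 * \<rho>"])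
        show "smooth (\<lambda>y. \<zeta> y - mol \<delta> r y)"
          unfolding \<zeta>_def by (intro smooth_diff smooth_mol)
        show "\<zeta> y - mol \<delta> r y = 0" if "y \<notin> cube (r + \<delta> + 2 * \<rho>)" for y
        proof -
          have "r + \<delta> + \<rho> + \<rho> = r + \<delta> + 2 * \<rho>" by simp
          then have "\<zeta> y = 0" unfolding \<zeta>_def using that by (intro mol_eq_0 rho) metis
          moreover have "mol \<delta> r y = 0"
            using that rho cube_mono[of "r + \<delta>" "r + \<delta> + 2 * \<rho>"] by (intro mol_eq_0 d) auto
          ultimately show ?thesis by simp
        qed
      qed (use cube_subset_box[OF r] in auto)
    qed
    also have "entropy_prod w k (\<lambda>y. \<zeta> y - mol \<delta> r y) = entropy_prod w k \<zeta> - entropy_prod w k (mol \<delta> r)"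
      unfolding entropy_prod_def \<zeta>_def
      using integrable_flux_grad[OF w k integrable_grad_mol[OF rho]] integrable_flux_grad[OF w k integrable_grad_mol[OF d]]
      by (simp add: smooth_diff(2) smooth_mol inner_diff_right)
    finally show ?thesis by simp
  qed
  also have "ennreal (entropy_prod w k \<zeta>) \<le> (\<integral>\<^sup>+y. ennreal (flux_max * CK / \<rho>) * indicator (cube (r + \<delta> + 2 * \<rho>) \<inter> {x. w x > k}) y \<partial>lborel)"
  proof -
    have "ennreal (entropy_prod w k \<zeta>) \<le> ennreal (norm (entropy_prod w k \<zeta>))"
      by (rule ennreal_leI) simp
    also have "\<dots> \<le> (\<integral>\<^sup>+y. norm (?g y \<bullet> grad \<zeta> y) \<partial>lborel)"
      unfolding entropy_prod_def \<zeta>_def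
      by (intro integral_norm_bound_ennreal integrable_flux_grad w k integrable_grad_mol rho)
    also have "\<dots> \<le> (\<integral>\<^sup>+y. ennreal (flux_max * CK / \<rho>) * indicator (cube (r + \<delta> + 2 * \<rho>) \<inter> {x. w x > k}) y \<partial>lborel)"
    proof (rule nn_integral_mono)
      fix y
      have "norm (?g y \<bullet> grad \<zeta> y) \<le> norm (?g y) * norm (grad \<zeta> y)" by (simp add: Cauchy_Schwarz_ineq2)
      also have "\<dots> \<le> (flux_max * indicator {k<..} (w y)) * (CK / \<rho> * indicator (cube (r + \<delta> + 2 * \<rho>)) y)"
      proof (intro mult_mono)
        have "r + \<delta> + \<rho> + \<rho> = r + \<delta> + 2 * \<rho>" by simp
        then have "grad \<zeta> y = 0" if "y \<notin> cube (r + \<delta> + 2 * \<rho>)"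
          using that grad_mol_zero[OF rho, of y "r + \<delta> + \<rho>"] by (simp only: \<zeta>_def simp_thms)
        then show "norm (grad \<zeta> y) \<le> CK / \<rho> * indicator (cube (r + \<delta> + 2 * \<rho>)) y"
          using norm_grad_mol[OF rho, of "r + \<delta> + \<rho>" y] by (auto simp: indicator_def \<zeta>_def)
      qed (use norm_flux_le[OF k sol_bound[OF w]] flux_max_nonneg in \<open>auto simp: indicator_def\<close>)
      finally show "ennreal (norm (?g y \<bullet> grad \<zeta> y)) \<le> ennreal (flux_max * CK / \<rho>) * indicator (cube (r + \<delta> + 2 * \<rho>) \<inter> {x. w x > k}) y"
        by (auto simp: indicator_def intro: ennreal_leI split: if_splits)
    qed
    finally show ?thesis .
  qed
  also have "\<dots> = ennreal (flux_max * CK / \<rho>) * vol_above w k (r + \<delta> + 2 * \<rho>)"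
    unfolding vol_above_def by (subst nn_integral_cmult_indicator) auto
  finally show ?thesis by (simp add: ennreal_leI order_trans)
qed

end

subsection \<open>Transport along characteristics\<close>

lemma nn_integral_cube_shift:
  fixes f :: "'a::euclidean_space \<Rightarrow> ennreal"
  assumes [measurable]: "f \<in> borel_measurable borel" and "norm z \<le> c"
  shows "(\<integral>\<^sup>+x. indicator (cube r) x * f (x + z) \<partial>lborel) \<le> (\<integral>\<^sup>+x. indicator (cube (r + c)) x * f x \<partial>lborel)"
proof -
  have "(\<integral>\<^sup>+x. indicator (cube r) x * f (x + z) \<partial>lborel) \<le> (\<integral>\<^sup>+x. indicator (cube (r + c)) (z + x) * f (z + x) \<partial>lborel)"
    using cube_add[OF _ assms(2)] by (intro nn_integral_mono) (auto simp: indicator_def add.commute[of z])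
  also have "\<dots> = (\<integral>\<^sup>+x. indicator (cube (r + c)) x * f x \<partial>lborel)"
    by (rule nn_integral_lborel_translate) measurable
  finally show ?thesis .
qed

context mollifier
begin

definition avg :: "real \<Rightarrow> ('a \<Rightarrow> real) \<Rightarrow> 'a \<Rightarrow> real" where
  "avg \<delta> h x = (\<integral>y. Ker \<delta> (y - x) * h y \<partial>lborel)"

lemma borel_avg [measurable (raw)]:
  assumes [measurable]: "h \<in> borel_measurable borel"
  shows "avg \<delta> h \<in> borel_measurable borel"
  unfolding avg_def by measurable

lemma borel_avg_compose [measurable (raw)]:
  assumes "h \<in> borel_measurable borel" "f \<in> N \<rightarrow>\<^sub>M borel"
  shows "(\<lambda>x. avg \<delta> h (f x)) \<in> borel_measurable N"
  using measurable_compose[OF assms(2) borel_avg[OF assms(1)]] .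

lemma integrable_Ker_mult:
  assumes d: "\<delta> > 0" and [measurable]: "h \<in> borel_measurable borel" and h: "\<And>y. \<bar>h y\<bar> \<le> B"
  shows "integrable lborel (\<lambda>y. Ker \<delta> (y - x) * h y)"
proof (rule Bochner_Integration.integrable_bound)
  show "integrable lborel (\<lambda>y. B * Ker \<delta> (y - x))" using integrable_Ker(1)[OF d] by simp
  show "AE y in lborel. norm (Ker \<delta> (y - x) * h y) \<le> norm (B * Ker \<delta> (y - x))"
  proof (rule AE_I2)
    fix y
    have "Ker \<delta> (y - x) * \<bar>h y\<bar> \<le> Ker \<delta> (y - x) * \<bar>B\<bar>"
      by (intro mult_left_mono order_trans[OF h abs_ge_self] Ker_nonneg d)
    then show "norm (Ker \<delta> (y - x) * h y) \<le> norm (B * Ker \<delta> (y - x))"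
      using Ker_nonneg[OF d, of "y - x"] by (simp add: abs_mult mult.commute)
  qed
qed measurable

lemma avg_mono:
  assumes d: "\<delta> > 0" and "h \<in> borel_measurable borel" "g \<in> borel_measurable borel"
    and "\<And>y. \<bar>h y\<bar> \<le> 1" "\<And>y. \<bar>g y\<bar> \<le> 1" "\<And>y. h y \<le> g y"
  shows "avg \<delta> h x \<le> avg \<delta> g x"
  unfolding avg_def
  by (intro integral_mono integrable_Ker_mult[where B=1] mult_left_mono Ker_nonneg assms)

lemma avg_nonneg:
  assumes d: "\<delta> > 0" and "\<And>y. h y \<ge> 0"
  shows "avg \<delta> h x \<ge> 0"
  unfolding avg_def using assms by (intro integral_nonneg_AE) (auto simp: Ker_nonneg)

lemma avg_shift:
  assumes [measurable]: "h \<in> borel_measurable borel"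
  shows "avg \<delta> h x = (\<integral>z. Ker \<delta> z * h (x + z) \<partial>lborel)"
  unfolding avg_def using integral_lborel_affine[of "\<lambda>y. Ker \<delta> (y - x) * h y" 1 x] by simp

lemma Ker_transport:
  "Ker \<delta> (y - (x + z)) - Ker \<delta> (y - x)
     = - (\<integral>s. (z \<bullet> grad (Ker \<delta>) (y - (x + s *\<^sub>R z))) * indicator {0..1} s \<partial>lborel)"
proof -
  have "(\<integral>s. (- (z \<bullet> grad (Ker \<delta>) (y - (x + s *\<^sub>R z)))) * indicator {0..1} s \<partial>lborel)
     = Ker \<delta> (y - (x + 1 *\<^sub>R z)) - Ker \<delta> (y - (x + 0 *\<^sub>R z))"
  proof (rule integral_FTC_Icc_real)
    fix s :: real
    have "((\<lambda>s. Ker \<delta> (y - (x + s *\<^sub>R z))) has_derivative (\<lambda>h. grad (Ker \<delta>) (y - (x + s *\<^sub>R z)) \<bullet> (- (h *\<^sub>R z)))) (at s)"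
      by (rule has_derivative_compose[OF _ smooth_grad_has_derivative[OF smooth_Ker]])
        (auto intro!: derivative_eq_intros)
    then show "((\<lambda>s. Ker \<delta> (y - (x + s *\<^sub>R z))) has_real_derivative - (z \<bullet> grad (Ker \<delta>) (y - (x + s *\<^sub>R z)))) (at s)"
      unfolding has_field_derivative_def
      by (rule has_derivative_eq_rhs) (simp add: fun_eq_iff inner_commute)
    have "continuous_on UNIV (\<lambda>s. - (z \<bullet> grad (Ker \<delta>) (y - (x + s *\<^sub>R z))))"
      by (intro continuous_intros continuous_on_compose2[OF continuous_on_grad_Ker[of UNIV]]) auto
    then show "isCont (\<lambda>s. - (z \<bullet> grad (Ker \<delta>) (y - (x + s *\<^sub>R z)))) s"
      by (simp add: continuous_on_eq_continuous_at)
  qed simp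
  then show ?thesis by simp
qed

text \<open>Translating the average is the same as translating the kernel, which is differentiated
  along the segment from \<open>x\<close> to \<open>x + z\<close>. All derivatives fall on the
  kernel, so \<open>h\<close> need only be bounded and measurable.\<close>

lemma avg_transport:
  assumes d: "\<delta> > 0" and [measurable]: "h \<in> borel_measurable borel" and h: "\<And>y. \<bar>h y\<bar> \<le> 1"
  shows "ennreal \<bar>avg \<delta> h (x + z) - avg \<delta> h x\<bar>
    \<le> (\<integral>\<^sup>+s. indicator {0..1} s * ennreal \<bar>\<integral>y. h y * (z \<bullet> grad (Ker \<delta>) (y - (x + s *\<^sub>R z))) \<partial>lborel\<bar> \<partial>lborel)"
proof -
  let ?F = "\<lambda>s y. indicator {0..1} s * (h y * (z \<bullet> grad (Ker \<delta>) (y - (x + s *\<^sub>R z))))"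
  have int: "integrable (lborel \<Otimes>\<^sub>M lborel) (\<lambda>(s, y). ?F s y)"
  proof -
    have "(\<integral>\<^sup>+p. norm (case p of (s, y) \<Rightarrow> ?F s y) \<partial>(lborel \<Otimes>\<^sub>M lborel))
       = (\<integral>\<^sup>+s. (\<integral>\<^sup>+y. norm (?F s y) \<partial>lborel) \<partial>lborel)"
      by (subst lborel.nn_integral_fst[symmetric]) auto
    also have "\<dots> \<le> (\<integral>\<^sup>+s. (\<integral>\<^sup>+y. indicator {0..1} s * (ennreal (norm z) * norm (grad (Ker \<delta>) (y - (x + s *\<^sub>R z)))) \<partial>lborel) \<partial>lborel)"
    proof (intro nn_integral_mono)
      fix s y
      have "\<bar>h y\<bar> * \<bar>z \<bullet> grad (Ker \<delta>) (y - (x + s *\<^sub>R z))\<bar> \<le> 1 * (norm z * norm (grad (Ker \<delta>) (y - (x + s *\<^sub>R z))))"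
        by (intro mult_mono h Cauchy_Schwarz_ineq2) auto
      then show "ennreal (norm (?F s y)) \<le> indicator {0..1} s * (ennreal (norm z) * norm (grad (Ker \<delta>) (y - (x + s *\<^sub>R z))))"
        by (auto simp: indicator_def ennreal_mult[symmetric] abs_mult intro: ennreal_leI)
    qed
    also have "\<dots> = (\<integral>\<^sup>+s. ennreal (norm z * (CK / \<delta>)) * indicator {0..1::real} s \<partial>lborel)"
      using CK(1) d
      by (simp add: nn_integral_cmult nn_integral_grad_Ker(1) ennreal_mult mult.commute
        del: times_divide_eq_right times_divide_eq_left)
    also have "\<dots> < \<infinity>"
      by (simp add: nn_integral_cmult_indicator)
    finally show ?thesis
      by (subst integrable_iff_bounded) auto
  qed
  have "avg \<delta> h (x + z) - avg \<delta> h x = (\<integral>y. (Ker \<delta> (y - (x + z)) - Ker \<delta> (y - x)) * h y \<partial>lborel)"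
    unfolding avg_def using integrable_Ker_mult[OF d _ h]
    by (simp add: left_diff_distrib)
  also have "\<dots> = (\<integral>y. - (\<integral>s. ?F s y \<partial>lborel) \<partial>lborel)"
  proof (intro Bochner_Integration.integral_cong refl)
    fix y
    have "(\<integral>s. ?F s y \<partial>lborel) = (\<integral>s. ((z \<bullet> grad (Ker \<delta>) (y - (x + s *\<^sub>R z))) * indicator {0..1} s) * h y \<partial>lborel)"
      by (intro Bochner_Integration.integral_cong) (auto simp: mult_ac)
    also have "\<dots> = (\<integral>s. (z \<bullet> grad (Ker \<delta>) (y - (x + s *\<^sub>R z))) * indicator {0..1} s \<partial>lborel) * h y"
      by (rule integral_mult_left_zero)
    finally show "(Ker \<delta> (y - (x + z)) - Ker \<delta> (y - x)) * h y = - (\<integral>s. ?F s y \<partial>lborel)"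
      unfolding Ker_transport by simp
  qed
  also have "\<dots> = - (\<integral>y. (\<integral>s. ?F s y \<partial>lborel) \<partial>lborel)" by simp
  also have "(\<integral>y. (\<integral>s. ?F s y \<partial>lborel) \<partial>lborel) = (\<integral>s. (\<integral>y. ?F s y \<partial>lborel) \<partial>lborel)"
    by (rule lborel_pair.Fubini_integral[OF int])
  finally have "ennreal \<bar>avg \<delta> h (x + z) - avg \<delta> h x\<bar> = ennreal (norm (\<integral>s. (\<integral>y. ?F s y \<partial>lborel) \<partial>lborel))"
    by simp
  also have "\<dots> \<le> (\<integral>\<^sup>+s. norm (\<integral>y. ?F s y \<partial>lborel) \<partial>lborel)"
    using lborel_pair.integrable_fst'[OF int] by (intro integral_norm_bound_ennreal) simp
  also have "\<dots> = (\<integral>\<^sup>+s. indicator {0..1} s * ennreal \<bar>\<integral>y. h y * (z \<bullet> grad (Ker \<delta>) (y - (x + s *\<^sub>R z))) \<partial>lborel\<bar> \<partial>lborel)"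
    by (intro nn_integral_cong) (auto simp: indicator_def)
  finally show ?thesis .
qed

end

context scalar_law
begin

lemma vol_above_mono:
  assumes "sol w" "r \<le> r'" "v' \<le> v"
  shows "vol_above w v r \<le> vol_above w v' r'"
proof -
  have [measurable]: "w \<in> borel_measurable borel" using assms(1) by (rule sol_borel)
  show ?thesis
    unfolding vol_above_def by (rule emeasure_mono) (use cube_mono[OF assms(2)] assms(3) in auto)
qed

text \<open>The first summand comes from two entropy productions, each of size
  \<open>flux_max * CK / \<rho>\<close> per unit of volume, divided by the window width
  \<open>e\<close>. The second is the cost \<open>L * e\<close> of freezing the velocity, times the
  L1 norm \<open>CK / \<delta>\<close> of the kernel gradient. The window must not be too narrow for
  the first nor too wide for the second.\<close>

definition Err :: "real \<Rightarrow> real \<Rightarrow> real \<Rightarrow> real" where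
  "Err \<delta> e \<rho> = (1 / e) * (2 * (flux_max * CK / \<rho>)) + L * e * (CK / \<delta>)"

lemma Err_nonneg: "\<delta> > 0 \<Longrightarrow> e > 0 \<Longrightarrow> \<rho> > 0 \<Longrightarrow> Err \<delta> e \<rho> \<ge> 0"
  using CK(1) flux_max_nonneg L_nonneg by (simp add: Err_def)

text \<open>Integrates \<open>ramp_grad_bound\<close> over the centres in the cube. The production
  at the upper level \<open>v + e\<close> is charged to the volume above \<open>v\<close>, which is
  larger.\<close>

lemma directional_bound:
  assumes w: "sol w" and e: "e > 0" and v: "\<bar>v\<bar> \<le> M" "\<bar>v + e\<bar> \<le> M"
    and d: "\<delta> > 0" and rho: "\<rho> > 0" and r: "r + \<delta> + 2 * \<rho> < 2"
  shows "(\<integral>\<^sup>+x. indicator (cube r) x * ennreal \<bar>\<integral>y. ramp v e (w y) * (a v \<bullet> grad (Ker \<delta>) (y - x)) \<partial>lborel\<bar> \<partial>lborel)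
     \<le> ennreal (Err \<delta> e \<rho>) * vol_above w v (r + \<delta> + 2 * \<rho>)"
proof -
  have [measurable]: "w \<in> borel_measurable borel" using w by (rule sol_borel)
  have [measurable]: "(\<lambda>x. entropy_prod w k (\<lambda>y. Ker \<delta> (y - x))) \<in> borel_measurable borel" for k
    unfolding entropy_prod_def grad_Ker_shift by measurable
  let ?W = "vol_above w v (r + \<delta> + 2 * \<rho>)"
  let ?m = "\<lambda>k x. ennreal (entropy_prod w k (\<lambda>y. Ker \<delta> (y - x)))"
  let ?N = "\<lambda>x. \<integral>\<^sup>+y. indicator {x. w x > v} y * ennreal (norm (grad (Ker \<delta>) (y - x))) \<partial>lborel"
  have "(\<integral>\<^sup>+x. indicator (cube r) x * ennreal \<bar>\<integral>y. ramp v e (w y) * (a v \<bullet> grad (Ker \<delta>) (y - x)) \<partial>lborel\<bar> \<partial>lborel)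
     \<le> (\<integral>\<^sup>+x. ennreal (1 / e) * (indicator (cube r) x * ?m v x + indicator (cube r) x * ?m (v + e) x)
         + ennreal (L * e) * (indicator (cube r) x * ?N x) \<partial>lborel)"
  proof (rule nn_integral_mono)
    fix x
    show "indicator (cube r) x * ennreal \<bar>\<integral>y. ramp v e (w y) * (a v \<bullet> grad (Ker \<delta>) (y - x)) \<partial>lborel\<bar>
      \<le> ennreal (1 / e) * (indicator (cube r) x * ?m v x + indicator (cube r) x * ?m (v + e) x)
         + ennreal (L * e) * (indicator (cube r) x * ?N x)"
    proof (cases "x \<in> cube r")
      case True
      have t: "test_function (box (- (2 *\<^sub>R One)) (2 *\<^sub>R One)) (\<lambda>y. Ker \<delta> (y - x))"
        using r rho by (intro test_function_Ker[OF d True]) simp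
      have g: "grad (\<lambda>y. Ker \<delta> (y - x)) = (\<lambda>y. grad (Ker \<delta>) (y - x))"
        by (intro ext grad_Ker_shift)
      have "integrable lborel (grad (\<lambda>y. Ker \<delta> (y - x)))"
        unfolding g by (rule integrable_grad_Ker(1)[OF d])
      from ramp_grad_bound[OF w e v this entropy_prod_nonneg[OF w t Ker_nonneg[OF d]]
          entropy_prod_nonneg[OF w t Ker_nonneg[OF d]]]
      show ?thesis using True by (simp add: g)
    qed simp
  qed
  also have "\<dots> = ennreal (1 / e) * ((\<integral>\<^sup>+x. indicator (cube r) x * ?m v x \<partial>lborel) + (\<integral>\<^sup>+x. indicator (cube r) x * ?m (v + e) x \<partial>lborel))
         + ennreal (L * e) * (\<integral>\<^sup>+x. indicator (cube r) x * ?N x \<partial>lborel)"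
    by (simp add: nn_integral_add nn_integral_cmult)
  also have "\<dots> \<le> ennreal (1 / e) * (ennreal (flux_max * CK / \<rho>) * ?W + ennreal (flux_max * CK / \<rho>) * ?W)
         + ennreal (L * e) * (ennreal (CK / \<delta>) * ?W)"
  proof (intro add_mono mult_left_mono)
    show "(\<integral>\<^sup>+x. indicator (cube r) x * ?m v x \<partial>lborel) \<le> ennreal (flux_max * CK / \<rho>) * ?W"
      by (rule entropy_prod_average[OF w v(1) d rho r])
    have "(\<integral>\<^sup>+x. indicator (cube r) x * ?m (v + e) x \<partial>lborel) \<le> ennreal (flux_max * CK / \<rho>) * vol_above w (v + e) (r + \<delta> + 2 * \<rho>)"
      by (rule entropy_prod_average[OF w v(2) d rho r])
    also have "\<dots> \<le> ennreal (flux_max * CK / \<rho>) * ?W"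
      using e by (intro mult_left_mono vol_above_mono w) auto
    finally show "(\<integral>\<^sup>+x. indicator (cube r) x * ?m (v + e) x \<partial>lborel) \<le> ennreal (flux_max * CK / \<rho>) * ?W" .
    have "(\<integral>\<^sup>+x. indicator (cube r) x * ?N x \<partial>lborel) \<le> ennreal (CK / \<delta>) * vol_above w v (r + \<delta>)"
      unfolding vol_above_def by (rule grad_Ker_double[OF d]) measurable
    also have "\<dots> \<le> ennreal (CK / \<delta>) * ?W"
      using rho by (intro mult_left_mono vol_above_mono w) auto
    finally show "(\<integral>\<^sup>+x. indicator (cube r) x * ?N x \<partial>lborel) \<le> ennreal (CK / \<delta>) * ?W" .
  qed auto
  also have "\<dots> = ennreal (Err \<delta> e \<rho>) * ?W"
  proof -
    define p where "p = flux_max * CK / \<rho>"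
    define q where "q = CK / \<delta>"
    have pq: "p \<ge> 0" "q \<ge> 0" using flux_max_nonneg CK(1) d rho by (simp_all add: p_def q_def)
    have "ennreal (Err \<delta> e \<rho>) = ennreal (1 / e) * (ennreal p + ennreal p) + ennreal (L * e) * ennreal q"
      unfolding Err_def p_def[symmetric] q_def[symmetric]
      using e L_nonneg pq by (subst ennreal_plus) (auto simp: ennreal_mult ennreal_plus[symmetric] simp del: ennreal_plus times_divide_eq_left)
    then show ?thesis
      unfolding p_def[symmetric] q_def[symmetric] by (simp add: distrib_right distrib_left mult.assoc)
  qed
  finally show ?thesis .
qed

text \<open>The directional bound is applied at every point of the segment from \<open>x\<close> to
  its translate. The radius therefore grows by \<open>c\<close>, a bound for the length of that
  segment.\<close>

lemma transport:
  assumes w: "sol w" and e: "e > 0" and v: "\<bar>v\<bar> \<le> M" "\<bar>v + e\<bar> \<le> M"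
    and d: "\<delta> > 0" and rho: "\<rho> > 0" and c: "\<bar>t\<bar> * A0 \<le> c" and r: "r + c + \<delta> + 2 * \<rho> < 2"
  shows "(\<integral>\<^sup>+x. indicator (cube r) x * ennreal \<bar>avg \<delta> (\<lambda>y. ramp v e (w y)) (x + t *\<^sub>R a v) - avg \<delta> (\<lambda>y. ramp v e (w y)) x\<bar> \<partial>lborel)
     \<le> ennreal (\<bar>t\<bar> * Err \<delta> e \<rho>) * vol_above w v (r + c + \<delta> + 2 * \<rho>)"
proof -
  have [measurable]: "w \<in> borel_measurable borel" using w by (rule sol_borel)
  let ?h = "\<lambda>y. ramp v e (w y)"
  let ?D = "\<lambda>x. ennreal \<bar>\<integral>y. ?h y * (a v \<bullet> grad (Ker \<delta>) (y - x)) \<partial>lborel\<bar>"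
  have h: "\<bar>?h y\<bar> \<le> 1" for y
    using ramp_nonneg[OF e, of v "w y"] ramp_le_1[OF e, of v "w y"] by simp
  have "(\<integral>\<^sup>+x. indicator (cube r) x * ennreal \<bar>avg \<delta> ?h (x + t *\<^sub>R a v) - avg \<delta> ?h x\<bar> \<partial>lborel)
     \<le> (\<integral>\<^sup>+x. indicator (cube r) x * (\<integral>\<^sup>+s. indicator {0..1} s * (ennreal \<bar>t\<bar> * ?D (x + s *\<^sub>R (t *\<^sub>R a v))) \<partial>lborel) \<partial>lborel)"
  proof (intro nn_integral_mono mult_left_mono)
    fix x
    have "ennreal \<bar>avg \<delta> ?h (x + t *\<^sub>R a v) - avg \<delta> ?h x\<bar>
       \<le> (\<integral>\<^sup>+s. indicator {0..1} s * ennreal \<bar>\<integral>y. ?h y * ((t *\<^sub>R a v) \<bullet> grad (Ker \<delta>) (y - (x + s *\<^sub>R (t *\<^sub>R a v)))) \<partial>lborel\<bar> \<partial>lborel)"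
      by (rule avg_transport[OF d _ h]) measurable
    also have "\<dots> = (\<integral>\<^sup>+s. indicator {0..1} s * (ennreal \<bar>t\<bar> * ?D (x + s *\<^sub>R (t *\<^sub>R a v))) \<partial>lborel)"
    proof (intro nn_integral_cong)
      fix s :: real
      have "(\<integral>y. ?h y * ((t *\<^sub>R a v) \<bullet> grad (Ker \<delta>) (y - (x + s *\<^sub>R (t *\<^sub>R a v)))) \<partial>lborel)
        = t * (\<integral>y. ?h y * (a v \<bullet> grad (Ker \<delta>) (y - (x + s *\<^sub>R (t *\<^sub>R a v)))) \<partial>lborel)"
        by (subst integral_mult_right_zero[symmetric]) (simp add: mult_ac)
      then show "indicator {0..1} s * ennreal \<bar>\<integral>y. ?h y * ((t *\<^sub>R a v) \<bullet> grad (Ker \<delta>) (y - (x + s *\<^sub>R (t *\<^sub>R a v)))) \<partial>lborel\<bar>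
        = indicator {0..1} s * (ennreal \<bar>t\<bar> * ?D (x + s *\<^sub>R (t *\<^sub>R a v)))"
        by (simp only: abs_mult) (simp add: ennreal_mult)
    qed
    finally show "ennreal \<bar>avg \<delta> ?h (x + t *\<^sub>R a v) - avg \<delta> ?h x\<bar>
       \<le> (\<integral>\<^sup>+s. indicator {0..1} s * (ennreal \<bar>t\<bar> * ?D (x + s *\<^sub>R (t *\<^sub>R a v))) \<partial>lborel)" .
  qed simp
  also have "\<dots> = (\<integral>\<^sup>+x. (\<integral>\<^sup>+s. indicator {0..1} s * (ennreal \<bar>t\<bar> * (indicator (cube r) x * ?D (x + s *\<^sub>R (t *\<^sub>R a v)))) \<partial>lborel) \<partial>lborel)"
    by (subst nn_integral_cmult[symmetric]) (auto simp: mult_ac)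
  also have "\<dots> = (\<integral>\<^sup>+s. (\<integral>\<^sup>+x. indicator {0..1} s * (ennreal \<bar>t\<bar> * (indicator (cube r) x * ?D (x + s *\<^sub>R (t *\<^sub>R a v)))) \<partial>lborel) \<partial>lborel)"
    by (rule lborel_pair.Fubini') measurable
  also have "\<dots> = (\<integral>\<^sup>+s. indicator {0..1} s * (ennreal \<bar>t\<bar> * (\<integral>\<^sup>+x. indicator (cube r) x * ?D (x + s *\<^sub>R (t *\<^sub>R a v)) \<partial>lborel)) \<partial>lborel)"
    by (simp add: nn_integral_cmult)
  also have "\<dots> \<le> (\<integral>\<^sup>+s. (ennreal \<bar>t\<bar> * (ennreal (Err \<delta> e \<rho>) * vol_above w v (r + c + \<delta> + 2 * \<rho>))) * indicator {0..1} s \<partial>(lborel :: real measure))"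
  proof (rule nn_integral_mono)
    fix s :: real
    show "indicator {0..1} s * (ennreal \<bar>t\<bar> * (\<integral>\<^sup>+x. indicator (cube r) x * ?D (x + s *\<^sub>R (t *\<^sub>R a v)) \<partial>lborel))
      \<le> (ennreal \<bar>t\<bar> * (ennreal (Err \<delta> e \<rho>) * vol_above w v (r + c + \<delta> + 2 * \<rho>))) * indicator {0..1} s"
    proof (cases "s \<in> {0..1}")
      case True
      have "norm (s *\<^sub>R (t *\<^sub>R a v)) \<le> 1 * (\<bar>t\<bar> * A0)"
        unfolding norm_scaleR using True a_bound[OF v(1)] by (intro mult_mono) auto
      then have "(\<integral>\<^sup>+x. indicator (cube r) x * ?D (x + s *\<^sub>R (t *\<^sub>R a v)) \<partial>lborel)
        \<le> (\<integral>\<^sup>+x. indicator (cube (r + c)) x * ?D x \<partial>lborel)"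
        using c by (intro nn_integral_cube_shift) auto
      also have "\<dots> \<le> ennreal (Err \<delta> e \<rho>) * vol_above w v (r + c + \<delta> + 2 * \<rho>)"
        by (rule directional_bound[OF w e v d rho]) (use r in simp)
      finally show ?thesis using True by (simp add: mult_left_mono)
    qed simp
  qed
  also have "\<dots> = ennreal \<bar>t\<bar> * (ennreal (Err \<delta> e \<rho>) * vol_above w v (r + c + \<delta> + 2 * \<rho>))"
    by (subst nn_integral_cmult_indicator) auto
  also have "\<dots> = ennreal (\<bar>t\<bar> * Err \<delta> e \<rho>) * vol_above w v (r + c + \<delta> + 2 * \<rho>)"
    using Err_nonneg[OF d e rho] by (simp add: ennreal_mult mult.assoc)
  finally show ?thesis .
qed

end

subsection \<open>Propagation between levels in all directions\<close>

text \<open>\<open>ennreal\<close> sends negative numbers to 0, so this is the subadditivity of the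
  positive part, with the first part weakened to an absolute value.\<close>

lemma ennreal_add_le: "ennreal (p + q) \<le> ennreal \<bar>p\<bar> + ennreal q"
proof (cases "q \<ge> 0")
  case True
  then have "ennreal \<bar>p\<bar> + ennreal q = ennreal (\<bar>p\<bar> + q)" by simp
  then show ?thesis by (simp add: ennreal_leI)
next
  case False
  then have "ennreal (p + q) \<le> ennreal \<bar>p\<bar>" by (intro ennreal_leI) simp
  then show ?thesis by (simp add: add_increasing2)
qed

definition above :: "('a \<Rightarrow> real) \<Rightarrow> real \<Rightarrow> 'a \<Rightarrow> real" where
  "above w v y = indicator {v<..} (w y)"

lemma borel_above [measurable (raw)]: "w \<in> borel_measurable M \<Longrightarrow> above w v \<in> borel_measurable M"
  unfolding above_def by measurable

lemma above_abs: "\<bar>above w v y\<bar> \<le> 1" and above_nonneg: "above w v y \<ge> 0"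
  by (auto simp: above_def)

context mollifier
begin

text \<open>Truncation by \<open>ennreal\<close> makes this one-sided: it counts only how much the
  mollified set {w > v} exceeds the translate by \<open>z\<close> of the mollified set {w > v'}. It
  is used with v above v'.\<close>

definition deficit :: "real \<Rightarrow> ('a \<Rightarrow> real) \<Rightarrow> real \<Rightarrow> real \<Rightarrow> 'a \<Rightarrow> real \<Rightarrow> ennreal" where
  "deficit \<delta> w v v' z r =
    (\<integral>\<^sup>+x. indicator (cube r) x * ennreal (avg \<delta> (above w v) x - avg \<delta> (above w v') (x + z)) \<partial>lborel)"

end

context scalar_law
begin

text \<open>
  Induction on the dimension of the space of admissible translations: the next velocity is taken
  from a window above all the levels used so far, where (GN) provides one transversal to the space
  already reached. The inequality is one-sided because the sets \<open>{w > v}\<close> decrease in \<open>v\<close>.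
\<close>

lemma chain:
  fixes v0 h \<beta> :: real
  assumes w: "sol w" and d: "\<delta> > 0" and e: "e > 0" and rho: "\<rho> > 0" and th: "\<theta> > 0" and h: "h \<ge> 0"
    and v0: "- M \<le> v0" "v0 + DIM('a) * h \<le> M" and R0: "R0 < 2"
    and beta: "\<beta> = 1 + (A0 + 1) / \<theta>"
    and nondeg: "\<And>v \<xi>. v0 \<le> v \<Longrightarrow> v + h \<le> v0 + DIM('a) * h \<Longrightarrow> norm \<xi> = 1 \<Longrightarrow>
        \<exists>v'. v \<le> v' \<and> v' + e \<le> v + h \<and> \<theta> \<le> \<bar>a v' \<bullet> \<xi>\<bar>"
    and r: "r + DIM('a) * \<beta> ^ DIM('a) * norm z + \<delta> + 2 * \<rho> \<le> R0"
  shows "deficit \<delta> w (v0 + DIM('a) * h) v0 z r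
      \<le> ennreal (DIM('a) * \<beta> ^ DIM('a) * norm z * Err \<delta> e \<rho>) * vol_above w v0 R0"
proof -
  \<comment> \<open>\<open>S\<close> is spanned by the velocities found so far. The number
    \<open>j * \<beta> ^ j\<close> controls both the distance travelled and the accumulated error:
    splitting off one more direction enlarges the components by a factor of at most \<beta>.\<close>
  have "\<exists>S. subspace S \<and> dim S = j \<and> (\<forall>z\<in>S. \<forall>r. r + j * \<beta> ^ j * norm z + \<delta> + 2 * \<rho> \<le> R0 \<longrightarrow>
    deficit \<delta> w (v0 + j * h) v0 z r
      \<le> ennreal (j * \<beta> ^ j * norm z * Err \<delta> e \<rho>) * vol_above w v0 R0)" if "j \<le> DIM('a)" for j
    using that
  proof (induction j)
    case 0
    show ?case
      by (rule exI[of _ "{0}"]) (simp add: subspace_single_0 deficit_def)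
  next
    case (Suc j)
    have [measurable]: "w \<in> borel_measurable borel" using w by (rule sol_borel)
    from Suc obtain S where S: "subspace S" "dim S = j"
      and IH: "\<And>z r. z \<in> S \<Longrightarrow> r + j * \<beta> ^ j * norm z + \<delta> + 2 * \<rho> \<le> R0 \<Longrightarrow>
      deficit \<delta> w (v0 + j * h) v0 z r
        \<le> ennreal (j * \<beta> ^ j * norm z * Err \<delta> e \<rho>) * vol_above w v0 R0"
      by auto
    have span_S: "span S = S" using S(1) span_eq_iff by blast
    \<comment> \<open>A unit normal \<xi> of \<open>S\<close> is the direction handed to the
      nondegeneracy hypothesis. The velocity obtained has a component of size at least \<theta>
      outside \<open>S\<close>, which keeps the coefficients of the decomposition under
      control.\<close>
    have "dim S < DIM('a)" using S Suc.prems by simp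
    then obtain \<xi>' where xi': "\<xi>' \<noteq> 0" "\<And>y. y \<in> span S \<Longrightarrow> orthogonal \<xi>' y"
      using orthogonal_to_subspace_exists by blast
    define \<xi> where "\<xi> = \<xi>' /\<^sub>R norm \<xi>'"
    have xi: "norm \<xi> = 1" "\<And>y. y \<in> S \<Longrightarrow> y \<bullet> \<xi> = 0"
      using xi' span_base by (auto simp: \<xi>_def orthogonal_def inner_commute)
    have jle: "v0 + Suc j * h \<le> v0 + DIM('a) * h"
      using Suc.prems h by (simp only: add_le_cancel_left) (intro mult_right_mono, auto simp del: of_nat_Suc)
    obtain v' where v': "v0 + j * h \<le> v'" "v' + e \<le> v0 + j * h + h" "\<theta> \<le> \<bar>a v' \<bullet> \<xi>\<bar>"
      using nondeg[of "v0 + j * h" \<xi>] jle h xi(1) by (auto simp: algebra_simps)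
    have v'M: "\<bar>v'\<bar> \<le> M" "\<bar>v' + e\<bar> \<le> M"
    proof -
      have "0 \<le> j * h" using h by simp
      then have "v0 \<le> v'" using v' by linarith
      moreover have "v' + e \<le> M" using v'(2) jle v0(2) by (simp add: algebra_simps)
      ultimately show "\<bar>v'\<bar> \<le> M" "\<bar>v' + e\<bar> \<le> M" using v0 e by auto
    qed
    define b where "b = a v'"
    have bxi: "\<theta> \<le> \<bar>b \<bullet> \<xi>\<bar>" using v' by (simp add: b_def)
    have b_le: "norm b \<le> A0" using a_bound[OF v'M(1)] by (simp add: b_def)
    have b_notin: "b \<notin> S" using xi(2)[of b] bxi th by auto
    have beta1: "\<beta> \<ge> 1" using beta A0_pos th by simp
    let ?S = "span (insert b S)"
    have "subspace ?S" by (rule subspace_span)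
    moreover have "dim ?S = Suc j"
      using b_notin S dim_insert[of b S] span_S by (simp add: dim_span)
    moreover have "deficit \<delta> w (v0 + Suc j * h) v0 z r
        \<le> ennreal (Suc j * \<beta> ^ Suc j * norm z * Err \<delta> e \<rho>) * vol_above w v0 R0"
      if z: "z \<in> ?S" and r: "r + Suc j * \<beta> ^ Suc j * norm z + \<delta> + 2 * \<rho> \<le> R0" for z r
    proof -
      obtain t where t: "z - t *\<^sub>R b \<in> S"
        using z span_S by (auto simp: span_breakdown_eq)
      define s where "s = z - t *\<^sub>R b"
      have "z \<bullet> \<xi> = t * (b \<bullet> \<xi>)"
        using xi(2)[OF t] by (simp add: inner_diff_left)
      then have "\<bar>t\<bar> * \<bar>b \<bullet> \<xi>\<bar> \<le> norm z"
        using Cauchy_Schwarz_ineq2[of z \<xi>] xi(1) by (simp add: abs_mult)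
      moreover have "\<bar>t\<bar> * \<theta> \<le> \<bar>t\<bar> * \<bar>b \<bullet> \<xi>\<bar>" by (intro mult_left_mono bxi) auto
      ultimately have t1: "\<bar>t\<bar> \<le> norm z / \<theta>" using th by (simp add: field_simps)
      have t2: "\<bar>t\<bar> * A0 \<le> norm z / \<theta> * A0" by (rule mult_right_mono[OF t1]) (use A0_pos in simp)
      \<comment> \<open>The three summands of \<beta> are made for three bounds: on
        \<open>t\<close>, on the length \<open>\<bar>t\<bar> * A0\<close> of the step along
        \<open>b\<close>, and on the remainder \<open>s\<close>.\<close>
      have beta_z: "\<beta> * norm z = norm z + norm z / \<theta> * A0 + norm z / \<theta>"
        using th by (simp add: beta field_simps)
      have zt: "norm z / \<theta> \<ge> 0" "norm z / \<theta> * A0 \<ge> 0" using th A0_pos by auto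
      have t\<beta>: "\<bar>t\<bar> \<le> \<beta> * norm z" "\<bar>t\<bar> * A0 \<le> \<beta> * norm z"
        using t1 t2 zt norm_ge_zero[of z] unfolding beta_z by linarith+
      have ntb: "norm (t *\<^sub>R b) \<le> \<bar>t\<bar> * A0" using b_le by (simp add: mult_left_mono)
      then have tb: "norm (t *\<^sub>R b) \<le> \<beta> * norm z" using t\<beta>(2) by linarith
      have s\<beta>: "norm s \<le> \<beta> * norm z"
        using norm_triangle_ineq4[of z "t *\<^sub>R b"] ntb t2 zt unfolding s_def beta_z by linarith
      have z_eq: "z = t *\<^sub>R b + s" by (simp add: s_def)
      have pow1: "\<beta> * norm z \<le> \<beta> ^ Suc j * norm z"
        using beta1 self_le_power[of \<beta> "Suc j"] by (intro mult_right_mono) auto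
      have pow2: "j * \<beta> ^ j * norm s \<le> j * \<beta> ^ Suc j * norm z"
      proof -
        have "j * \<beta> ^ j * norm s \<le> j * \<beta> ^ j * (\<beta> * norm z)"
          using beta1 by (intro mult_left_mono s\<beta>) auto
        then show ?thesis by (simp add: mult_ac)
      qed
      have sum_le: "\<beta> * norm z + j * \<beta> ^ j * norm s \<le> Suc j * \<beta> ^ Suc j * norm z"
        using pow1 pow2 by (simp add: distrib_right)
      let ?T = "\<lambda>y. ramp v' e (w y)"
      have T: "\<bar>?T y\<bar> \<le> 1" for y
        using ramp_nonneg[OF e, of v' "w y"] ramp_le_1[OF e, of v' "w y"] by simp
      \<comment> \<open>The ramp over [v', v' + e] is squeezed between the indicators at the levels
        \<open>v0 + Suc j * h\<close> and \<open>v0 + j * h\<close>. The ramp is what can be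
        transported along \<open>b\<close>; the remainder \<open>s\<close> is left to the induction
        hypothesis at the lower level.\<close>
      have lower: "avg \<delta> (above w (v0 + Suc j * h)) x \<le> avg \<delta> ?T x" for x
      proof (rule avg_mono[OF d _ _ above_abs T])
        fix y
        have "above w (v0 + Suc j * h) y \<le> indicator {v' + e<..} (w y)"
          using v'(2) by (auto simp: above_def indicator_def algebra_simps)
        also have "\<dots> \<le> ?T y" by (rule indicator_le_ramp[OF e])
        finally show "above w (v0 + Suc j * h) y \<le> ?T y" .
      qed measurable
      have upper: "avg \<delta> ?T x \<le> avg \<delta> (above w (v0 + j * h)) x" for x
      proof (rule avg_mono[OF d _ _ T above_abs])
        fix y
        have "?T y \<le> indicator {v'<..} (w y)" by (rule ramp_le_indicator[OF e])
        also have "\<dots> \<le> above w (v0 + j * h) y" using v'(1) by (auto simp: above_def indicator_def)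
        finally show "?T y \<le> above w (v0 + j * h) y" .
      qed measurable
      let ?G = "\<lambda>x. ennreal (avg \<delta> (above w (v0 + j * h)) x - avg \<delta> (above w v0) (x + s))"
      let ?P = "\<lambda>x. ennreal \<bar>avg \<delta> ?T (x + t *\<^sub>R b) - avg \<delta> ?T x\<bar>"
      have "deficit \<delta> w (v0 + Suc j * h) v0 z r
        \<le> (\<integral>\<^sup>+x. indicator (cube r) x * ?P x + indicator (cube r) x * ?G (x + t *\<^sub>R b) \<partial>lborel)"
      unfolding deficit_def
      proof (rule nn_integral_mono)
        fix x
        have "avg \<delta> (above w (v0 + Suc j * h)) x - avg \<delta> (above w v0) (x + z)
           \<le> - (avg \<delta> ?T (x + t *\<^sub>R b) - avg \<delta> ?T x)
             + (avg \<delta> (above w (v0 + j * h)) (x + t *\<^sub>R b) - avg \<delta> (above w v0) (x + z))"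
          using lower[of x] upper[of "x + t *\<^sub>R b"] by simp
        then have "ennreal (avg \<delta> (above w (v0 + Suc j * h)) x - avg \<delta> (above w v0) (x + z))
          \<le> ennreal (- (avg \<delta> ?T (x + t *\<^sub>R b) - avg \<delta> ?T x)
             + (avg \<delta> (above w (v0 + j * h)) (x + t *\<^sub>R b) - avg \<delta> (above w v0) (x + z)))"
          by (rule ennreal_leI)
        also have "\<dots> \<le> ennreal \<bar>- (avg \<delta> ?T (x + t *\<^sub>R b) - avg \<delta> ?T x)\<bar>
          + ennreal (avg \<delta> (above w (v0 + j * h)) (x + t *\<^sub>R b) - avg \<delta> (above w v0) (x + z))"
          by (rule ennreal_add_le)
        also have "\<dots> = ?P x + ?G (x + t *\<^sub>R b)"
          by (simp only: abs_minus_cancel z_eq add.assoc)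
        finally show "indicator (cube r) x * ennreal (avg \<delta> (above w (v0 + Suc j * h)) x - avg \<delta> (above w v0) (x + z))
          \<le> indicator (cube r) x * ?P x + indicator (cube r) x * ?G (x + t *\<^sub>R b)"
          by (auto simp: indicator_def)
      qed
      also have "\<dots> = (\<integral>\<^sup>+x. indicator (cube r) x * ?P x \<partial>lborel) + (\<integral>\<^sup>+x. indicator (cube r) x * ?G (x + t *\<^sub>R b) \<partial>lborel)"
        by (rule nn_integral_add) measurable
      also have "\<dots> \<le> ennreal (\<beta> * norm z * Err \<delta> e \<rho>) * vol_above w v0 R0 + ennreal (j * \<beta> ^ j * norm s * Err \<delta> e \<rho>) * vol_above w v0 R0"
      proof (rule add_mono)
        have jn: "0 \<le> j * \<beta> ^ j * norm s" using beta1 by simp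
        have rc: "r + \<beta> * norm z + \<delta> + 2 * \<rho> \<le> R0" using r sum_le jn by linarith
        have "(\<integral>\<^sup>+x. indicator (cube r) x * ?P x \<partial>lborel) \<le> ennreal (\<bar>t\<bar> * Err \<delta> e \<rho>) * vol_above w v' (r + \<beta> * norm z + \<delta> + 2 * \<rho>)"
          unfolding b_def by (rule transport[OF w e v'M d rho t\<beta>(2)]) (use rc R0 in linarith)
        also have "\<dots> \<le> ennreal (\<beta> * norm z * Err \<delta> e \<rho>) * vol_above w v0 R0"
        proof (intro mult_mono vol_above_mono w rc)
          show "v0 \<le> v'" using v'(1) h by (meson le_add_same_cancel1 mult_nonneg_nonneg of_nat_0_le_iff order_trans)
          show "ennreal (\<bar>t\<bar> * Err \<delta> e \<rho>) \<le> ennreal (\<beta> * norm z * Err \<delta> e \<rho>)"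
            by (intro ennreal_leI mult_right_mono t\<beta>(1) Err_nonneg d e rho)
        qed auto
        finally show "(\<integral>\<^sup>+x. indicator (cube r) x * ?P x \<partial>lborel) \<le> ennreal (\<beta> * norm z * Err \<delta> e \<rho>) * vol_above w v0 R0" .
        have "(\<integral>\<^sup>+x. indicator (cube r) x * ?G (x + t *\<^sub>R b) \<partial>lborel)
           \<le> (\<integral>\<^sup>+x. indicator (cube (r + \<beta> * norm z)) x * ?G x \<partial>lborel)"
          by (rule nn_integral_cube_shift[OF _ tb]) measurable
        also have "\<dots> \<le> ennreal (j * \<beta> ^ j * norm s * Err \<delta> e \<rho>) * vol_above w v0 R0"
          by (rule IH[unfolded deficit_def]) (use t r sum_le in \<open>auto simp: s_def\<close>)
        finally show "(\<integral>\<^sup>+x. indicator (cube r) x * ?G (x + t *\<^sub>R b) \<partial>lborel)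
           \<le> ennreal (j * \<beta> ^ j * norm s * Err \<delta> e \<rho>) * vol_above w v0 R0" .
      qed
      also have "\<dots> = ennreal ((\<beta> * norm z + j * \<beta> ^ j * norm s) * Err \<delta> e \<rho>) * vol_above w v0 R0"
        using beta1 Err_nonneg[OF d e rho] by (simp add: distrib_right)
      also have "\<dots> \<le> ennreal (Suc j * \<beta> ^ Suc j * norm z * Err \<delta> e \<rho>) * vol_above w v0 R0"
        by (intro mult_right_mono ennreal_leI sum_le Err_nonneg d e rho) auto
      finally show ?thesis .
    qed
    ultimately show ?case by blast
  qed
  from this[OF order_refl] obtain S where S: "subspace S" "dim S = DIM('a)"
    and *: "\<forall>z\<in>S. \<forall>r. r + DIM('a) * \<beta> ^ DIM('a) * norm z + \<delta> + 2 * \<rho> \<le> R0 \<longrightarrow>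
      deficit \<delta> w (v0 + DIM('a) * h) v0 z r \<le> ennreal (DIM('a) * \<beta> ^ DIM('a) * norm z * Err \<delta> e \<rho>) * vol_above w v0 R0" by blast
  have "S = UNIV"
    using S dim_eq_full[of S] span_eq_iff[of S] by auto
  then show ?thesis using * r by blast
qed

end

locale nonlinear_law = scalar_law K A a M A0 L
  for K :: "'a::euclidean_space \<Rightarrow> real" and A a M A0 L +
  fixes k0 k1 C \<alpha> :: real
  assumes k_bounds: "- M \<le> k0" "k1 \<le> M" and \<alpha>: "0 < \<alpha>" "\<alpha> \<le> 1" and C_pos: "C > 0"
    and GN: "\<And>\<xi> \<theta>. norm \<xi> = 1 \<Longrightarrow> \<theta> > 0 \<Longrightarrow>
      emeasure lborel {v \<in> {k0..k1}. \<bar>a v \<bullet> \<xi>\<bar> < \<theta>} \<le> ennreal (C * \<theta> powr \<alpha>)"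
begin

lemma continuous_on_a: "continuous_on {-M..M} a"
proof -
  have "\<exists>d>0. \<forall>x'\<in>{-M..M}. dist x' x < d \<longrightarrow> dist (a x') (a x) < e" if "x \<in> {-M..M}" "e > 0" for x e
  proof (intro exI[of _ "e / (L + 1)"] conjI ballI impI)
    show "e / (L + 1) > 0" using that L_nonneg by simp
    fix x' assume x': "x' \<in> {-M..M}" "dist x' x < e / (L + 1)"
    have "dist (a x') (a x) \<le> L * \<bar>x' - x\<bar>"
      unfolding dist_norm using x' that by (intro a_lipschitz) auto
    also have "\<dots> \<le> (L + 1) * \<bar>x' - x\<bar>" by (simp add: mult_right_mono)
    also have "\<dots> < e" using x'(2) L_nonneg by (simp add: dist_real_def pos_less_divide_eq mult.commute)
    finally show "dist (a x') (a x) < e" .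
  qed
  then show ?thesis unfolding continuous_on_iff by blast
qed

text \<open>Otherwise the whole interval [v, v + h - e] would consist of bad levels, and its length
  h - e exceeds what (GN) grants them.\<close>

lemma nondegenerate_velocity:
  assumes "k0 \<le> v" "v + h \<le> k1" "norm \<xi> = 1" "\<theta> > 0" "e \<le> h" "C * \<theta> powr \<alpha> < h - e" "e > 0"
  shows "\<exists>v'. v \<le> v' \<and> v' + e \<le> v + h \<and> \<theta> \<le> \<bar>a v' \<bullet> \<xi>\<bar>"
proof (rule ccontr)
  assume "\<not> ?thesis"
  then have sub: "{v..v + h - e} \<subseteq> {v \<in> {k0..k1}. \<bar>a v \<bullet> \<xi>\<bar> < \<theta>}"
    using assms by (fastforce simp: not_le)
  have "continuous_on {k0..k1} (\<lambda>v. \<bar>a v \<bullet> \<xi>\<bar>)"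
    using continuous_on_subset[OF continuous_on_a] k_bounds by (intro continuous_intros) auto
  then have "closed ({k0..k1} \<inter> (\<lambda>v. \<bar>a v \<bullet> \<xi>\<bar>) -` {\<theta>..})"
    by (intro continuous_closed_preimage) auto
  then have "{k0..k1} - ({k0..k1} \<inter> (\<lambda>v. \<bar>a v \<bullet> \<xi>\<bar>) -` {\<theta>..}) \<in> sets lborel" by auto
  moreover have "{k0..k1} - ({k0..k1} \<inter> (\<lambda>v. \<bar>a v \<bullet> \<xi>\<bar>) -` {\<theta>..}) = {v \<in> {k0..k1}. \<bar>a v \<bullet> \<xi>\<bar> < \<theta>}" by auto
  ultimately have "emeasure lborel {v..v + h - e} \<le> emeasure lborel {v \<in> {k0..k1}. \<bar>a v \<bullet> \<xi>\<bar> < \<theta>}"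
    by (intro emeasure_mono sub) simp
  also have "\<dots> \<le> ennreal (C * \<theta> powr \<alpha>)" by (rule GN[OF assms(3,4)])
  finally have "ennreal (h - e) \<le> ennreal (C * \<theta> powr \<alpha>)" using assms by simp
  then show False using assms C_pos by simp
qed

text \<open>
  Here \<open>e = sqrt \<delta>\<close> balances the two terms of \<open>Err\<close>, and \<open>\<sigma>\<close> is chosen so small that the loss
  in the inverse of the velocity matrix, a power of \<open>\<delta> powr (- \<sigma>)\<close>, still leaves \<open>\<delta> powr (1/4)\<close>.
\<close>

lemma level_translation:
  "\<exists>\<sigma>>0. \<exists>C1>0. \<exists>\<delta>1>0. \<delta>1 \<le> 1 \<and> \<sigma> \<le> 1 \<and> (\<forall>w \<delta> z v r. sol w \<longrightarrow> 0 < \<delta> \<longrightarrow> \<delta> < \<delta>1 \<longrightarrow> norm z \<le> 2 * \<delta> \<longrightarrow>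
     k0 \<le> v \<longrightarrow> v + \<delta> powr \<sigma> \<le> k1 \<longrightarrow> r + 4 * \<delta> powr \<sigma> < 2 \<longrightarrow>
     deficit \<delta> w (v + \<delta> powr \<sigma>) v z r
      \<le> ennreal (C1 * \<delta> powr (1/4)) * vol_above w v (r + 4 * \<delta> powr \<sigma>))"
proof -
  define n where "n = real DIM('a)"
  have n1: "n \<ge> 1" by (simp add: n_def DIM_ge_Suc0)
  \<comment> \<open>With the level gap \<open>h = \<delta> powr \<sigma> / n\<close>, (GN) allows
    \<theta> of order \<delta> powr (\<sigma> / \<alpha>), so \<open>\<beta> ^ DIM('a)\<close> is of
    order \<delta> powr (- \<sigma> * n / \<alpha>). This \<sigma> turns that power into \<delta>
    powr (\<sigma> - 1/4). Multiplied by \<open>norm z\<close>, of order \<delta>, and by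
    \<open>Err\<close>, of order \<delta> powr (- 1/2 - \<sigma>), it leaves \<delta> powr
    (1/4).\<close>
  define \<sigma> where "\<sigma> = 1 / (4 * (n / \<alpha> + 1))"
  have na: "n / \<alpha> \<ge> 1" using n1 \<alpha> by (simp add: field_simps)
  have \<sigma>: "\<sigma> > 0" "\<sigma> \<le> 1 / 8" "\<sigma> * (n / \<alpha>) = 1 / 4 - \<sigma>"
  proof -
    have "4 * (n / \<alpha> + 1) \<ge> 8" using na by simp
    then show "\<sigma> > 0" "\<sigma> \<le> 1 / 8" unfolding \<sigma>_def by (simp_all only: zero_less_divide_iff) (auto intro!: divide_left_mono)
    have "\<sigma> * (n / \<alpha> + 1) = 1 / 4" using na by (simp add: \<sigma>_def)
    then have "\<sigma> * (n / \<alpha>) + \<sigma> = 1 / 4" by (simp only: distrib_left mult_1_right)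
    then show "\<sigma> * (n / \<alpha>) = 1 / 4 - \<sigma>" by linarith
  qed
  \<comment> \<open>Makes \<open>C * \<theta> powr \<alpha>\<close> equal to \<open>h / 4\<close>.
    As \<open>e \<le> h / 2\<close>, this lies below \<open>h - e\<close>, which
    \<open>nondegenerate_velocity\<close> requires.\<close>
  define c\<theta> where "c\<theta> = (1 / (4 * n * C)) powr (1 / \<alpha>)"
  have c\<theta>: "c\<theta> > 0" "c\<theta> powr \<alpha> = 1 / (4 * n * C)"
    using n1 C_pos \<alpha> by (simp_all add: c\<theta>_def powr_powr)
  define c\<beta> where "c\<beta> = 1 + (A0 + 1) / c\<theta>"
  have c\<beta>: "c\<beta> \<ge> 1" using c\<theta> A0_pos by (simp add: c\<beta>_def)
  define E0 where "E0 = 2 * (flux_max * CK) + L * CK + 1"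
  have E0: "E0 > 0" using flux_max_nonneg CK(1) L_nonneg by (simp add: E0_def add_nonneg_pos)
  define C1 where "C1 = 2 * n * c\<beta> ^ DIM('a) * E0"
  have C1: "C1 > 0" using n1 c\<beta> E0 by (simp add: C1_def)
  have small: "\<exists>d>0. \<forall>x. 0 < x \<and> x < d \<longrightarrow> x powr p \<le> c" if "p > 0" "c > 0" for p c :: real
  proof (intro exI[of _ "c powr (1 / p)"] conjI allI impI)
    fix x assume "0 < x \<and> x < c powr (1 / p)"
    then have "x powr p \<le> (c powr (1 / p)) powr p" using that by (intro powr_mono2) auto
    then show "x powr p \<le> c" using that by (simp add: powr_powr)
  qed (use that in auto)
  \<comment> \<open>\<open>d1\<close> keeps the total displacement of the chain below \<delta> powr
    \<sigma>; \<open>d2\<close> keeps the window \<open>e\<close> below half of the level gap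
    \<open>h\<close>.\<close>
  obtain d1 where d1: "d1 > 0" "\<And>x. 0 < x \<Longrightarrow> x < d1 \<Longrightarrow> x powr (3 / 4) \<le> 1 / (2 * n * c\<beta> ^ DIM('a))"
    using small[of "3 / 4" "1 / (2 * n * c\<beta> ^ DIM('a))"] n1 c\<beta> by auto
  obtain d2 where d2: "d2 > 0" "\<And>x. 0 < x \<Longrightarrow> x < d2 \<Longrightarrow> x powr (1 / 2 - \<sigma>) \<le> 1 / (2 * n)"
    using small[of "1 / 2 - \<sigma>" "1 / (2 * n)"] n1 \<sigma> by auto
  define \<delta>1 where "\<delta>1 = min 1 (min d1 d2)"
  have main: "deficit \<delta> w (v + \<delta> powr \<sigma>) v z r
      \<le> ennreal (C1 * \<delta> powr (1/4)) * vol_above w v (r + 4 * \<delta> powr \<sigma>)"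
    if w: "sol w" and d: "0 < \<delta>" "\<delta> < \<delta>1" and z: "norm z \<le> 2 * \<delta>"
      and v: "k0 \<le> v" "v + \<delta> powr \<sigma> \<le> k1" and r: "r + 4 * \<delta> powr \<sigma> < 2" for w \<delta> z v r
  proof -
    have dle: "\<delta> < 1" "\<delta> < d1" "\<delta> < d2" using d by (auto simp: \<delta>1_def)
    define h where "h = \<delta> powr \<sigma> / n"
    define e where "e = \<delta> powr (1 / 2)"
    define \<theta> where "\<theta> = c\<theta> * \<delta> powr (\<sigma> / \<alpha>)"
    define \<beta> where "\<beta> = 1 + (A0 + 1) / \<theta>"
    have pos: "h > 0" "e > 0" "\<theta> > 0" "\<delta> powr \<sigma> > 0" using d n1 c\<theta> by (auto simp: h_def e_def \<theta>_def)
    have nh: "n * h = \<delta> powr \<sigma>" using n1 by (simp add: h_def)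
    have e_le: "e \<le> h / 2"
    proof -
      have "e = \<delta> powr (1 / 2 - \<sigma>) * \<delta> powr \<sigma>" by (simp add: e_def powr_add[symmetric])
      also have "\<dots> \<le> 1 / (2 * n) * \<delta> powr \<sigma>" by (intro mult_right_mono d2 d dle) auto
      finally show ?thesis by (simp add: h_def)
    qed
    have C\<theta>: "C * \<theta> powr \<alpha> = h / 4"
    proof -
      have "\<theta> powr \<alpha> = c\<theta> powr \<alpha> * \<delta> powr \<sigma>"
        using c\<theta> d \<alpha> by (simp add: \<theta>_def powr_mult powr_powr)
      then show ?thesis using C_pos n1 by (simp add: c\<theta>(2) h_def)
    qed
    have \<beta>_le: "\<beta> \<le> c\<beta> * \<delta> powr (- (\<sigma> / \<alpha>))"
    proof -
      have "1 \<le> \<delta> powr (- (\<sigma> / \<alpha>))"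
        using d dle \<sigma> \<alpha> by (simp add: powr_minus one_le_inverse_iff powr_le1)
      moreover have "(A0 + 1) / \<theta> = (A0 + 1) / c\<theta> * \<delta> powr (- (\<sigma> / \<alpha>))"
        by (simp add: \<theta>_def powr_minus divide_inverse)
      ultimately show ?thesis by (simp add: \<beta>_def c\<beta>_def distrib_right)
    qed
    have \<beta>0: "\<beta> \<ge> 0" using pos A0_pos by (simp add: \<beta>_def)
    have \<beta>n: "\<beta> ^ DIM('a) \<le> c\<beta> ^ DIM('a) * \<delta> powr (\<sigma> - 1 / 4)"
    proof -
      have "\<beta> ^ DIM('a) \<le> (c\<beta> * \<delta> powr (- (\<sigma> / \<alpha>))) ^ DIM('a)" by (intro power_mono \<beta>_le \<beta>0)
      also have "\<dots> = c\<beta> ^ DIM('a) * \<delta> powr (- (\<sigma> / \<alpha>) * n)"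
        using d by (simp add: power_mult_distrib n_def powr_realpow[symmetric] powr_powr)
      also have "- (\<sigma> / \<alpha>) * n = \<sigma> - 1 / 4" using \<sigma>(3) by (simp add: mult.commute)
      finally show ?thesis .
    qed
    have nz: "n * \<beta> ^ DIM('a) * norm z \<le> 2 * n * c\<beta> ^ DIM('a) * \<delta> powr (\<sigma> + 3 / 4)"
    proof -
      have "n * \<beta> ^ DIM('a) * norm z \<le> n * (c\<beta> ^ DIM('a) * \<delta> powr (\<sigma> - 1 / 4)) * (2 * \<delta>)"
        using n1 \<beta>0 c\<beta> z by (intro mult_mono mult_left_mono \<beta>n) auto
      also have "\<dots> = 2 * n * c\<beta> ^ DIM('a) * (\<delta> powr (\<sigma> - 1 / 4) * \<delta> powr 1)" using d by simp
      also have "\<delta> powr (\<sigma> - 1 / 4) * \<delta> powr 1 = \<delta> powr (\<sigma> + 3 / 4)"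
        by (simp only: powr_add[symmetric]) (simp add: add.commute)
      finally show ?thesis .
    qed
    have disp: "n * \<beta> ^ DIM('a) * norm z \<le> \<delta> powr \<sigma>"
    proof -
      have "2 * n * c\<beta> ^ DIM('a) * \<delta> powr (\<sigma> + 3 / 4) = 2 * n * c\<beta> ^ DIM('a) * \<delta> powr (3 / 4) * \<delta> powr \<sigma>"
        by (simp add: powr_add)
      also have "\<dots> \<le> 1 * \<delta> powr \<sigma>"
      proof (rule mult_right_mono)
        have "2 * n * c\<beta> ^ DIM('a) > 0" using n1 c\<beta> by simp
        then show "2 * n * c\<beta> ^ DIM('a) * \<delta> powr (3 / 4) \<le> 1"
          using d1(2)[OF d(1) dle(2)] by (simp add: field_simps)
      qed simp
      finally show ?thesis using nz by simp
    qed
    have d_le: "\<delta> \<le> \<delta> powr \<sigma>"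
      using powr_mono'[of \<sigma> 1 \<delta>] d dle \<sigma> by simp
    have Err_le: "Err \<delta> e (\<delta> powr \<sigma>) \<le> E0 * \<delta> powr (- 1 / 2 - \<sigma>)"
    proof -
      have "1 / e * (1 / \<delta> powr \<sigma>) = \<delta> powr (- 1 / 2 - \<sigma>)"
        unfolding e_def by (simp add: powr_minus_divide[symmetric] powr_add[symmetric])
      moreover have "(1 / e) * (2 * (flux_max * CK / \<delta> powr \<sigma>)) = 2 * (flux_max * CK) * (1 / e * (1 / \<delta> powr \<sigma>))"
        by simp
      ultimately have 1: "(1 / e) * (2 * (flux_max * CK / \<delta> powr \<sigma>)) = 2 * (flux_max * CK) * \<delta> powr (- 1 / 2 - \<sigma>)"
        by (simp only:)
      have "e / \<delta> = \<delta> powr (1 / 2) / \<delta> powr 1" using d by (simp add: e_def)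
      also have "\<dots> = \<delta> powr (- 1 / 2)" by (simp only: powr_diff[symmetric]) simp
      also have "\<dots> \<le> \<delta> powr (- 1 / 2 - \<sigma>)"
        using d dle \<sigma> by (intro powr_mono') auto
      finally have "L * CK * (e / \<delta>) \<le> L * CK * \<delta> powr (- 1 / 2 - \<sigma>)"
        using L_nonneg CK(1) by (intro mult_left_mono) auto
      then have 2: "L * e * (CK / \<delta>) \<le> L * CK * \<delta> powr (- 1 / 2 - \<sigma>)" by (simp add: mult_ac)
      have "Err \<delta> e (\<delta> powr \<sigma>) \<le> 2 * (flux_max * CK) * \<delta> powr (- 1 / 2 - \<sigma>) + L * CK * \<delta> powr (- 1 / 2 - \<sigma>)"
        unfolding Err_def 1 using 2 by simp
      also have "\<dots> \<le> E0 * \<delta> powr (- 1 / 2 - \<sigma>)"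
        by (simp add: E0_def distrib_right)
      finally show ?thesis .
    qed
    \<comment> \<open>The cutoff width is \<rho> = \<delta> powr \<sigma>. Displacement, kernel
      radius \<delta> and 2 * \<rho> are then at most one, one and two multiples of \<delta> powr
      \<sigma>, hence the four in the radius.\<close>
    have "deficit \<delta> w (v + DIM('a) * h) v z r
      \<le> ennreal (DIM('a) * \<beta> ^ DIM('a) * norm z * Err \<delta> e (\<delta> powr \<sigma>)) * vol_above w v (r + 4 * \<delta> powr \<sigma>)"
    proof (rule chain[OF w d(1) pos(2,4,3) _ _ _ r \<beta>_def])
      show "0 \<le> h" using pos by simp
      show "- M \<le> v" using v k_bounds by simp
      show "v + DIM('a) * h \<le> M" using v k_bounds nh by (simp add: n_def)
      show "r + DIM('a) * \<beta> ^ DIM('a) * norm z + \<delta> + 2 * \<delta> powr \<sigma> \<le> r + 4 * \<delta> powr \<sigma>"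
        using disp d_le by (simp add: n_def)
      fix u \<xi> assume u: "v \<le> u" "u + h \<le> v + DIM('a) * h" and \<xi>: "norm (\<xi> :: 'a) = 1"
      show "\<exists>v'. u \<le> v' \<and> v' + e \<le> u + h \<and> \<theta> \<le> \<bar>a v' \<bullet> \<xi>\<bar>"
      proof (rule nondegenerate_velocity[OF _ _ \<xi> pos(3)])
        show "C * \<theta> powr \<alpha> < h - e" using C\<theta> e_le pos by linarith
      qed (use u v nh e_le pos in \<open>auto simp: n_def\<close>)
    qed
    also have "\<dots> \<le> ennreal (C1 * \<delta> powr (1/4)) * vol_above w v (r + 4 * \<delta> powr \<sigma>)"
    proof (intro mult_right_mono ennreal_leI)
      have "n * \<beta> ^ DIM('a) * norm z * Err \<delta> e (\<delta> powr \<sigma>)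
        \<le> (2 * n * c\<beta> ^ DIM('a) * \<delta> powr (\<sigma> + 3 / 4)) * (E0 * \<delta> powr (- 1 / 2 - \<sigma>))"
        using n1 c\<beta> Err_nonneg[OF d(1) pos(2,4)] by (intro mult_mono nz Err_le) auto
      also have "\<dots> = C1 * (\<delta> powr (\<sigma> + 3 / 4) * \<delta> powr (- 1 / 2 - \<sigma>))" by (simp add: C1_def)
      also have "\<delta> powr (\<sigma> + 3 / 4) * \<delta> powr (- 1 / 2 - \<sigma>) = \<delta> powr (1 / 4)"
        by (simp only: powr_add[symmetric]) (simp add: add.commute)
      finally show "DIM('a) * \<beta> ^ DIM('a) * norm z * Err \<delta> e (\<delta> powr \<sigma>) \<le> C1 * \<delta> powr (1/4)"
        by (simp add: n_def)
    qed simp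
    finally show ?thesis using nh by (simp add: n_def)
  qed
  have "\<delta>1 > 0" "\<delta>1 \<le> 1" "\<sigma> \<le> 1" using d1 d2 \<sigma> by (auto simp: \<delta>1_def)
  then show ?thesis using main \<sigma>(1) C1 by blast
qed

end

subsection \<open>From small measure to boundedness\<close>

lemma ennreal_integral_le:
  assumes "integrable M g"
  shows "ennreal (\<integral>x. g x \<partial>M) \<le> (\<integral>\<^sup>+x. ennreal (g x) \<partial>M)"
proof -
  have i: "integrable M (\<lambda>x. max 0 (g x))" using assms by simp
  have "ennreal (\<integral>x. g x \<partial>M) \<le> ennreal (\<integral>x. max 0 (g x) \<partial>M)"
    by (intro ennreal_leI integral_mono assms i) simp
  also have "\<dots> = (\<integral>\<^sup>+x. ennreal (max 0 (g x)) \<partial>M)"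
    by (rule nn_integral_eq_integral[OF i, symmetric]) simp
  also have "\<dots> = (\<integral>\<^sup>+x. ennreal (g x) \<partial>M)"
    by (intro nn_integral_cong) (simp add: max_def ennreal_neg)
  finally show ?thesis .
qed

context mollifier
begin

section \<open>Jensen's inequality for mollified functions\<close>

lemma avg_le_1:
  assumes d: "\<delta> > 0" and [measurable]: "h \<in> borel_measurable borel" and "\<And>y. \<bar>h y\<bar> \<le> 1"
  shows "avg \<delta> h x \<le> 1"
proof -
  have "avg \<delta> h x \<le> avg \<delta> (\<lambda>y. 1) x"
    by (rule avg_mono[OF d]) (use assms in \<open>auto simp: abs_le_iff\<close>)
  also have "\<dots> = 1" by (simp add: avg_def integral_Ker d)
  finally show ?thesis .
qed

lemma ennreal_avg:
  assumes d: "\<delta> > 0" and [measurable]: "h \<in> borel_measurable borel" and h: "\<And>y. 0 \<le> h y" "\<And>y. h y \<le> 1"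
  shows "ennreal (avg \<delta> h x) = (\<integral>\<^sup>+z. ennreal (Ker \<delta> z) * ennreal (h (x + z)) \<partial>lborel)"
proof -
  have "avg \<delta> h x = (\<integral>z. Ker \<delta> z * h (x + z) \<partial>lborel)" by (rule avg_shift) measurable
  moreover have "integrable lborel (\<lambda>z. Ker \<delta> z * h (x + z))"
    using integrable_Ker_mult[OF d, of "\<lambda>z. h (x + z)" 1 0] h by simp
  ultimately have "ennreal (avg \<delta> h x) = (\<integral>\<^sup>+z. ennreal (Ker \<delta> z * h (x + z)) \<partial>lborel)"
    using h Ker_nonneg[OF d] by (simp add: nn_integral_eq_integral)
  then show ?thesis using h Ker_nonneg[OF d] by (simp add: ennreal_mult)
qed

lemma avg_commute:
  assumes d: "\<delta> > 0" "\<eta> > 0" and [measurable]: "h \<in> borel_measurable borel" and h: "\<And>y. 0 \<le> h y" "\<And>y. h y \<le> 1"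
  shows "avg \<delta> (avg \<eta> h) x = avg \<eta> (avg \<delta> h) x"
proof -
  have b: "0 \<le> avg \<epsilon> h y" "avg \<epsilon> h y \<le> 1" if "\<epsilon> > 0" for \<epsilon> y
    using that h by (auto intro!: avg_nonneg avg_le_1 simp: abs_le_iff)
  have eq: "ennreal (avg \<delta> (avg \<eta> h) x)
      = (\<integral>\<^sup>+z. (\<integral>\<^sup>+y. ennreal (Ker \<delta> z) * (ennreal (Ker \<eta> y) * ennreal (h (x + z + y))) \<partial>lborel) \<partial>lborel)"
    if "\<delta> > 0" "\<eta> > 0" for \<delta> \<eta>
    using that b h by (subst ennreal_avg) (auto simp: ennreal_avg nn_integral_cmult)
  have "ennreal (avg \<delta> (avg \<eta> h) x) = ennreal (avg \<eta> (avg \<delta> h) x)"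
    unfolding eq[OF d] eq[OF d(2,1)]
    by (subst lborel_pair.Fubini') (auto simp: ac_simps)
  moreover have "0 \<le> avg \<delta> (avg \<eta> h) x" "0 \<le> avg \<eta> (avg \<delta> h) x"
    by (intro avg_nonneg b d)+
  ultimately show ?thesis by simp
qed

text \<open>\<open>Ker \<delta>\<close> has integral 1, so the constant \<open>c\<close> may be
  moved under the average. What remains is that the positive part of an average is at most the
  average of the positive part.\<close>

lemma avg_minus_le:
  assumes d: "\<delta> > 0" and [measurable]: "h \<in> borel_measurable borel" and h: "\<And>y. \<bar>h y\<bar> \<le> 1"
  shows "ennreal (avg \<delta> h x - c) \<le> (\<integral>\<^sup>+z. ennreal (Ker \<delta> z) * ennreal (h (x + z) - c) \<partial>lborel)"
    and "ennreal (c - avg \<delta> h x) \<le> (\<integral>\<^sup>+z. ennreal (Ker \<delta> z) * ennreal (c - h (x + z)) \<partial>lborel)"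
proof -
  have e: "avg \<delta> h x = (\<integral>z. Ker \<delta> z * h (x + z) \<partial>lborel)" by (rule avg_shift) measurable
  have i: "integrable lborel (\<lambda>z. Ker \<delta> z * h (x + z))"
    using integrable_Ker_mult[OF d, of "\<lambda>z. h (x + z)" 1 0] h by simp
  note ic = integrable_mult_left[OF integrable_Ker(3)[OF d], of c]
  have "avg \<delta> h x - c = (\<integral>z. Ker \<delta> z * (h (x + z) - c) \<partial>lborel)"
    using i ic integral_Ker(3)[OF d] by (simp add: e right_diff_distrib)
  then have "ennreal (avg \<delta> h x - c) \<le> (\<integral>\<^sup>+z. ennreal (Ker \<delta> z * (h (x + z) - c)) \<partial>lborel)"
    using i ic by (simp only:) (intro ennreal_integral_le, simp add: right_diff_distrib)
  then show "ennreal (avg \<delta> h x - c) \<le> (\<integral>\<^sup>+z. ennreal (Ker \<delta> z) * ennreal (h (x + z) - c) \<partial>lborel)"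
    using Ker_nonneg[OF d] by (simp add: ennreal_mult')
  have "c - avg \<delta> h x = (\<integral>z. Ker \<delta> z * (c - h (x + z)) \<partial>lborel)"
    using i ic integral_Ker(3)[OF d] by (simp add: e right_diff_distrib)
  then have "ennreal (c - avg \<delta> h x) \<le> (\<integral>\<^sup>+z. ennreal (Ker \<delta> z * (c - h (x + z))) \<partial>lborel)"
    using i ic by (simp only:) (intro ennreal_integral_le, simp add: right_diff_distrib)
  then show "ennreal (c - avg \<delta> h x) \<le> (\<integral>\<^sup>+z. ennreal (Ker \<delta> z) * ennreal (c - h (x + z)) \<partial>lborel)"
    using Ker_nonneg[OF d] by (simp add: ennreal_mult')
qed

text \<open>The threshold lies strictly between 0 and 1. At a scale where {w > v} has low density
  the excess vanishes (\<open>excess_zero\<close>), while along ever finer scales it still controls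
  the measure of {w > v} (\<open>measure_le_excess\<close>). The iteration compares these two
  regimes.\<close>

definition excess :: "real \<Rightarrow> ('a \<Rightarrow> real) \<Rightarrow> real \<Rightarrow> real \<Rightarrow> ennreal" where
  "excess \<delta> w v r = (\<integral>\<^sup>+x. indicator (cube r) x * ennreal (avg \<delta> (above w v) x - 1/2) \<partial>lborel)"

lemma excess_mono:
  assumes [measurable]: "w \<in> borel_measurable borel" and d: "\<delta> > 0" and "v' \<le> v"
  shows "excess \<delta> w v r \<le> excess \<delta> w v' r"
  unfolding excess_def
proof (intro nn_integral_mono mult_left_mono ennreal_leI diff_right_mono)
  show "avg \<delta> (above w v) x \<le> avg \<delta> (above w v') x" for x
    by (rule avg_mono[OF d _ _ above_abs above_abs])
      (use assms(3) in \<open>auto simp: above_def indicator_def\<close>)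
qed simp

text \<open>The kernel is bounded by \<open>Kmax / \<delta> ^ DIM('a)\<close>, so too little volume
  within reach of the cube keeps the mollified indicator at or below 1/2 there.\<close>

lemma excess_zero:
  assumes [measurable]: "w \<in> borel_measurable borel" and d: "\<delta> > 0"
    and small: "ennreal (Kmax / \<delta> ^ DIM('a)) * emeasure lborel (cube (r + \<delta>) \<inter> {x. w x > v}) \<le> ennreal (1/2)"
  shows "excess \<delta> w v r = 0"
proof -
  have *: "indicator (cube r) x * ennreal (avg \<delta> (above w v) x - 1/2) = 0" for x
  proof (cases "x \<in> cube r")
    case True
    have "ennreal (avg \<delta> (above w v) x) = (\<integral>\<^sup>+y. ennreal (Ker \<delta> (y - x) * above w v y) \<partial>lborel)"
      unfolding avg_def
      by (rule nn_integral_eq_integral[symmetric])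
        (auto intro!: integrable_Ker_mult[OF d _ above_abs] simp: above_nonneg Ker_nonneg d)
    also have "\<dots> \<le> (\<integral>\<^sup>+y. ennreal (Kmax / \<delta> ^ DIM('a)) * indicator (cube (r + \<delta>) \<inter> {x. w x > v}) y \<partial>lborel)"
    proof (rule nn_integral_mono)
      fix y
      show "ennreal (Ker \<delta> (y - x) * above w v y) \<le> ennreal (Kmax / \<delta> ^ DIM('a)) * indicator (cube (r + \<delta>) \<inter> {x. w x > v}) y"
      proof (cases "norm (y - x) \<ge> \<delta>")
        case False
        then show ?thesis
          using cube_add[OF True, of "y - x" \<delta>] Ker_le[OF d]
          by (auto simp: above_def indicator_def intro!: ennreal_leI)
      qed (simp add: Ker_zero d)
    qed
    also have "\<dots> = ennreal (Kmax / \<delta> ^ DIM('a)) * emeasure lborel (cube (r + \<delta>) \<inter> {x. w x > v})"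
      by (subst nn_integral_cmult_indicator) auto
    finally have "ennreal (avg \<delta> (above w v) x) \<le> ennreal (1/2)" using small by (rule order_trans)
    then have "avg \<delta> (above w v) x \<le> 1/2" by (subst (asm) ennreal_le_iff) auto
    then show ?thesis by (simp add: ennreal_neg)
  qed simp
  show ?thesis unfolding excess_def * by simp
qed

text \<open>
  The excess of an indicator function over \<open>1/2\<close> is half of the indicator, hence the factor 2.
\<close>

lemma measure_le_excess:
  assumes [measurable]: "w \<in> borel_measurable borel" and d: "\<delta> > 0"
    and ex: "\<And>i::nat. excess (\<delta> / 2 ^ i) w v r \<le> B"
  shows "emeasure lborel (cube r \<inter> {x. w x > v}) \<le> 2 * B"
proof (rule ennreal_le_epsilon)
  fix e' :: real assume "e' > 0"
  \<comment> \<open>The final inequality for the measure \<open>m\<close> of \<open>F\<close> gives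
    m \<le> 2 b + 2 e, and the discarded part of the set adds one more \<open>e\<close>; a fifth of
    \<open>e'\<close> is enough.\<close>
  define e where "e = e' / 5"
  have e: "e > 0" using \<open>e' > 0\<close> by (simp add: e_def)
  let ?E = "cube r \<inter> {x. w x > v}"
  have E: "?E \<in> sets lborel" by measurable
  then have EL: "?E \<in> sets lebesgue" by (rule sets_completionI_sets)
  \<comment> \<open>Inner and outer approximation do the work of Lebesgue's differentiation theorem.
    Shifts shorter than \<open>s\<close> keep the compact set \<open>F\<close> inside the open set
    \<open>U\<close>, hence move at most measure \<open>e\<close> of it off \<open>F\<close>, and
    the kernel at a fine dyadic scale uses only such shifts.\<close>
  obtain F where F: "closed F" "F \<subseteq> ?E" "?E - F \<in> lmeasurable" "emeasure lebesgue (?E - F) < ennreal e"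
    by (rule sets_lebesgue_inner_closed[OF EL e])
  have FL: "F \<in> sets lebesgue" using F(1) by auto
  obtain U where U: "open U" "F \<subseteq> U" "U - F \<in> lmeasurable" "emeasure lebesgue (U - F) < ennreal e"
    by (rule sets_lebesgue_outer_open[OF FL e])
  have [measurable]: "F \<in> sets borel" "U \<in> sets borel" using F(1) U(1) by auto
  have "compact F"
    unfolding compact_eq_bounded_closed
    using F(1) bounded_subset[OF bounded_cbox, of F "- (r *\<^sub>R One)" "r *\<^sub>R One"] F(2)
    by (auto simp: cube_def)
  then obtain s where s: "s > 0" "(\<Union>x\<in>F. ball x s) \<subseteq> U"
    using compact_subset_open_imp_ball_epsilon_subset[OF _ U(1,2)] by blast
  obtain i where "inverse (2 ^ i) < s / \<delta>"
    using real_arch_pow_inv[of "s / \<delta>" "1/2"] s d by (auto simp: power_one_over inverse_eq_divide)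
  then have i: "\<delta> / 2 ^ i < s" using d by (simp add: field_simps)
  define \<eta> where "\<eta> = \<delta> / 2 ^ i"
  have \<eta>: "\<eta> > 0" "\<eta> < s" using i d by (auto simp: \<eta>_def)
  have Efin: "emeasure lborel ?E < \<infinity>"
    using emeasure_mono[of ?E "cube r" lborel] emeasure_cube_finite[of r, where 'a='a] by (auto simp: less_top top_unique)
  then have Ffin: "emeasure lborel F < \<infinity>"
    using emeasure_mono[of F ?E lborel] F(2) E by (auto simp: less_top top_unique)
  have shift: "emeasure lborel F \<le> (\<integral>\<^sup>+x. indicator F x * indicator F (x + z) \<partial>lborel) + ennreal e" if z: "norm z < \<eta>" for z
  proof -
    have "emeasure lborel F = (\<integral>\<^sup>+x. indicator F x \<partial>lborel)" by simp
    also have "\<dots> \<le> (\<integral>\<^sup>+x. indicator F x * indicator F (x + z) + indicator (U - F) (z + x) \<partial>lborel)"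
    proof (rule nn_integral_mono)
      fix x
      show "indicator F x \<le> indicator F x * indicator F (x + z) + (indicator (U - F) (z + x) :: ennreal)"
      proof (cases "x \<in> F")
        case True
        have "x + z \<in> ball x s" using z \<eta> by (simp add: dist_norm)
        then have "x + z \<in> U" using s(2) True by blast
        then show ?thesis by (auto simp: indicator_def add.commute)
      qed simp
    qed
    also have "\<dots> = (\<integral>\<^sup>+x. indicator F x * indicator F (x + z) \<partial>lborel) + (\<integral>\<^sup>+x. indicator (U - F) (z + x) \<partial>lborel)"
      by (rule nn_integral_add) measurable
    also have "(\<integral>\<^sup>+x. indicator (U - F) (z + x) \<partial>lborel) = (\<integral>\<^sup>+x. indicator (U - F) x \<partial>lborel)"
      by (rule nn_integral_lborel_translate) measurable
    also have "\<dots> = emeasure lebesgue (U - F)" by simp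
    also have "\<dots> \<le> ennreal e" using U(4) by simp
    finally show ?thesis by simp
  qed
  have "emeasure lborel F = (\<integral>\<^sup>+z. ennreal (Ker \<eta> z) * emeasure lborel F \<partial>lborel)"
    using nn_integral_Ker(3)[OF \<eta>(1)] by (simp add: nn_integral_multc)
  also have "\<dots> \<le> (\<integral>\<^sup>+z. ennreal (Ker \<eta> z) * (\<integral>\<^sup>+x. indicator F x * indicator F (x + z) \<partial>lborel) + ennreal (Ker \<eta> z) * ennreal e \<partial>lborel)"
  proof (rule nn_integral_mono)
    fix z
    show "ennreal (Ker \<eta> z) * emeasure lborel F
      \<le> ennreal (Ker \<eta> z) * (\<integral>\<^sup>+x. indicator F x * indicator F (x + z) \<partial>lborel) + ennreal (Ker \<eta> z) * ennreal e"
    proof (cases "norm z < \<eta>")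
      case True
      then show ?thesis using mult_left_mono[OF shift[OF True]] by (simp add: distrib_left)
    qed (simp add: Ker_zero \<eta>)
  qed
  also have "\<dots> = (\<integral>\<^sup>+z. (\<integral>\<^sup>+x. indicator F x * (ennreal (Ker \<eta> z) * indicator F (x + z)) \<partial>lborel) \<partial>lborel) + ennreal e"
  proof -
    have "(\<integral>\<^sup>+z. ennreal (Ker \<eta> z) * ennreal e \<partial>lborel) = ennreal e"
      using nn_integral_Ker(3)[OF \<eta>(1)] by (simp add: nn_integral_multc)
    then show ?thesis
      by (subst nn_integral_add) (auto simp: nn_integral_cmult[symmetric] mult.left_commute)
  qed
  also have "(\<integral>\<^sup>+z. (\<integral>\<^sup>+x. indicator F x * (ennreal (Ker \<eta> z) * indicator F (x + z)) \<partial>lborel) \<partial>lborel)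
     = (\<integral>\<^sup>+x. (\<integral>\<^sup>+z. indicator F x * (ennreal (Ker \<eta> z) * indicator F (x + z)) \<partial>lborel) \<partial>lborel)"
    by (rule lborel_pair.Fubini') measurable
  also have "\<dots> \<le> (\<integral>\<^sup>+x. indicator (cube r) x * ennreal (avg \<eta> (above w v) x - 1/2) + ennreal (1/2) * indicator F x \<partial>lborel)"
  proof (rule nn_integral_mono)
    fix x
    show "(\<integral>\<^sup>+z. indicator F x * (ennreal (Ker \<eta> z) * indicator F (x + z)) \<partial>lborel)
      \<le> indicator (cube r) x * ennreal (avg \<eta> (above w v) x - 1/2) + ennreal (1/2) * indicator F x"
    proof (cases "x \<in> F")
      case True
      have "(\<integral>\<^sup>+z. ennreal (Ker \<eta> z) * indicator F (x + z) \<partial>lborel)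
        \<le> (\<integral>\<^sup>+z. ennreal (Ker \<eta> z) * ennreal (above w v (x + z)) \<partial>lborel)"
        using F(2) by (intro nn_integral_mono mult_left_mono) (auto simp: above_def indicator_def)
      also have "\<dots> = ennreal (avg \<eta> (above w v) x)"
        using \<eta>(1) by (subst ennreal_avg) (auto simp: above_def)
      also have "\<dots> \<le> ennreal (avg \<eta> (above w v) x - 1/2) + ennreal (1/2)"
        using ennreal_add_le[of "1/2" "avg \<eta> (above w v) x - 1/2"] by (simp add: add.commute)
      finally show ?thesis using True F(2) by auto
    qed simp
  qed
  also have "\<dots> = excess \<eta> w v r + ennreal (1/2) * emeasure lborel F"
    unfolding excess_def by (subst nn_integral_add) (auto simp: nn_integral_cmult_indicator)
  also have "\<dots> \<le> B + ennreal (1/2) * emeasure lborel F"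
    using ex[of i] by (intro add_right_mono) (simp add: \<eta>_def)
  finally have main: "emeasure lborel F \<le> B + ennreal (1/2) * emeasure lborel F + ennreal e"
    by (simp add: add_right_mono)
  define m where "m = measure lborel F"
  have m: "emeasure lborel F = ennreal m" "m \<ge> 0"
    using Ffin by (simp_all add: m_def emeasure_eq_ennreal_measure less_top)
  have "emeasure lborel ?E \<le> emeasure lborel F + emeasure lebesgue (?E - F)"
  proof -
    have "emeasure lborel ?E = emeasure lborel (F \<union> (?E - F))" using F(2) by (simp add: Un_absorb1)
    also have "\<dots> \<le> emeasure lborel F + emeasure lborel (?E - F)"
      by (rule emeasure_subadditive) auto
    finally show ?thesis by simp
  qed
  also have "\<dots> \<le> ennreal m + ennreal e" using F(4) by (simp add: m add_left_mono)
  also have "\<dots> \<le> 2 * B + ennreal e'"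
  proof (cases "B = \<infinity>")
    case False
    then obtain b where b: "B = ennreal b" "b \<ge> 0" by (cases B) auto
    have "ennreal (1/2) * ennreal m = ennreal (1/2 * m)" using m by (intro ennreal_mult[symmetric]) auto
    then have "ennreal m \<le> ennreal b + ennreal (1/2 * m) + ennreal e" using main by (simp only: b m)
    also have "\<dots> = ennreal (b + 1/2 * m + e)" using b m e by (simp add: ennreal_plus[symmetric] del: ennreal_plus)
    finally have "ennreal m \<le> ennreal (b + 1/2 * m + e)" .
    then have "m \<le> b + 1/2 * m + e" using b m e by (subst (asm) ennreal_le_iff) auto
    then have "m + e \<le> 2 * b + e'" using e by (simp add: e_def)
    then have "ennreal (m + e) \<le> ennreal (2 * b + e')" by (rule ennreal_leI)
    then show ?thesis using b m e \<open>e' > 0\<close> by (simp add: ennreal_mult)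
  qed simp
  finally show "emeasure lborel ?E \<le> 2 * B + ennreal e'" .
qed

lemma excess_radius_mono: "r \<le> R \<Longrightarrow> excess \<delta> w v r \<le> excess \<delta> w v R"
  unfolding excess_def using cube_mono[of r R] by (intro nn_integral_mono) (auto simp: indicator_def)

text \<open>
  Compare \<open>avg \<delta>\<close> at the higher level with \<open>avg (2 * \<delta>) \<circ> avg \<delta>\<close> at the lower one; since the two
  averages commute, Jensen's inequality for the positive part removes the inner one.
\<close>

lemma excess_step:
  assumes [measurable]: "w \<in> borel_measurable borel" and d: "\<delta> > 0"
    and B: "\<And>z. norm z \<le> 2 * \<delta> \<Longrightarrow> deficit \<delta> w v' v z r \<le> B"
  shows "excess \<delta> w v' r \<le> excess (2 * \<delta>) w v (r + \<delta>) + B"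
proof -
  have d2: "2 * \<delta> > 0" using d by simp
  let ?u = "avg \<delta> (above w v')" and ?l = "avg \<delta> (above w v)" and ?L = "avg (2 * \<delta>) (above w v)"
  have abs_avg: "\<bar>avg \<epsilon> (above w c) y\<bar> \<le> 1" if "\<epsilon> > 0" for \<epsilon> c y
  proof -
    have "0 \<le> avg \<epsilon> (above w c) y" by (intro avg_nonneg that above_nonneg)
    moreover have "avg \<epsilon> (above w c) y \<le> 1" by (rule avg_le_1[OF that _ above_abs]) measurable
    ultimately show ?thesis by simp
  qed
  \<comment> \<open>\<open>?D\<close> compares the upper set with translates of the lower one,
    weighted by the kernel of scale \<open>2 * \<delta>\<close>; this is why translations up to
    length \<open>2 * \<delta>\<close> must be covered. \<open>?X\<close> is the excess at the
    doubled scale, seen through the leftover average at scale \<delta>.\<close>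
  let ?D = "\<lambda>x z. ennreal (Ker (2 * \<delta>) z) * (indicator (cube r) x * ennreal (?u x - ?l (x + z)))"
  let ?X = "\<lambda>x z. ennreal (Ker \<delta> z) * (indicator (cube r) x * ennreal (?L (x + z) - 1/2))"
  have "excess \<delta> w v' r \<le> (\<integral>\<^sup>+x. (\<integral>\<^sup>+z. ?X x z \<partial>lborel) + (\<integral>\<^sup>+z. ?D x z \<partial>lborel) \<partial>lborel)"
    unfolding excess_def
  proof (rule nn_integral_mono)
    fix x
    have eq: "avg (2 * \<delta>) ?l x = avg \<delta> ?L x"
      by (rule avg_commute[OF d2 d]) (auto simp: above_def)
    have "ennreal (?u x - 1/2) \<le> ennreal (avg \<delta> ?L x - 1/2) + ennreal (?u x - avg (2 * \<delta>) ?l x)"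
    proof (cases "?u x - avg (2 * \<delta>) ?l x \<ge> 0")
      case True
      then show ?thesis
        using ennreal_add_le[of "?u x - avg (2 * \<delta>) ?l x" "avg \<delta> ?L x - 1/2"] by (simp add: eq add.commute)
    next
      case False
      then have "ennreal (?u x - 1/2) \<le> ennreal (avg \<delta> ?L x - 1/2)" by (intro ennreal_leI) (simp add: eq)
      then show ?thesis by (rule add_increasing2[rotated]) simp
    qed
    also have "\<dots> \<le> (\<integral>\<^sup>+z. ennreal (Ker \<delta> z) * ennreal (?L (x + z) - 1/2) \<partial>lborel)
        + (\<integral>\<^sup>+z. ennreal (Ker (2 * \<delta>) z) * ennreal (?u x - ?l (x + z)) \<partial>lborel)"
      by (intro add_mono avg_minus_le d d2 abs_avg) measurable
    finally show "indicator (cube r) x * ennreal (?u x - 1/2) \<le> (\<integral>\<^sup>+z. ?X x z \<partial>lborel) + (\<integral>\<^sup>+z. ?D x z \<partial>lborel)"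
      by (cases "x \<in> cube r") auto
  qed
  also have "\<dots> = (\<integral>\<^sup>+x. (\<integral>\<^sup>+z. ?X x z \<partial>lborel) \<partial>lborel) + (\<integral>\<^sup>+x. (\<integral>\<^sup>+z. ?D x z \<partial>lborel) \<partial>lborel)"
    by (rule nn_integral_add) measurable
  also have "(\<integral>\<^sup>+x. (\<integral>\<^sup>+z. ?X x z \<partial>lborel) \<partial>lborel) = (\<integral>\<^sup>+z. (\<integral>\<^sup>+x. ?X x z \<partial>lborel) \<partial>lborel)"
    by (rule lborel_pair.Fubini') measurable
  also have "\<dots> \<le> (\<integral>\<^sup>+z. ennreal (Ker \<delta> z) * excess (2 * \<delta>) w v (r + \<delta>) \<partial>lborel)"
  proof (rule nn_integral_mono)
    fix z
    have "ennreal (Ker \<delta> z) * (\<integral>\<^sup>+x. indicator (cube r) x * ennreal (?L (x + z) - 1/2) \<partial>lborel)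
       \<le> ennreal (Ker \<delta> z) * excess (2 * \<delta>) w v (r + \<delta>)"
    proof (cases "norm z \<le> \<delta>")
      case True
      show ?thesis unfolding excess_def
      proof (rule mult_left_mono)
        show "(\<integral>\<^sup>+x. indicator (cube r) x * ennreal (?L (x + z) - 1/2) \<partial>lborel)
          \<le> (\<integral>\<^sup>+x. indicator (cube (r + \<delta>)) x * ennreal (?L x - 1/2) \<partial>lborel)"
          by (rule nn_integral_cube_shift[OF _ True]) measurable
      qed simp
    qed (simp add: Ker_zero d)
    then show "(\<integral>\<^sup>+x. ?X x z \<partial>lborel) \<le> ennreal (Ker \<delta> z) * excess (2 * \<delta>) w v (r + \<delta>)"
      by (subst nn_integral_cmult) auto
  qed
  also have "\<dots> = excess (2 * \<delta>) w v (r + \<delta>)"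
    using nn_integral_Ker(3)[OF d] by (simp add: nn_integral_multc)
  also have "(\<integral>\<^sup>+x. (\<integral>\<^sup>+z. ?D x z \<partial>lborel) \<partial>lborel) = (\<integral>\<^sup>+z. (\<integral>\<^sup>+x. ?D x z \<partial>lborel) \<partial>lborel)"
    by (rule lborel_pair.Fubini') measurable
  also have "\<dots> \<le> (\<integral>\<^sup>+z. ennreal (Ker (2 * \<delta>) z) * B \<partial>lborel)"
  proof (rule nn_integral_mono)
    fix z
    have "ennreal (Ker (2 * \<delta>) z) * deficit \<delta> w v' v z r \<le> ennreal (Ker (2 * \<delta>) z) * B"
      using B by (cases "norm z \<le> 2 * \<delta>") (auto simp: Ker_zero d intro: mult_left_mono)
    then show "(\<integral>\<^sup>+x. ?D x z \<partial>lborel) \<le> ennreal (Ker (2 * \<delta>) z) * B"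
      unfolding deficit_def by (subst nn_integral_cmult) auto
  qed
  also have "\<dots> = B"
    using nn_integral_Ker(3)[OF d2] by (simp add: nn_integral_multc)
  finally show ?thesis by (simp add: add_left_mono add_right_mono)
qed

end

context nonlinear_law
begin

text \<open>
  The constants \<open>c1\<close>, \<open>c2\<close>, \<open>c3\<close> make \<open>G\<close>, \<open>H\<close>, \<open>\<Gamma>\<close> telescope: \<open>G (2 * \<delta>) - G \<delta> = \<delta> powr \<sigma>\<close>,
  \<open>H (2 * \<delta>) - H \<delta> = \<delta> powr (1/4)\<close> and \<open>\<Gamma> \<delta> - \<Gamma> (\<delta> / 2) = G \<delta>\<close>. The first two sum the losses over the
  scales below \<open>\<delta>\<close>, the third sums the level gaps of the De Giorgi iteration.
\<close>

lemma core:
  assumes k01: "k0 < k1"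
  shows "\<exists>\<eta>>0. \<forall>w. sol w \<longrightarrow> vol_above w k0 2 \<le> ennreal \<eta> \<longrightarrow> vol_above w k1 1 = 0"
proof -
  obtain \<sigma> C1 \<delta>1 where \<sigma>: "0 < \<sigma>" "\<sigma> \<le> 1" and C1: "C1 > 0" and \<delta>1: "\<delta>1 > 0" "\<delta>1 \<le> 1"
    and translation: "\<And>w \<delta> z v r. sol w \<Longrightarrow> 0 < \<delta> \<Longrightarrow> \<delta> < \<delta>1 \<Longrightarrow> norm z \<le> 2 * \<delta> \<Longrightarrow>
     k0 \<le> v \<Longrightarrow> v + \<delta> powr \<sigma> \<le> k1 \<Longrightarrow> r + 4 * \<delta> powr \<sigma> < 2 \<Longrightarrow>
     deficit \<delta> w (v + \<delta> powr \<sigma>) v z r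
      \<le> ennreal (C1 * \<delta> powr (1/4)) * vol_above w v (r + 4 * \<delta> powr \<sigma>)"
    using level_translation by blast
  have le_powr: "\<delta> \<le> \<delta> powr \<sigma>" if "0 < \<delta>" "\<delta> < \<delta>1" for \<delta>
    using powr_mono'[of \<sigma> 1 \<delta>] that \<sigma> \<delta>1 by simp

  \<comment> \<open>One dyadic step, from scale \<delta> up to \<open>2 * \<delta>\<close> and down
    in level. A common enlargement of the radius absorbs both the shift by \<delta> and the four
    multiples of \<delta> powr \<sigma> in \<open>translation\<close>.\<close>
  have step: "excess \<delta> w (v + \<delta> powr \<sigma>) r \<le> excess (2 * \<delta>) w v (r + 5 * \<delta> powr \<sigma>)
      + ennreal (C1 * \<delta> powr (1/4)) * vol_above w v (r + 5 * \<delta> powr \<sigma>)"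
    if w: "sol w" and d: "0 < \<delta>" "\<delta> < \<delta>1" and v: "k0 \<le> v" "v + \<delta> powr \<sigma> \<le> k1" and r: "r + 5 * \<delta> powr \<sigma> < 2"
    for w \<delta> v r
  proof -
    have wb: "w \<in> borel_measurable borel" using w by (rule sol_borel)
    define g where "g = \<delta> powr \<sigma>"
    have g: "g > 0" "\<delta> \<le> g" using d le_powr by (simp_all add: g_def)
    have r4: "r + 4 * \<delta> powr \<sigma> < 2" using r g(1) unfolding g_def by linarith
    have "excess \<delta> w (v + g) r \<le> excess (2 * \<delta>) w v (r + \<delta>) + ennreal (C1 * \<delta> powr (1/4)) * vol_above w v (r + 4 * g)"
      unfolding g_def by (rule excess_step[OF wb d(1) translation[OF w d _ v r4]])
    also have "\<dots> \<le> excess (2 * \<delta>) w v (r + 5 * g) + ennreal (C1 * \<delta> powr (1/4)) * vol_above w v (r + 5 * g)"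
      using g by (intro add_mono excess_radius_mono mult_left_mono vol_above_mono w) auto
    finally show ?thesis by (simp add: g_def)
  qed

  define c1 where "c1 = 1 / (2 powr \<sigma> - 1)"
  have two_powr: "1 < 2 powr \<sigma>" "2 powr \<sigma> \<le> 2"
    using \<sigma> powr_mono[of \<sigma> 1 2] by (auto simp: gr_one_powr)
  have c1: "c1 \<ge> 1" using two_powr \<sigma> by (simp add: c1_def field_simps)
  define G where "G \<delta> = c1 * \<delta> powr \<sigma>" for \<delta> :: real
  have G2: "G (2 * \<delta>) = G \<delta> + \<delta> powr \<sigma>" if "\<delta> > 0" for \<delta>
  proof -
    have "c1 * (2 powr \<sigma> - 1) = 1" using two_powr \<sigma> by (simp add: c1_def)
    then have "c1 * (2 powr \<sigma> - 1) * \<delta> powr \<sigma> = \<delta> powr \<sigma>" by simp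
    then show ?thesis using that by (simp add: G_def powr_mult algebra_simps)
  qed
  have G_pos: "G \<delta> > 0" if "\<delta> > 0" for \<delta> using that c1 by (simp add: G_def)
  have G_ge: "\<delta> \<le> G \<delta>" if "0 < \<delta>" "\<delta> < \<delta>1" for \<delta>
    using mult_right_mono[OF c1, of "\<delta> powr \<sigma>"] le_powr[OF that] by (simp add: G_def)
  define c2 :: real where "c2 = 1 / (2 powr (1/4) - 1)"
  have two_powr4: "1 < 2 powr (1/4 :: real)" by (simp add: gr_one_powr)
  have c2: "c2 > 0" using two_powr4 by (simp add: c2_def)
  define H where "H \<delta> = c2 * \<delta> powr (1/4)" for \<delta> :: real
  have H2: "H (2 * \<delta>) = H \<delta> + \<delta> powr (1/4)" if "\<delta> > 0" for \<delta>
  proof -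
    have "c2 * (2 powr (1/4) - 1) = 1" using two_powr4 by (simp add: c2_def)
    then have "c2 * (2 powr (1/4) - 1) * \<delta> powr (1/4) = \<delta> powr (1/4)" by simp
    then show ?thesis using that by (simp add: H_def powr_mult algebra_simps)
  qed
  have H_nonneg: "H \<delta> \<ge> 0" for \<delta> using c2 by (simp add: H_def)
  have G_mono: "G x \<le> G y" if "0 < x" "x \<le> y" for x y
    using that \<sigma> c1 by (simp add: G_def powr_mono2 mult_left_mono)
  have H_mono: "H x \<le> H y" if "0 < x" "x \<le> y" for x y
    using that c2 by (simp add: H_def powr_mono2 mult_left_mono)

  \<comment> \<open>Climbs from \<open>\<delta> / 2 ^ i\<close> to \<delta>. The losses of level,
    radius and error are geometric sums dominated by the coarsest scale, so they stay bounded
    however fine the start.\<close>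
  have telescope: "excess (\<delta> / 2 ^ i) w (v + (G \<delta> - G (\<delta> / 2 ^ i))) r
      \<le> excess \<delta> w v R + ennreal (C1 * (H \<delta> - H (\<delta> / 2 ^ i))) * vol_above w v R"
    if w: "sol w" and d: "0 < \<delta>" "\<delta> < \<delta>1" and v: "k0 \<le> v" "v + G \<delta> \<le> k1" and R: "R < 2"
      and r: "r + 5 * (G \<delta> - G (\<delta> / 2 ^ i)) \<le> R"
    for w \<delta> v r R i
    using r
  proof (induction i arbitrary: r)
    case 0
    then have "excess \<delta> w v r \<le> excess \<delta> w v R" by (intro excess_radius_mono) simp
    then show ?case by simp
  next
    case (Suc i)
    define \<eta> where "\<eta> = \<delta> / 2 ^ Suc i"
    have \<eta>2: "2 * \<eta> = \<delta> / 2 ^ i" by (simp add: \<eta>_def)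
    have \<eta>: "\<eta> > 0" using d by (simp add: \<eta>_def)
    have \<eta>_le: "2 * \<eta> \<le> \<delta>" unfolding \<eta>2 using d by (simp add: field_simps)
    define v' where "v' = v + (G \<delta> - G (2 * \<eta>))"
    have vv': "v \<le> v'" using G_mono[of "2 * \<eta>" \<delta>] \<eta> \<eta>_le by (simp add: v'_def)
    have eq: "v + (G \<delta> - G \<eta>) = v' + \<eta> powr \<sigma>" using G2[OF \<eta>] by (simp add: v'_def)
    have "r + 5 * (G \<delta> - G \<eta>) \<le> R" using Suc.prems unfolding \<eta>_def .
    then have r5: "r + 5 * \<eta> powr \<sigma> + 5 * (G \<delta> - G (2 * \<eta>)) \<le> R"
      unfolding G2[OF \<eta>] by simp
    have r5': "r + 5 * \<eta> powr \<sigma> \<le> R"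
      using r5 G_mono[of "2 * \<eta>" \<delta>] \<eta> \<eta>_le by simp
    have "excess \<eta> w (v' + \<eta> powr \<sigma>) r \<le> excess (2 * \<eta>) w v' (r + 5 * \<eta> powr \<sigma>)
      + ennreal (C1 * \<eta> powr (1/4)) * vol_above w v' (r + 5 * \<eta> powr \<sigma>)"
    proof (rule step[OF w \<eta>])
      show "\<eta> < \<delta>1" using \<eta>_le \<eta> d by simp
      show "k0 \<le> v'" using v vv' by simp
      show "v' + \<eta> powr \<sigma> \<le> k1" using eq v G_pos[OF \<eta>] by simp
      show "r + 5 * \<eta> powr \<sigma> < 2" using r5' R by simp
    qed
    also have "\<dots> \<le> (excess \<delta> w v R + ennreal (C1 * (H \<delta> - H (2 * \<eta>))) * vol_above w v R)
        + ennreal (C1 * \<eta> powr (1/4)) * vol_above w v R"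
      using Suc.IH[OF r5[unfolded \<eta>2]]
      by (intro add_mono mult_left_mono vol_above_mono w vv' r5') (simp_all add: v'_def \<eta>2)
    also have "\<dots> = excess \<delta> w v R + ennreal (C1 * (H \<delta> - H \<eta>)) * vol_above w v R"
    proof -
      have "C1 * (H \<delta> - H \<eta>) = C1 * (H \<delta> - H (2 * \<eta>)) + C1 * \<eta> powr (1/4)"
        by (simp only: H2[OF \<eta>]) (simp add: algebra_simps)
      moreover have "0 \<le> C1 * (H \<delta> - H (2 * \<eta>))"
        using C1 H_mono[of "2 * \<eta>" \<delta>] \<eta> \<eta>_le by simp
      ultimately have "ennreal (C1 * (H \<delta> - H \<eta>)) = ennreal (C1 * (H \<delta> - H (2 * \<eta>))) + ennreal (C1 * \<eta> powr (1/4))"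
        using C1 by (simp only: ennreal_plus[symmetric] mult_nonneg_nonneg powr_ge_zero less_imp_le)
      then show ?thesis by (simp add: distrib_right add.assoc)
    qed
    finally show ?case unfolding \<eta>_def[symmetric] eq .
  qed

  \<comment> \<open>The smallness hypothesis kills the excess at scale \<delta>, so at all finer
    scales only the summed error is left, and \<open>measure_le_excess\<close> converts it into
    volume. Of \<open>6 * G \<delta>\<close>, five parts pay for the climb and one for the kernel
    radius \<delta>.\<close>
  have improve: "vol_above w (v + G \<delta>) r \<le> ennreal (2 * C1 * H \<delta>) * vol_above w v (r + 6 * G \<delta>)"
    if w: "sol w" and d: "0 < \<delta>" "\<delta> < \<delta>1" and v: "k0 \<le> v" "v + G \<delta> \<le> k1" and r: "r + 6 * G \<delta> < 2"
      and small: "ennreal (Kmax / \<delta> ^ DIM('a)) * vol_above w v (r + 6 * G \<delta>) \<le> ennreal (1/2)"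
    for w \<delta> v r
  proof -
    have wb: "w \<in> borel_measurable borel" using w by (rule sol_borel)
    define R where "R = r + 5 * G \<delta>"
    have Rd: "R + \<delta> \<le> r + 6 * G \<delta>" using G_ge[OF d] by (simp add: R_def)
    have ex0: "excess \<delta> w v R = 0"
    proof (rule excess_zero[OF wb d(1)])
      have "ennreal (Kmax / \<delta> ^ DIM('a)) * vol_above w v (R + \<delta>) \<le> ennreal (Kmax / \<delta> ^ DIM('a)) * vol_above w v (r + 6 * G \<delta>)"
        by (intro mult_left_mono vol_above_mono w Rd) auto
      then show "ennreal (Kmax / \<delta> ^ DIM('a)) * emeasure lborel (cube (R + \<delta>) \<inter> {x. w x > v}) \<le> ennreal (1/2)"
        using small by (simp add: vol_above_def)
    qed
    have "vol_above w (v + G \<delta>) r \<le> 2 * (ennreal (C1 * H \<delta>) * vol_above w v R)"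
      unfolding vol_above_def[of w "v + G \<delta>" r]
    proof (rule measure_le_excess[OF wb d(1)])
      fix i
      have \<eta>: "\<delta> / 2 ^ i > 0" "\<delta> / 2 ^ i \<le> \<delta>" using d by (auto simp: field_simps)
      have "excess (\<delta> / 2 ^ i) w (v + G \<delta>) r \<le> excess (\<delta> / 2 ^ i) w (v + (G \<delta> - G (\<delta> / 2 ^ i))) r"
        using G_pos[OF \<eta>(1)] by (intro excess_mono wb \<eta>) simp
      also have "\<dots> \<le> excess \<delta> w v R + ennreal (C1 * (H \<delta> - H (\<delta> / 2 ^ i))) * vol_above w v R"
        by (rule telescope[OF w d v]) (use r G_pos[OF d(1)] G_pos[OF \<eta>(1)] in \<open>auto simp: R_def\<close>)
      also have "\<dots> \<le> ennreal (C1 * H \<delta>) * vol_above w v R"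
        unfolding ex0 using C1 H_nonneg[of "\<delta> / 2 ^ i"]
        by (auto intro!: mult_right_mono ennreal_leI)
      finally show "excess (\<delta> / 2 ^ i) w (v + G \<delta>) r \<le> ennreal (C1 * H \<delta>) * vol_above w v R" .
    qed
    also have "\<dots> \<le> 2 * (ennreal (C1 * H \<delta>) * vol_above w v (r + 6 * G \<delta>))"
      using Rd d by (intro mult_left_mono vol_above_mono w) auto
    also have "\<dots> = ennreal (2 * C1 * H \<delta>) * vol_above w v (r + 6 * G \<delta>)"
      using C1 H_nonneg by (simp add: ennreal_mult mult.assoc)
    finally show ?thesis .
  qed

  define c3 where "c3 = c1 * 2 powr \<sigma> / (2 powr \<sigma> - 1)"
  have c3: "c3 > 0" using c1 two_powr \<sigma> by (simp add: c3_def)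
  define \<Gamma> where "\<Gamma> \<delta> = c3 * \<delta> powr \<sigma>" for \<delta> :: real
  have \<Gamma>2: "\<Gamma> \<delta> = \<Gamma> (\<delta> / 2) + G \<delta>" if "\<delta> > 0" for \<delta>
  proof -
    have "\<Gamma> (\<delta> / 2) = c1 / (2 powr \<sigma> - 1) * \<delta> powr \<sigma>"
      using that by (simp add: \<Gamma>_def c3_def powr_divide)
    moreover have "c3 = c1 / (2 powr \<sigma> - 1) + c1"
      using two_powr \<sigma> by (simp add: c3_def field_simps)
    ultimately show ?thesis by (simp add: \<Gamma>_def G_def distrib_right)
  qed
  have \<Gamma>_pos: "\<Gamma> \<delta> > 0" if "\<delta> > 0" for \<delta> using that c3 by (simp add: \<Gamma>_def)
  have \<Gamma>_mono: "\<Gamma> x \<le> \<Gamma> y" if "0 < x" "x \<le> y" for x y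
    using that \<sigma> c3 by (simp add: \<Gamma>_def powr_mono2 mult_left_mono)
  \<comment> \<open>\<open>q\<close> makes the total drop \<open>\<Gamma> \<delta>0\<close> fit
    between \<open>k0\<close> and \<open>k1\<close> and the radius
    \<open>1 + 6 * \<Gamma> \<delta>0\<close> stay below 2. \<open>p\<close> makes one use of
    \<open>improve\<close> gain the factor \<open>1 / 2 ^ DIM('a)\<close>.\<close>
  define q where "q = min (min (1/12) (k1 - k0) / c3) 1"
  have q: "q > 0" using c3 k01 by (simp add: q_def)
  define p where "p = 1 / (2 ^ DIM('a) * (2 * C1 * c2))"
  have p: "p > 0" using C1 c2 by (simp add: p_def)
  define \<delta>0 where "\<delta>0 = min (\<delta>1 / 2) (min (q powr (1 / \<sigma>)) (p powr 4))"
  have \<delta>0: "\<delta>0 > 0" "\<delta>0 < \<delta>1" using \<delta>1 q p by (auto simp: \<delta>0_def)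
  have \<Gamma>0: "\<Gamma> \<delta>0 \<le> 1/12" "\<Gamma> \<delta>0 \<le> k1 - k0"
  proof -
    have "\<delta>0 powr \<sigma> \<le> (q powr (1 / \<sigma>)) powr \<sigma>"
      using \<delta>0 \<sigma> by (intro powr_mono2) (auto simp: \<delta>0_def)
    also have "\<dots> = q" using q \<sigma> by (simp add: powr_powr)
    finally have "c3 * \<delta>0 powr \<sigma> \<le> c3 * q" using c3 by simp
    also have "\<dots> \<le> c3 * (min (1/12) (k1 - k0) / c3)" using c3 by (intro mult_left_mono) (auto simp: q_def)
    also have "\<dots> = min (1/12) (k1 - k0)" using c3 by simp
    finally show "\<Gamma> \<delta>0 \<le> 1/12" "\<Gamma> \<delta>0 \<le> k1 - k0" by (auto simp: \<Gamma>_def)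
  qed
  have H0: "2 * C1 * H \<delta>0 \<le> 1 / 2 ^ DIM('a)"
  proof -
    have "\<delta>0 powr (1/4) \<le> (p powr 4) powr (1/4)"
      using \<delta>0 by (intro powr_mono2) (auto simp: \<delta>0_def)
    also have "\<dots> = p" by (simp only: powr_powr) (use p in simp)
    finally have "(2 * C1 * c2) * \<delta>0 powr (1/4) \<le> (2 * C1 * c2) * p"
      using C1 c2 by (intro mult_left_mono) auto
    also have "\<dots> = 1 / 2 ^ DIM('a)" using C1 c2 by (simp add: p_def)
    finally show ?thesis by (simp add: H_def mult.assoc)
  qed
  \<comment> \<open>Calibrated so that a volume of \<open>c0 * \<delta> ^ DIM('a)\<close> meets the
    smallness hypothesis of \<open>improve\<close> with equality.\<close>
  define c0 where "c0 = 1 / (2 * Kmax)"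
  have c0: "c0 > 0" using Kmax by (simp add: c0_def)
  \<comment> \<open>Halving the scale lowers the admissible volume by the factor
    \<open>2 ^ DIM('a)\<close>, which is the gain of one step. The smallness hypothesis therefore
    reproduces itself at every scale.\<close>
  have main: "vol_above w (k0 + (\<Gamma> \<delta>0 - \<Gamma> (\<delta>0 / 2 ^ j))) (1 + 6 * \<Gamma> (\<delta>0 / 2 ^ j)) \<le> ennreal (c0 * (\<delta>0 / 2 ^ j) ^ DIM('a))"
    if w: "sol w" and small: "vol_above w k0 2 \<le> ennreal (c0 * \<delta>0 ^ DIM('a))" for w j
  proof (induction j)
    case 0
    have "vol_above w k0 (1 + 6 * \<Gamma> \<delta>0) \<le> vol_above w k0 2"
      using \<Gamma>0 by (intro vol_above_mono w) auto
    then show ?case using small by simp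
  next
    case (Suc j)
    define \<delta> where "\<delta> = \<delta>0 / 2 ^ j"
    have d: "\<delta> > 0" "\<delta> \<le> \<delta>0" using \<delta>0 by (auto simp: \<delta>_def field_simps)
    have half: "\<delta>0 / 2 ^ Suc j = \<delta> / 2" by (simp add: \<delta>_def)
    have half_pos: "\<delta> / 2 > 0" using d by simp
    define v where "v = k0 + (\<Gamma> \<delta>0 - \<Gamma> \<delta>)"
    define r where "r = 1 + 6 * \<Gamma> (\<delta> / 2)"
    have r6: "r + 6 * G \<delta> = 1 + 6 * \<Gamma> \<delta>" using \<Gamma>2[OF d(1)] by (simp add: r_def)
    have IH: "vol_above w v (r + 6 * G \<delta>) \<le> ennreal (c0 * \<delta> ^ DIM('a))"
      using Suc.IH unfolding \<delta>_def[symmetric] v_def[symmetric] r6[symmetric] .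
    have "vol_above w (v + G \<delta>) r \<le> ennreal (2 * C1 * H \<delta>) * vol_above w v (r + 6 * G \<delta>)"
    proof (rule improve[OF w d(1)])
      show "\<delta> < \<delta>1" using d \<delta>0 by simp
      show "k0 \<le> v" using \<Gamma>_mono[OF d] by (simp add: v_def)
      show "v + G \<delta> \<le> k1" using \<Gamma>2[OF d(1)] \<Gamma>_pos[OF half_pos] \<Gamma>0 by (simp add: v_def)
      show "r + 6 * G \<delta> < 2" unfolding r6 using \<Gamma>_mono[OF d] \<Gamma>0 by simp
      have "ennreal (Kmax / \<delta> ^ DIM('a)) * vol_above w v (r + 6 * G \<delta>) \<le> ennreal (Kmax / \<delta> ^ DIM('a)) * ennreal (c0 * \<delta> ^ DIM('a))"
        by (rule mult_left_mono[OF IH]) simp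
      also have "\<dots> = ennreal (Kmax / \<delta> ^ DIM('a) * (c0 * \<delta> ^ DIM('a)))"
        using d Kmax c0 by (intro ennreal_mult[symmetric]) (auto intro: less_imp_le)
      also have "Kmax / \<delta> ^ DIM('a) * (c0 * \<delta> ^ DIM('a)) = 1/2"
        using d Kmax by (simp add: c0_def)
      finally show "ennreal (Kmax / \<delta> ^ DIM('a)) * vol_above w v (r + 6 * G \<delta>) \<le> ennreal (1/2)" .
    qed
    also have "\<dots> \<le> ennreal (1 / 2 ^ DIM('a)) * ennreal (c0 * \<delta> ^ DIM('a))"
    proof (intro mult_mono IH ennreal_leI)
      show "2 * C1 * H \<delta> \<le> 1 / 2 ^ DIM('a)"
        using H0 mult_left_mono[OF H_mono[OF d], of "2 * C1"] C1 by linarith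
    qed auto
    also have "\<dots> = ennreal (c0 * (\<delta> / 2) ^ DIM('a))"
      using d c0 by (subst ennreal_mult[symmetric]) (auto simp: power_divide)
    finally have "vol_above w (v + G \<delta>) r \<le> ennreal (c0 * (\<delta> / 2) ^ DIM('a))" .
    moreover have "v + G \<delta> = k0 + (\<Gamma> \<delta>0 - \<Gamma> (\<delta> / 2))" using \<Gamma>2[OF d(1)] by (simp add: v_def)
    ultimately show ?case unfolding half r_def by simp
  qed
  show ?thesis
  proof (intro exI[of _ "c0 * \<delta>0 ^ DIM('a)"] conjI allI impI)
    show "c0 * \<delta>0 ^ DIM('a) > 0" using c0 \<delta>0 by simp
    fix w assume w: "sol w" and small: "vol_above w k0 2 \<le> ennreal (c0 * \<delta>0 ^ DIM('a))"
    have le: "vol_above w k1 1 \<le> ennreal (c0 * (\<delta>0 / 2 ^ j) ^ DIM('a))" for j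
    proof -
      have pos: "\<delta>0 / 2 ^ j > 0" using \<delta>0 by simp
      have "vol_above w k1 1 \<le> vol_above w (k0 + (\<Gamma> \<delta>0 - \<Gamma> (\<delta>0 / 2 ^ j))) (1 + 6 * \<Gamma> (\<delta>0 / 2 ^ j))"
        using \<Gamma>_pos[OF pos] \<Gamma>0 by (intro vol_above_mono w) auto
      then show ?thesis using main[OF w small, of j] by (rule order_trans)
    qed
    have "(\<lambda>j. \<delta>0 / 2 ^ j) \<longlonglongrightarrow> 0"
      by (intro tendsto_divide_0[OF tendsto_const] filterlim_at_top_imp_at_infinity filterlim_realpow_sequentially_gt1) simp
    then have "(\<lambda>j. c0 * (\<delta>0 / 2 ^ j) ^ DIM('a)) \<longlonglongrightarrow> c0 * 0 ^ DIM('a)"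
      by (intro tendsto_intros)
    then have "(\<lambda>j. ennreal (c0 * (\<delta>0 / 2 ^ j) ^ DIM('a))) \<longlonglongrightarrow> ennreal 0"
      by (intro tendsto_ennrealI) (simp add: zero_power)
    then have "vol_above w k1 1 \<le> ennreal 0"
      by (rule LIMSEQ_le_const) (use le in blast)
    then show "vol_above w k1 1 = 0" by simp
  qed
qed

end

subsection \<open>Local upper bounds for entropy solutions\<close>

text \<open>The entropy inequalities for (s - k)^+ alone. The integral extends over the whole space
  since \<open>grad \<phi>\<close> vanishes off the support of \<phi>; with a Borel \<open>g\<close>
  defined everywhere, dilations and restrictions become harmless.\<close>

definition kruzhkov :: "(real \<Rightarrow> 'a::euclidean_space) \<Rightarrow> 'a set \<Rightarrow> ('a \<Rightarrow> real) \<Rightarrow> bool" where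
  "kruzhkov A \<Omega> g \<longleftrightarrow> g \<in> borel_measurable borel \<and>
     (\<forall>k \<phi>. test_function \<Omega> \<phi> \<longrightarrow> (\<forall>x. \<phi> x \<ge> 0) \<longrightarrow>
        (\<integral>x. (A (max (g x) k) - A k) \<bullet> grad \<phi> x \<partial>lborel) \<ge> 0)"

lemma test_function_smooth: "test_function U \<phi> \<Longrightarrow> smooth \<phi>"
  by (simp add: test_function_def smooth_def)

lemma test_function_grad_zero:
  assumes "test_function U \<phi>" "\<And>x. \<phi> x \<ge> 0" "x \<notin> U"
  shows "grad \<phi> x = 0"
proof -
  have "closure {x. \<phi> x \<noteq> 0} \<subseteq> U" using assms(1) by (simp add: test_function_def)
  then have "x \<notin> {x. \<phi> x \<noteq> 0}" using assms(3) closure_subset[of "{x. \<phi> x \<noteq> 0}"] by auto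
  then have "\<phi> x = 0" by simp
  then show ?thesis
    using assms(1,2) by (intro grad_eq_0 smooth_differentiable test_function_smooth) auto
qed

text \<open>\<open>entropy_flux\<close> imposes a derivative only where the entropy has one. This
  settles the kink at \<open>k\<close>, where the flux of the positive part may well fail to be
  differentiable.\<close>

lemma positive_part_not_differentiable: "\<not> (\<lambda>v. max (v - k) 0) differentiable (at (k :: real))"
proof
  assume "(\<lambda>v. max (v - k) 0) differentiable (at k)"
  then obtain D where D: "((\<lambda>v. max (v - k) 0) has_real_derivative D) (at k)"
    using real_differentiable_def by blast
  then have lim: "((\<lambda>h. (max (k + h - k) 0 - max (k - k) 0) / h) \<longlongrightarrow> D) (at 0)"
    by (simp add: DERIV_def)
  have "((\<lambda>h. (max (k + h - k) 0 - max (k - k) 0) / h) \<longlongrightarrow> D) (at_right 0)"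
    "((\<lambda>h. (max (k + h - k) 0 - max (k - k) 0) / h) \<longlongrightarrow> D) (at_left 0)"
    using lim by (simp_all add: filterlim_at_split)
  moreover have "((\<lambda>h. (max (k + h - k) 0 - max (k - k) 0) / h) \<longlongrightarrow> 1) (at_right 0)"
    by (rule Lim_transform_eventually[OF tendsto_const]) (auto intro!: eventually_at_rightI[of 0 1])
  moreover have "((\<lambda>h. (max (k + h - k) 0 - max (k - k) 0) / h) \<longlongrightarrow> 0) (at_left 0)"
    by (rule Lim_transform_eventually[OF tendsto_const]) (auto intro!: eventually_at_leftI[of "-1"])
  ultimately have "D = 1" "D = 0" by (auto intro: tendsto_unique[rotated])
  then show False by simp
qed

lemma kruzhkov_entropy_flux:
  fixes A a :: "real \<Rightarrow> 'a::euclidean_space"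
  assumes A: "\<And>v. (A has_vector_derivative a v) (at v)"
  shows "entropy_flux a (\<lambda>v. max (v - k) 0) (\<lambda>v. A (max v k) - A k)"
  unfolding entropy_flux_def
proof (intro conjI allI impI)
  have cA: "continuous_on UNIV A"
    by (intro continuous_at_imp_continuous_on ballI has_vector_derivative_continuous[OF A])
  show "continuous_on UNIV (\<lambda>v. A (max v k) - A k)"
    by (intro continuous_intros continuous_on_compose2[OF cA]) auto
  fix v assume diff: "(\<lambda>v. max (v - k) 0) differentiable (at v)"
  consider "v < k" | "v > k" | "v = k" by linarith
  then show "((\<lambda>v. A (max v k) - A k) has_vector_derivative deriv (\<lambda>v. max (v - k) 0) v *\<^sub>R a v) (at v)"
  proof cases
    case 1
    have "((\<lambda>v. max (v - k) 0) has_real_derivative 0) (at v)"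
      by (rule has_field_derivative_transform_within_open[where S="{..<k}" and f="\<lambda>v. 0"]) (use 1 in auto)
    then have d: "deriv (\<lambda>v. max (v - k) 0) v = 0" by (rule DERIV_imp_deriv)
    have "((\<lambda>v. A (max v k) - A k) has_vector_derivative 0) (at v)"
      by (rule has_vector_derivative_transform_within_open[where S="{..<k}" and f="\<lambda>v. 0"]) (use 1 in auto)
    then show ?thesis by (simp add: d)
  next
    case 2
    have "((\<lambda>v. max (v - k) 0) has_real_derivative 1) (at v)"
      by (rule has_field_derivative_transform_within_open[where S="{k<..}" and f="\<lambda>v. v - k"])
        (use 2 in \<open>auto intro!: derivative_eq_intros\<close>)
    then have d: "deriv (\<lambda>v. max (v - k) 0) v = 1" by (rule DERIV_imp_deriv)
    have "((\<lambda>v. A v - A k) has_vector_derivative a v) (at v)"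
      using has_vector_derivative_diff[OF A has_vector_derivative_const] by simp
    then have "((\<lambda>v. A (max v k) - A k) has_vector_derivative a v) (at v)"
      by (rule has_vector_derivative_transform_within_open[where S="{k<..}"]) (use 2 in auto)
    then show ?thesis by (simp add: d)
  next
    case 3
    then show ?thesis using diff positive_part_not_differentiable by blast
  qed
qed

lemma convex_on_positive_part: "convex_on UNIV (\<lambda>v::real. max (v - k) 0)"
proof (rule convex_onI)
  fix t x y :: real assume t: "0 < t" "t < 1"
  have "(1 - t) * x + t * y - k = (1 - t) * (x - k) + t * (y - k)" by (simp add: algebra_simps)
  also have "\<dots> \<le> (1 - t) * max (x - k) 0 + t * max (y - k) 0"
    using t by (intro add_mono mult_left_mono) auto
  finally show "max ((1 - t) *\<^sub>R x + t *\<^sub>R y - k) 0 \<le> (1 - t) * max (x - k) 0 + t * max (y - k) 0"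
    using t by simp
qed simp

text \<open>The representative is \<open>u\<close> extended by 0, replaced by a Borel version and
  clipped at the essential bound. It is bounded everywhere, and Borel measurability survives
  composition with affine maps.\<close>

lemma entropy_solution_imp_kruzhkov:
  fixes A a :: "real \<Rightarrow> 'a::euclidean_space"
  assumes A: "\<And>v. (A has_vector_derivative a v) (at v)" and \<Omega>: "open \<Omega>" and u: "entropy_solution a \<Omega> u"
  shows "\<exists>M g. kruzhkov A \<Omega> g \<and> (\<forall>x. \<bar>g x\<bar> \<le> M) \<and> (AE x in lborel. x \<in> \<Omega> \<longrightarrow> u x = g x)"
proof -
  have \<Omega>L: "\<Omega> \<in> sets lebesgue" using \<Omega> by auto
  obtain M where um: "u \<in> borel_measurable (lebesgue_on \<Omega>)" and M: "AE x in lebesgue_on \<Omega>. \<bar>u x\<bar> \<le> M"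
    using u unfolding entropy_solution_def L_infinity_def by blast
  define u0 where "u0 x = (if x \<in> \<Omega> then u x else 0)" for x
  have u0: "u0 \<in> borel_measurable lebesgue"
    using um \<Omega>L by (simp add: u0_def[abs_def] borel_measurable_if)
  then obtain g0 where g0: "g0 \<in> borel_measurable lborel" "AE x in lborel. u0 x = g0 x"
    using completion_ex_borel_measurable_real by blast
  define M' where "M' = max M 0"
  define g where "g x = max (- M') (min M' (g0 x))" for x
  have [measurable]: "g0 \<in> borel_measurable borel" using g0(1) by simp
  have g_borel [measurable]: "g \<in> borel_measurable borel" unfolding g_def[abs_def] by measurable
  have gM: "\<bar>g x\<bar> \<le> M'" for x by (auto simp: g_def M'_def)
  have M_ae: "AE x in lborel. x \<in> \<Omega> \<longrightarrow> \<bar>u x\<bar> \<le> M"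
    using M \<Omega>L by (simp add: AE_restrict_space_iff AE_completion_iff)
  have ug: "AE x in lborel. x \<in> \<Omega> \<longrightarrow> u x = g x"
    using g0(2) M_ae by eventually_elim (auto simp: g_def M'_def u0_def)
  have cA: "continuous_on UNIV A"
    by (intro continuous_at_imp_continuous_on ballI has_vector_derivative_continuous[OF A])
  have "kruzhkov A \<Omega> g"
    unfolding kruzhkov_def
  proof (intro conjI allI impI g_borel)
    fix k \<phi> assume \<phi>: "test_function \<Omega> \<phi>" "\<forall>x. \<phi> x \<ge> 0"
    let ?q = "\<lambda>v. A (max v k) - A k"
    have [measurable]: "?q \<in> borel_measurable borel"
      by (intro borel_measurable_continuous_onI continuous_intros continuous_on_compose2[OF cA]) auto
    have [measurable]: "grad \<phi> \<in> borel_measurable borel"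
      by (intro borel_measurable_continuous_onI smooth_continuous_on_grad test_function_smooth[OF \<phi>(1)])
    have "0 \<le> (LINT x|lebesgue_on \<Omega>. ?q (u x) \<bullet> grad \<phi> x)"
      using u kruzhkov_entropy_flux[OF A] convex_on_positive_part \<phi> unfolding entropy_solution_def by blast
    also have "\<dots> = (LINT x|lebesgue. indicator \<Omega> x *\<^sub>R (?q (u x) \<bullet> grad \<phi> x))"
      using \<Omega>L by (subst integral_restrict_space) auto
    also have "\<dots> = (LINT x|lebesgue. ?q (g x) \<bullet> grad \<phi> x)"
    proof (rule integral_cong_AE)
      have eq: "AE x in lebesgue. indicator \<Omega> x *\<^sub>R (?q (u x) \<bullet> grad \<phi> x) = ?q (g x) \<bullet> grad \<phi> x"
        unfolding AE_completion_iff
        using ug by eventually_elim (use test_function_grad_zero[OF \<phi>(1)] \<phi>(2) in \<open>auto simp: indicator_def\<close>)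
      then show "AE x in lebesgue. indicator \<Omega> x *\<^sub>R (?q (u x) \<bullet> grad \<phi> x) = ?q (g x) \<bullet> grad \<phi> x" .
      have "(\<lambda>x. ?q (g x) \<bullet> grad \<phi> x) \<in> borel_measurable borel" by measurable
      then show b: "(\<lambda>x. ?q (g x) \<bullet> grad \<phi> x) \<in> borel_measurable lebesgue"
        by (simp add: measurable_completion)
      show "(\<lambda>x. indicator \<Omega> x *\<^sub>R (?q (u x) \<bullet> grad \<phi> x)) \<in> borel_measurable lebesgue"
      proof -
        have [measurable]: "\<Omega> \<in> sets lebesgue" "grad \<phi> \<in> borel_measurable lebesgue"
          using \<Omega>L by (auto intro!: measurable_completion)
        have [measurable]: "u0 \<in> borel_measurable lebesgue" using u0 .
        have "(\<lambda>x. indicator \<Omega> x *\<^sub>R (?q (u0 x) \<bullet> grad \<phi> x)) \<in> borel_measurable lebesgue"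
          by measurable
        also have "(\<lambda>x. indicator \<Omega> x *\<^sub>R (?q (u0 x) \<bullet> grad \<phi> x)) = (\<lambda>x. indicator \<Omega> x *\<^sub>R (?q (u x) \<bullet> grad \<phi> x))"
          by (auto simp: u0_def indicator_def)
        finally show ?thesis .
      qed
    qed
    also have "\<dots> = (LINT x|lborel. ?q (g x) \<bullet> grad \<phi> x)"
      by (rule integral_completion) measurable
    finally show "0 \<le> (\<integral>x. (A (max (g x) k) - A k) \<bullet> grad \<phi> x \<partial>lborel)" .
  qed
  then show ?thesis using gM ug by blast
qed

text \<open>The equation is homogeneous of first order. Carrying a test function from
  \<open>U\<close> to \<Omega> produces the Jacobian and one factor 1 / s from the gradient, which
  together are positive and can be divided out.\<close>

lemma kruzhkov_affine:
  fixes A :: "real \<Rightarrow> 'a::euclidean_space"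
  assumes A: "continuous_on UNIV A" and g: "kruzhkov A \<Omega> g" and s: "s > 0" and sub: "(\<lambda>z. c + s *\<^sub>R z) ` U \<subseteq> \<Omega>"
  shows "kruzhkov A U (\<lambda>z. g (c + s *\<^sub>R z))"
  unfolding kruzhkov_def
proof (intro conjI allI impI)
  have [measurable]: "g \<in> borel_measurable borel" using g by (simp add: kruzhkov_def)
  show "(\<lambda>z. g (c + s *\<^sub>R z)) \<in> borel_measurable borel" by measurable
  fix k \<phi> assume \<phi>: "test_function U \<phi>" "\<forall>x. \<phi> x \<ge> 0"
  have [measurable]: "(\<lambda>v. A (max v k) - A k) \<in> borel_measurable borel"
    by (intro borel_measurable_continuous_onI continuous_intros continuous_on_compose2[OF A]) auto
  define \<psi> where "\<psi> y = 1 * \<phi> ((1 / s) *\<^sub>R y + (- (1 / s)) *\<^sub>R c)" for y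
  have \<psi>: "smooth \<psi>" "grad \<psi> y = (1 / s) *\<^sub>R grad \<phi> ((1 / s) *\<^sub>R y + (- (1 / s)) *\<^sub>R c)" for y
    unfolding \<psi>_def[abs_def]
    using smooth_affine[OF test_function_smooth[OF \<phi>(1)], of 1 "1 / s" "(- (1 / s)) *\<^sub>R c"]
    by (simp_all only: mult_1_left)
  have [measurable]: "grad \<psi> \<in> borel_measurable borel"
    by (intro borel_measurable_continuous_onI smooth_continuous_on_grad \<psi>)
  let ?S = "closure {x. \<phi> x \<noteq> 0}"
  let ?T = "(\<lambda>z. c + s *\<^sub>R z) ` ?S"
  have S: "compact ?S" "?S \<subseteq> U" using \<phi>(1) by (auto simp: test_function_def)
  have T: "compact ?T" by (intro compact_continuous_image S continuous_intros)
  have "{y. \<psi> y \<noteq> 0} \<subseteq> ?T"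
  proof
    fix y assume "y \<in> {y. \<psi> y \<noteq> 0}"
    then have "(1 / s) *\<^sub>R y + (- (1 / s)) *\<^sub>R c \<in> ?S"
      by (intro subsetD[OF closure_subset]) (simp add: \<psi>_def)
    moreover have "y = c + s *\<^sub>R ((1 / s) *\<^sub>R y + (- (1 / s)) *\<^sub>R c)"
      using s by (simp add: scaleR_add_right scaleR_diff_right)
    ultimately show "y \<in> ?T" by blast
  qed
  then have cl: "closure {y. \<psi> y \<noteq> 0} \<subseteq> ?T"
    by (intro closure_minimal compact_imp_closed T)
  then have "compact (closure {y. \<psi> y \<noteq> 0})"
    using T by (meson bounded_subset closed_closure compact_eq_bounded_closed)
  moreover have "closure {y. \<psi> y \<noteq> 0} \<subseteq> \<Omega>" using cl S(2) sub by blast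
  ultimately have "test_function \<Omega> \<psi>"
    using \<psi>(1) by (simp add: test_function_def smooth_def)
  moreover have "\<forall>y. \<psi> y \<ge> 0" using \<phi>(2) by (simp add: \<psi>_def)
  ultimately have "0 \<le> (\<integral>y. (A (max (g y) k) - A k) \<bullet> grad \<psi> y \<partial>lborel)"
    using g by (simp add: kruzhkov_def)
  also have "\<dots> = \<bar>s\<bar> ^ DIM('a) *\<^sub>R (\<integral>z. (A (max (g (c + s *\<^sub>R z)) k) - A k) \<bullet> grad \<psi> (c + s *\<^sub>R z) \<partial>lborel)"
    by (rule integral_lborel_affine) (use s in auto)
  also have "(\<lambda>z. (A (max (g (c + s *\<^sub>R z)) k) - A k) \<bullet> grad \<psi> (c + s *\<^sub>R z))
     = (\<lambda>z. (1 / s) * ((A (max (g (c + s *\<^sub>R z)) k) - A k) \<bullet> grad \<phi> z))"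
  proof
    fix z
    have "(1 / s) *\<^sub>R (c + s *\<^sub>R z) + (- (1 / s)) *\<^sub>R c = z"
      using s by (simp add: scaleR_add_right scaleR_diff_right)
    then have "grad \<psi> (c + s *\<^sub>R z) = (1 / s) *\<^sub>R grad \<phi> z" by (simp only: \<psi>(2))
    then show "(A (max (g (c + s *\<^sub>R z)) k) - A k) \<bullet> grad \<psi> (c + s *\<^sub>R z)
      = (1 / s) * ((A (max (g (c + s *\<^sub>R z)) k) - A k) \<bullet> grad \<phi> z)" by simp
  qed
  also have "\<bar>s\<bar> ^ DIM('a) *\<^sub>R (\<integral>z. (1 / s) * ((A (max (g (c + s *\<^sub>R z)) k) - A k) \<bullet> grad \<phi> z) \<partial>lborel)
    = (s ^ DIM('a) / s) * (\<integral>z. (A (max (g (c + s *\<^sub>R z)) k) - A k) \<bullet> grad \<phi> z \<partial>lborel)"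
    using s by (subst integral_mult_right_zero) simp
  finally have "0 \<le> (s ^ DIM('a) / s) * (\<integral>z. (A (max (g (c + s *\<^sub>R z)) k) - A k) \<bullet> grad \<phi> z \<partial>lborel)" .
  moreover have "s ^ DIM('a) / s > 0" using s by simp
  ultimately show "0 \<le> (\<integral>z. (A (max (g (c + s *\<^sub>R z)) k) - A k) \<bullet> grad \<phi> z \<partial>lborel)"
    by (meson mult_pos_neg not_le)
qed

section \<open>Scaling the bound to balls of arbitrary radius\<close>

lemma norm_le_cube: "z \<in> cube r \<Longrightarrow> norm z \<le> DIM('a) * r" for z :: "'a::euclidean_space" and r :: real
proof -
  assume "z \<in> cube r"
  then have "(\<Sum>b\<in>Basis. \<bar>z \<bullet> b\<bar>) \<le> (\<Sum>b\<in>(Basis :: 'a set). r)"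
    by (intro sum_mono) (auto simp: mem_cube)
  then show ?thesis using norm_le_l1[of z] by simp
qed

lemma C1_bounds:
  fixes a :: "real \<Rightarrow> 'a::euclidean_space"
  assumes "a C1_differentiable_on UNIV"
  shows "\<exists>A0>0. \<forall>v. \<bar>v\<bar> \<le> M \<longrightarrow> norm (a v) \<le> A0"
    and "\<exists>L\<ge>0. \<forall>v v'. \<bar>v\<bar> \<le> M \<longrightarrow> \<bar>v'\<bar> \<le> M \<longrightarrow> norm (a v - a v') \<le> L * \<bar>v - v'\<bar>"
proof -
  obtain D where D: "\<And>x. (a has_vector_derivative D x) (at x)" "continuous_on UNIV D"
    using assms unfolding C1_differentiable_on_def by auto
  have bound: "\<exists>B>0. \<forall>v. \<bar>v\<bar> \<le> M \<longrightarrow> norm (f v) \<le> B" if "continuous_on UNIV f" for f :: "real \<Rightarrow> 'a"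
  proof -
    have "compact (f ` {-M..M})"
      using that continuous_on_subset by (intro compact_continuous_image) auto
    then obtain B where "B > 0" "\<And>y. y \<in> f ` {-M..M} \<Longrightarrow> norm y \<le> B"
      using compact_imp_bounded bounded_pos by metis
    then show ?thesis by (intro exI[of _ B]) (auto simp: abs_le_iff)
  qed
  have "continuous_on UNIV a"
    by (intro continuous_at_imp_continuous_on ballI has_vector_derivative_continuous[OF D(1)])
  then show "\<exists>A0>0. \<forall>v. \<bar>v\<bar> \<le> M \<longrightarrow> norm (a v) \<le> A0" by (rule bound)
  obtain B where B: "B > 0" "\<And>v. \<bar>v\<bar> \<le> M \<Longrightarrow> norm (D v) \<le> B" using bound[OF D(2)] by blast
  have "norm (a v - a v') \<le> B * \<bar>v - v'\<bar>" if "\<bar>v\<bar> \<le> M" "\<bar>v'\<bar> \<le> M" for v v'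
  proof -
    have "norm (a v - a v') \<le> B * norm (v - v')"
    proof (rule differentiable_bound[where S="{-M..M}" and f'="\<lambda>v h. h *\<^sub>R D v"])
      fix x assume "x \<in> {-M..M}"
      then show "onorm (\<lambda>h. h *\<^sub>R D x) \<le> B"
        using B(2)[of x] by (intro onorm_le) (auto simp: abs_le_iff mult.commute[of B] intro!: mult_left_mono)
    qed (use that D(1) in \<open>auto simp: has_vector_derivative_def abs_le_iff intro: has_derivative_at_withinI\<close>)
    then show ?thesis by simp
  qed
  then show "\<exists>L\<ge>0. \<forall>v v'. \<bar>v\<bar> \<le> M \<longrightarrow> \<bar>v'\<bar> \<le> M \<longrightarrow> norm (a v - a v') \<le> L * \<bar>v - v'\<bar>"
    using B(1) by (intro exI[of _ B]) auto
qed

text \<open>\<open>core\<close> after rescaling. The threshold \<eta> is chosen before \<Omega>,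
  \<open>g\<close>, \<open>c\<close> and \<open>s\<close>, so one value serves a whole blow-up. The
  factor \<open>3 * DIM('a)\<close> appears because points of \<open>cube 2\<close> have norm at
  most \<open>2 * DIM('a)\<close>; conversely the unit ball lies in \<open>cube 1\<close>.\<close>

lemma local_upper_bound:
  fixes A a :: "real \<Rightarrow> 'a::euclidean_space"
  assumes A: "\<And>v. (A has_vector_derivative a v) (at v)" and closed_I: "closed I" and GN: "genuinely_nonlinear I a"
    and k: "k0 < k1" "{k0..k1} \<subseteq> I"
  shows "\<exists>\<eta>>0. \<forall>\<Omega> g c (s::real). kruzhkov A \<Omega> g \<longrightarrow> (\<forall>x. \<bar>g x\<bar> \<le> M) \<longrightarrow> s > 0 \<longrightarrow>
    ball c (3 * DIM('a) * s) \<subseteq> \<Omega> \<longrightarrow>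
    emeasure lborel (ball c (3 * DIM('a) * s) \<inter> {x. g x > k0}) \<le> ennreal (s ^ DIM('a)) * ennreal \<eta> \<longrightarrow>
    (AE x in lborel. x \<in> ball c s \<longrightarrow> g x \<le> k1)"
proof -
  \<comment> \<open>Large enough for the solution and both levels, and positive whatever the sign of
    \<open>M\<close>.\<close>
  define M' where "M' = \<bar>M\<bar> + \<bar>k0\<bar> + \<bar>k1\<bar> + 1"
  obtain K :: "'a \<Rightarrow> real" where K: "mollifier K" using mollifier_exists by blast
  have C1: "a C1_differentiable_on UNIV" using GN by (simp add: genuinely_nonlinear_def)
  obtain A0 where A0: "A0 > 0" "\<And>v. \<bar>v\<bar> \<le> M' \<Longrightarrow> norm (a v) \<le> A0" using C1_bounds(1)[OF C1] by blast
  obtain L where L: "L \<ge> 0" "\<And>v v'. \<bar>v\<bar> \<le> M' \<Longrightarrow> \<bar>v'\<bar> \<le> M' \<Longrightarrow> norm (a v - a v') \<le> L * \<bar>v - v'\<bar>"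
    using C1_bounds(2)[OF C1] by blast
  obtain \<alpha> C where \<alpha>: "0 < \<alpha>" "\<alpha> \<le> 1" and C: "C > 0"
    and meas: "\<And>\<xi> \<delta>. norm \<xi> = 1 \<Longrightarrow> \<delta> > 0 \<Longrightarrow> emeasure lborel {v \<in> I. \<bar>a v \<bullet> \<xi>\<bar> < \<delta>} \<le> ennreal (C * \<delta> powr \<alpha>)"
    using GN unfolding genuinely_nonlinear_def by blast
  have "continuous_on UNIV a"
    using C1 C1_differentiable_imp_continuous_on by blast
  then have open_set: "open {v. \<bar>a v \<bullet> \<xi>\<bar> < \<theta>}" for \<xi> \<theta>
    by (intro open_Collect_less continuous_intros)
  have meas': "emeasure lborel {v \<in> {k0..k1}. \<bar>a v \<bullet> \<xi>\<bar> < \<theta>} \<le> ennreal (C * \<theta> powr \<alpha>)"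
    if "norm \<xi> = 1" "\<theta> > 0" for \<xi> \<theta>
  proof -
    have "{v \<in> I. \<bar>a v \<bullet> \<xi>\<bar> < \<theta>} = I \<inter> {v. \<bar>a v \<bullet> \<xi>\<bar> < \<theta>}" by auto
    then have "{v \<in> I. \<bar>a v \<bullet> \<xi>\<bar> < \<theta>} \<in> sets lborel"
      using closed_I open_set[of \<xi> \<theta>] by auto
    then have "emeasure lborel {v \<in> {k0..k1}. \<bar>a v \<bullet> \<xi>\<bar> < \<theta>} \<le> emeasure lborel {v \<in> I. \<bar>a v \<bullet> \<xi>\<bar> < \<theta>}"
      using k(2) by (intro emeasure_mono) auto
    then show ?thesis using meas[OF that] by (rule order_trans)
  qed
  interpret nonlinear_law K A a M' A0 L k0 k1 C \<alpha>
  proof (intro nonlinear_law.intro scalar_law.intro K)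
    show "scalar_law_axioms A a M' A0 L"
      by standard (use A A0 L in \<open>auto simp: M'_def\<close>)
    show "nonlinear_law_axioms a M' k0 k1 C \<alpha>"
      by standard (use \<alpha> C meas' in \<open>auto simp: M'_def\<close>)
  qed
  obtain \<eta> where \<eta>: "\<eta> > 0" "\<And>w. sol w \<Longrightarrow> vol_above w k0 2 \<le> ennreal \<eta> \<Longrightarrow> vol_above w k1 1 = 0"
    using core[OF k(1)] by blast
  show ?thesis
  proof (intro exI[of _ \<eta>] conjI allI impI \<eta>(1))
    fix \<Omega> g c and s :: real
    assume g: "kruzhkov A \<Omega> g" and gM: "\<forall>x. \<bar>g x\<bar> \<le> M" and s: "s > 0"
      and sub: "ball c (3 * DIM('a) * s) \<subseteq> \<Omega>"
      and small: "emeasure lborel (ball c (3 * DIM('a) * s) \<inter> {x. g x > k0}) \<le> ennreal (s ^ DIM('a)) * ennreal \<eta>"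
    have [measurable]: "g \<in> borel_measurable borel" using g by (simp add: kruzhkov_def)
    define w where "w z = g (c + s *\<^sub>R z)" for z
    have [measurable]: "w \<in> borel_measurable borel" unfolding w_def by measurable
    have img: "c + s *\<^sub>R z \<in> ball c (3 * DIM('a) * s)" if "z \<in> cube 2" for z :: 'a
    proof -
      have "norm z < 3 * DIM('a)" using norm_le_cube[OF that] DIM_positive[where 'a='a] by linarith
      then have "s * norm z < s * (3 * DIM('a))" using s by (intro mult_strict_left_mono) auto
      then show ?thesis using s by (simp add: dist_norm mult_ac)
    qed
    let ?U = "box (- (2 *\<^sub>R One)) (2 *\<^sub>R One :: 'a)"
    have U_cube: "?U \<subseteq> cube 2" unfolding cube_def by (rule box_subset_cbox)
    have "kruzhkov A ?U w"
      unfolding w_def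
      by (rule kruzhkov_affine[OF continuous_on_A g s]) (use U_cube img sub in blast)
    moreover have "\<bar>w x\<bar> \<le> M'" for x
    proof -
      have "\<bar>w x\<bar> \<le> M" using gM by (simp add: w_def)
      then show ?thesis by (simp add: M'_def)
    qed
    ultimately have w: "sol w"
      by (simp add: sol_def kruzhkov_def flux_def)
    have scale: "emeasure lborel S = ennreal (s ^ DIM('a)) * emeasure lborel {z. c + s *\<^sub>R z \<in> S}"
      if [measurable]: "S \<in> sets borel" for S
    proof -
      have "emeasure lborel S = (\<integral>\<^sup>+x. indicator S x \<partial>lborel)" by simp
      also have "\<dots> = ennreal (\<bar>s\<bar> ^ DIM('a)) * (\<integral>\<^sup>+x. indicator S (c + s *\<^sub>R x) \<partial>lborel)"
        using s by (intro nn_integral_lborel_affine) auto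
      also have "(\<integral>\<^sup>+x. indicator S (c + s *\<^sub>R x) \<partial>lborel) = (\<integral>\<^sup>+x. indicator {z. c + s *\<^sub>R z \<in> S} x \<partial>lborel)"
        by (intro nn_integral_cong) (simp add: indicator_def)
      also have "\<dots> = emeasure lborel {z. c + s *\<^sub>R z \<in> S}" by (rule nn_integral_indicator) measurable
      finally show ?thesis using s by simp
    qed
    have "ennreal (s ^ DIM('a)) * vol_above w k0 2
       \<le> ennreal (s ^ DIM('a)) * emeasure lborel {z. c + s *\<^sub>R z \<in> ball c (3 * DIM('a) * s) \<inter> {x. g x > k0}}"
      unfolding vol_above_def using img by (intro mult_left_mono emeasure_mono) (auto simp: w_def)
    also have "\<dots> \<le> ennreal (s ^ DIM('a)) * ennreal \<eta>"
      using small by (subst scale[symmetric]) auto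
    finally have "vol_above w k0 2 \<le> ennreal \<eta>"
      using s by (subst (asm) ennreal_mult_le_mult_iff) auto
    then have "vol_above w k1 1 = 0" by (rule \<eta>(2)[OF w])
    moreover have "emeasure lborel (ball c s \<inter> {x. g x > k1}) \<le> ennreal (s ^ DIM('a)) * vol_above w k1 1"
    proof -
      have "{z. c + s *\<^sub>R z \<in> ball c s \<inter> {x. g x > k1}} \<subseteq> cube 1 \<inter> {x. w x > k1}"
      proof
        fix z assume z: "z \<in> {z. c + s *\<^sub>R z \<in> ball c s \<inter> {x. g x > k1}}"
        then have "norm z < 1" using s by (simp add: dist_norm)
        then have "z \<in> cube 1" unfolding mem_cube by (meson Basis_le_norm less_imp_le order_trans)
        then show "z \<in> cube 1 \<inter> {x. w x > k1}" using z by (simp add: w_def)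
      qed
      then show ?thesis
        unfolding vol_above_def by (subst scale) (auto intro!: mult_left_mono emeasure_mono)
    qed
    ultimately have "emeasure lborel (ball c s \<inter> {x. g x > k1}) = 0" by simp
    then have "ball c s \<inter> {x. g x > k1} \<in> null_sets lborel" by (intro null_setsI) auto
    then have "AE x in lborel. x \<notin> ball c s \<inter> {x. g x > k1}" by (rule AE_not_in)
    then show "AE x in lborel. x \<in> ball c s \<longrightarrow> g x \<le> k1" by eventually_elim auto
  qed
qed

subsection \<open>Blow-up limits\<close>

lemma AE_lborel_affine:
  fixes c :: "'a::euclidean_space"
  assumes "AE x in lborel. P x" and r: "r \<noteq> 0"
  shows "AE z in lborel. P (c + r *\<^sub>R z)"
proof -
  obtain N where N: "N \<in> null_sets lborel" "{x \<in> space lborel. \<not> P x} \<subseteq> N"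
    using assms(1) unfolding eventually_ae_filter by blast
  have [measurable]: "N \<in> sets borel" using N(1) by auto
  have "0 = (\<integral>\<^sup>+x. indicator N x \<partial>lborel)" using N(1) by (simp add: null_setsD1)
  also have "\<dots> = ennreal (\<bar>r\<bar> ^ DIM('a)) * (\<integral>\<^sup>+z. indicator N (c + r *\<^sub>R z) \<partial>lborel)"
    by (rule nn_integral_lborel_affine[OF _ r]) measurable
  finally have "(\<integral>\<^sup>+z. indicator N (c + r *\<^sub>R z) \<partial>lborel) = 0" using r by auto
  then have "AE z in lborel. (indicator N (c + r *\<^sub>R z) :: ennreal) = 0"
    by (subst (asm) nn_integral_0_iff_AE) auto
  then show ?thesis
    by eventually_elim (use N(2) in \<open>auto simp: indicator_def split: if_splits\<close>)
qed

text \<open>If \<eta>, q is an entropy pair for the reflected velocity, then \<eta>(-v), q(-v) is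
  one for \<open>a\<close>, since the chain rule changes the sign of both derivatives. With this,
  every lower bound below is an upper bound for the reflected problem.\<close>

lemma entropy_solution_reflect:
  fixes a :: "real \<Rightarrow> 'a::euclidean_space"
  assumes "entropy_solution a \<Omega> u"
  shows "entropy_solution (\<lambda>v. a (- v)) \<Omega> (\<lambda>x. - u x)"
proof -
  obtain M where "u \<in> borel_measurable (lebesgue_on \<Omega>)" "AE x in lebesgue_on \<Omega>. \<bar>u x\<bar> \<le> M"
    using assms unfolding entropy_solution_def L_infinity_def by blast
  then have "L_infinity \<Omega> (\<lambda>x. - u x)" unfolding L_infinity_def by auto
  moreover have "0 \<le> (LINT x|lebesgue_on \<Omega>. q (- u x) \<bullet> grad \<phi> x)"
    if \<eta>: "convex_on UNIV \<eta>" and q: "entropy_flux (\<lambda>v. a (- v)) \<eta> q"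
      and \<phi>: "test_function \<Omega> \<phi>" "\<forall>x. \<phi> x \<ge> 0" for \<eta> q \<phi>
  proof -
    have c: "convex_on UNIV (\<lambda>v. \<eta> (- v))"
    proof (rule convex_onI)
      fix t x y :: real assume "0 < t" "t < 1"
      then have "\<eta> ((1 - t) *\<^sub>R (- x) + t *\<^sub>R (- y)) \<le> (1 - t) * \<eta> (- x) + t * \<eta> (- y)"
        using \<eta> by (intro convex_onD[where A=UNIV]) auto
      then show "\<eta> (- ((1 - t) *\<^sub>R x + t *\<^sub>R y)) \<le> (1 - t) * \<eta> (- x) + t * \<eta> (- y)"
        by (simp add: algebra_simps)
    qed simp
    have "entropy_flux a (\<lambda>v. \<eta> (- v)) (\<lambda>v. q (- v))"
      unfolding entropy_flux_def
    proof (intro conjI allI impI)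
      have "continuous_on UNIV q" using q by (simp add: entropy_flux_def)
      then show "continuous_on UNIV (\<lambda>v. q (- v))"
        by (rule continuous_on_compose2) (auto intro!: continuous_intros)
      fix v assume d: "(\<lambda>v. \<eta> (- v)) differentiable (at v)"
      then obtain D where D: "((\<lambda>v. \<eta> (- v)) has_real_derivative D) (at v)"
        using real_differentiable_def by blast
      have "((\<lambda>v. \<eta> (- (- v))) has_real_derivative D * (- 1)) (at (- v))"
        using D by (intro DERIV_chain2[where f="\<lambda>v. \<eta> (- v)" and g=uminus]) (auto intro!: derivative_eq_intros)
      then have D': "(\<eta> has_real_derivative - D) (at (- v))" by simp
      then have "\<eta> differentiable (at (- v))" using real_differentiable_def by blast
      then have "(q has_vector_derivative deriv \<eta> (- v) *\<^sub>R a v) (at (- v))"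
        using q unfolding entropy_flux_def by fastforce
      then have "(q has_vector_derivative (- D) *\<^sub>R a v) (at (- v))" using DERIV_imp_deriv[OF D'] by simp
      then have "((q \<circ> uminus) has_vector_derivative (- 1) *\<^sub>R ((- D) *\<^sub>R a v)) (at v)"
        by (intro vector_diff_chain_at) (auto intro!: derivative_eq_intros)
      then show "((\<lambda>v. q (- v)) has_vector_derivative deriv (\<lambda>v. \<eta> (- v)) v *\<^sub>R a v) (at v)"
        using DERIV_imp_deriv[OF D] by (simp add: o_def)
    qed
    then show ?thesis using assms c \<phi> unfolding entropy_solution_def by blast
  qed
  ultimately show ?thesis unfolding entropy_solution_def by blast
qed

lemma genuinely_nonlinear_reflect:
  fixes a :: "real \<Rightarrow> 'a::euclidean_space"
  assumes "closed I" "genuinely_nonlinear I a"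
  shows "genuinely_nonlinear {v. - v \<in> I} (\<lambda>v. a (- v))"
proof -
  have C1: "a C1_differentiable_on UNIV" using assms(2) by (simp add: genuinely_nonlinear_def)
  then obtain D where D: "\<And>x. (a has_vector_derivative D x) (at x)" "continuous_on UNIV D"
    unfolding C1_differentiable_on_def by auto
  have "((\<lambda>v. a (- v)) has_vector_derivative - D (- v)) (at v)" for v
  proof -
    have "((a \<circ> uminus) has_vector_derivative (- 1) *\<^sub>R D (- v)) (at v)"
      by (intro vector_diff_chain_at D) (auto intro!: derivative_eq_intros)
    then show ?thesis by (simp add: o_def)
  qed
  moreover have "continuous_on UNIV (\<lambda>v. - D (- v))"
    by (intro continuous_intros continuous_on_compose2[OF D(2)]) auto
  ultimately have C1': "(\<lambda>v. a (- v)) C1_differentiable_on UNIV"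
    unfolding C1_differentiable_on_def by (intro exI[of _ "\<lambda>v. - D (- v)"]) auto
  have "continuous_on UNIV a" using C1 C1_differentiable_imp_continuous_on by blast
  then have op: "open {v. \<bar>a v \<bullet> \<xi>\<bar> < \<delta>}" for \<xi> \<delta>
    by (intro open_Collect_less continuous_intros)
  have eq: "emeasure lborel {v \<in> {v. - v \<in> I}. \<bar>a (- v) \<bullet> \<xi>\<bar> < \<delta>} = emeasure lborel {v \<in> I. \<bar>a v \<bullet> \<xi>\<bar> < \<delta>}" for \<xi> \<delta>
  proof -
    let ?S = "{v \<in> I. \<bar>a v \<bullet> \<xi>\<bar> < \<delta>}"
    have "?S = I \<inter> {v. \<bar>a v \<bullet> \<xi>\<bar> < \<delta>}" by auto
    then have S [measurable]: "?S \<in> sets borel" using assms(1) op[of \<xi> \<delta>] by auto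
    have "emeasure lborel ?S = (\<integral>\<^sup>+v. indicator ?S v \<partial>lborel)" by simp
    also have "\<dots> = (\<integral>\<^sup>+v. indicator ?S (0 - v) \<partial>lborel)"
      by (rule nn_integral_lborel_reflect[symmetric]) measurable
    also have "\<dots> = (\<integral>\<^sup>+v. indicator (uminus -` ?S) v \<partial>lborel)"
      by (intro nn_integral_cong) (simp add: indicator_def)
    also have "\<dots> = emeasure lborel (uminus -` ?S)"
      using measurable_sets_borel[OF _ S, of uminus] by (intro nn_integral_indicator) auto
    finally show ?thesis by (simp add: vimage_def)
  qed
  show ?thesis
    using assms(2) C1' unfolding genuinely_nonlinear_def eq by blast
qed

text \<open>The limit \<open>f\<close> is left arbitrary, so that the hypotheses survive the passage
  from \<open>u\<close> to \<open>-u\<close>; the shock is inserted only in the theorem.\<close>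

locale blow_up_limit =
  fixes A a :: "real \<Rightarrow> 'a::euclidean_space" and \<Omega> :: "'a set" and u :: "'a \<Rightarrow> real"
    and I :: "real set" and x0 :: 'a and f :: "'a \<Rightarrow> real"
  assumes A: "\<And>v. (A has_vector_derivative a v) (at v)"
    and \<Omega>: "open \<Omega>" and u: "entropy_solution a \<Omega> u"
    and I: "closed I" "is_interval I" and u_in_I: "AE x in lebesgue_on \<Omega>. u x \<in> I"
    and GN: "genuinely_nonlinear I a" and x0: "x0 \<in> \<Omega>"
    and limit: "L1_loc_limit (blow_up u x0) f (at_right 0)"

lemma blow_up_limit_reflect:
  assumes "blow_up_limit A a \<Omega> u I x0 f"
  shows "blow_up_limit (\<lambda>v. - A (- v)) (\<lambda>v. a (- v)) \<Omega> (\<lambda>x. - u x) {v. - v \<in> I} x0 (\<lambda>z. - f z)"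
proof -
  interpret blow_up_limit A a \<Omega> u I x0 f by fact
  show ?thesis
  proof
    fix v
    have "((A \<circ> uminus) has_vector_derivative (- 1) *\<^sub>R a (- v)) (at v)"
      by (intro vector_diff_chain_at A) (auto intro!: derivative_eq_intros)
    then show "((\<lambda>v. - A (- v)) has_vector_derivative a (- v)) (at v)"
      using has_vector_derivative_minus by (fastforce simp: o_def)
  next
    have "{v. - v \<in> I} = uminus -` I" by auto
    then show "closed {v. - v \<in> I}"
      using I(1) by (simp add: continuous_closed_vimage continuous_minus)
    show "is_interval {v. - v \<in> I}"
      using I(2) unfolding is_interval_1 by (metis mem_Collect_eq neg_le_iff_le)
    show "L1_loc_limit (blow_up (\<lambda>x. - u x) x0) (\<lambda>z. - f z) (at_right 0)"
    proof -
      have "\<bar>- u (r *\<^sub>R x + x0) - - f x\<bar> = \<bar>u (r *\<^sub>R x + x0) - f x\<bar>" for r x by simp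
      then show ?thesis using limit by (simp add: L1_loc_limit_def blow_up_def)
    qed
  qed (use \<Omega> x0 u_in_I entropy_solution_reflect[OF u] genuinely_nonlinear_reflect[OF I(1) GN] in auto)
qed

context blow_up_limit
begin

section \<open>One-sided bounds for the blow-ups\<close>

lemma AE_in_I: "AE x in lborel. x \<in> \<Omega> \<longrightarrow> u x \<in> I"
  using u_in_I \<Omega> by (simp add: AE_restrict_space_iff AE_completion_iff)

lemma eventually_inside: "bounded S \<Longrightarrow> \<forall>\<^sub>F r in at_right 0. \<forall>z\<in>S. x0 + r *\<^sub>R z \<in> \<Omega>"
proof -
  assume "bounded S"
  then obtain B where B: "B > 0" "\<And>z. z \<in> S \<Longrightarrow> norm z \<le> B" using bounded_pos by blast
  obtain \<rho> where \<rho>: "\<rho> > 0" "ball x0 \<rho> \<subseteq> \<Omega>" using \<Omega> x0 openE by blast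
  show ?thesis
  proof (rule eventually_at_rightI)
    show "0 < \<rho> / B" using \<rho> B by simp
    fix r assume r: "r \<in> {0<..<\<rho> / B}"
    show "\<forall>z\<in>S. x0 + r *\<^sub>R z \<in> \<Omega>"
    proof
      fix z assume "z \<in> S"
      then have "r * norm z \<le> r * B" using r B by (intro mult_left_mono) auto
      also have "\<dots> < \<rho>" using r B by (simp add: field_simps)
      finally have "x0 + r *\<^sub>R z \<in> ball x0 \<rho>" using r by (simp add: dist_norm)
      then show "x0 + r *\<^sub>R z \<in> \<Omega>" using \<rho> by blast
    qed
  qed
qed

text \<open>If \<kappa> had a positive distance \<open>e\<close> from the closed set
  \<open>I\<close>, the blow-ups, with values in \<open>I\<close>, would differ from it by
  \<open>e\<close> on a ball of positive measure, against the convergence in L1. This places the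
  limit values among the levels where (GN) is available.\<close>

lemma value_in_I:
  assumes s: "s > 0" and f: "\<And>z. z \<in> cball y s \<Longrightarrow> f z = \<kappa>"
  shows "\<kappa> \<in> I"
proof (rule ccontr)
  assume "\<kappa> \<notin> I"
  then obtain e where e: "e > 0" "ball \<kappa> e \<subseteq> - I" using I(1) openE[of "- I" \<kappa>] by auto
  let ?K = "cball y s"
  have K: "compact ?K" by simp
  have "\<forall>\<^sub>F r in at_right 0. ennreal e * emeasure lborel ?K \<le> (\<integral>\<^sup>+x. ennreal \<bar>blow_up u x0 r x - f x\<bar> \<partial>lebesgue_on ?K)"
    using eventually_inside[OF compact_imp_bounded[OF K]] eventually_at_right_less[of 0]
  proof eventually_elim
    case (elim r)
    have "AE z in lborel. x0 + r *\<^sub>R z \<in> \<Omega> \<longrightarrow> u (x0 + r *\<^sub>R z) \<in> I"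
      using elim by (intro AE_lborel_affine[OF AE_in_I]) auto
    then have "AE z in lborel. ennreal e * indicator ?K z \<le> ennreal \<bar>blow_up u x0 r z - f z\<bar> * indicator ?K z"
    proof eventually_elim
      case (elim z)
      show ?case
      proof (cases "z \<in> ?K")
        case True
        then have "u (x0 + r *\<^sub>R z) \<in> I" using elim \<open>\<forall>z\<in>?K. x0 + r *\<^sub>R z \<in> \<Omega>\<close> by blast
        then have "u (x0 + r *\<^sub>R z) \<notin> ball \<kappa> e" using e by blast
        then have "e \<le> \<bar>blow_up u x0 r z - f z\<bar>"
          using f[OF True] by (simp add: blow_up_def dist_real_def add.commute abs_minus_commute)
        then show ?thesis using True by (simp add: ennreal_leI)
      qed simp
    qed
    then have "AE z in lebesgue. ennreal e * indicator ?K z \<le> ennreal \<bar>blow_up u x0 r z - f z\<bar> * indicator ?K z"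
      by (simp add: AE_completion_iff)
    then have "(\<integral>\<^sup>+z. ennreal e * indicator ?K z \<partial>lebesgue) \<le> (\<integral>\<^sup>+z. ennreal \<bar>blow_up u x0 r z - f z\<bar> * indicator ?K z \<partial>lebesgue)"
      by (rule nn_integral_mono_AE)
    then show ?case
      by (simp add: nn_integral_cmult_indicator nn_integral_restrict_space)
  qed
  moreover have "((\<lambda>r. \<integral>\<^sup>+x. ennreal \<bar>blow_up u x0 r x - f x\<bar> \<partial>lebesgue_on ?K) \<longlongrightarrow> 0) (at_right 0)"
    using limit K unfolding L1_loc_limit_def by blast
  ultimately have "ennreal e * emeasure lborel ?K \<le> 0"
    by (intro tendsto_lowerbound[where F="at_right (0::real)"]) auto
  then have "emeasure lborel ?K = 0" using e by simp
  moreover have "measure lborel ?K > 0" using content_cball_pos[OF s, of y] by simp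
  ultimately show False by (simp add: measure_def)
qed

text \<open>By Chebyshev the blow-ups exceed \<kappa> + e/2 on a set of small measure only, and
  \<open>local_upper_bound\<close> then works between \<kappa> + e/2 and \<kappa> + e. These levels
  must lie in \<open>I\<close>; if \<kappa> + e does not, the interval \<open>I\<close> ends below
  it and the bound is immediate.\<close>

lemma upper_bound_on_ball:
  fixes s :: real
  assumes \<kappa>: "\<kappa> \<in> I" and e: "e > 0" and s: "s > 0" and f: "\<And>z. z \<in> ball y (3 * DIM('a) * s) \<Longrightarrow> f z \<le> \<kappa>"
  shows "\<forall>\<^sub>F r in at_right 0. AE x in lborel. x \<in> ball (x0 + r *\<^sub>R y) (r * s) \<longrightarrow> u x \<le> \<kappa> + e"
proof (cases "\<kappa> + e \<in> I")
  case False
  have less: "v \<le> \<kappa> + e" if "v \<in> I" for v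
  proof (rule ccontr)
    assume "\<not> v \<le> \<kappa> + e"
    then have "\<kappa> + e \<in> I"
      by (intro mem_is_interval_1_I[OF I(2) \<kappa> that]) (use e in auto)
    then show False using False by blast
  qed
  have inside: "\<forall>\<^sub>F r in at_right 0. \<forall>z\<in>ball y s. x0 + r *\<^sub>R z \<in> \<Omega>"
    by (rule eventually_inside) simp
  show ?thesis
    using inside eventually_at_right_less[of 0]
  proof eventually_elim
    case (elim r)
    show ?case
      using AE_in_I
    proof eventually_elim
      case (elim x)
      show ?case
      proof
        assume x: "x \<in> ball (x0 + r *\<^sub>R y) (r * s)"
        define z where "z = (1 / r) *\<^sub>R (x - x0)"
        have xz: "x = x0 + r *\<^sub>R z" using \<open>0 < r\<close> by (simp add: z_def)
        have "r * dist y z < r * s" using x \<open>0 < r\<close> unfolding xz by (simp add: dist_norm scaleR_diff_right[symmetric])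
        then have "z \<in> ball y s" using \<open>0 < r\<close> by simp
        then have "x \<in> \<Omega>" using \<open>\<forall>z\<in>ball y s. x0 + r *\<^sub>R z \<in> \<Omega>\<close> xz by blast
        then show "u x \<le> \<kappa> + e" using elim less by blast
      qed
    qed
  qed
next
  case True
  define D where "D = real (3 * DIM('a))"
  have D: "D \<ge> 1" unfolding D_def using DIM_positive[where 'a='a] by linarith
  have sub: "{\<kappa> + e / 2..\<kappa> + e} \<subseteq> I"
    using mem_is_interval_1_I[OF I(2) \<kappa> True] e by auto
  have lt: "\<kappa> + e / 2 < \<kappa> + e" using e by simp
  obtain M g where g: "kruzhkov A \<Omega> g" "\<forall>x. \<bar>g x\<bar> \<le> M" and ug: "AE x in lborel. x \<in> \<Omega> \<longrightarrow> u x = g x"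
    using entropy_solution_imp_kruzhkov[OF A \<Omega> u] by blast
  from local_upper_bound[OF A I(1) GN lt sub, of M, folded D_def] obtain \<eta> where \<eta>: "\<eta> > 0"
    and all: "\<forall>\<Omega> g c (s::real). kruzhkov A \<Omega> g \<longrightarrow> (\<forall>x. \<bar>g x\<bar> \<le> M) \<longrightarrow> s > 0 \<longrightarrow> ball c (D * s) \<subseteq> \<Omega> \<longrightarrow>
      emeasure lborel (ball c (D * s) \<inter> {x. g x > \<kappa> + e / 2}) \<le> ennreal (s ^ DIM('a)) * ennreal \<eta> \<longrightarrow>
      (AE x in lborel. x \<in> ball c s \<longrightarrow> g x \<le> \<kappa> + e)"
    by (elim exE conjE)
  have bound: "AE x in lborel. x \<in> ball c s \<longrightarrow> g x \<le> \<kappa> + e"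
    if "s > 0" "ball c (D * s) \<subseteq> \<Omega>"
      "emeasure lborel (ball c (D * s) \<inter> {x. g x > \<kappa> + e / 2}) \<le> ennreal (s ^ DIM('a)) * ennreal \<eta>"
    for c and s :: real
    by (rule all[rule_format, OF g(1) _ that]) (use g(2) in blast)
  have [measurable]: "g \<in> borel_measurable borel" using g by (simp add: kruzhkov_def)
  let ?K = "cball y (D * s)"
  have K: "compact ?K" by simp
  \<comment> \<open>Height \<open>e / 2\<close> times the volume allowed at radius \<open>s\<close>.
    In the original variables the Jacobian \<open>r ^ DIM('a)\<close> turns this into the volume
    allowed at radius \<open>s * r\<close>.\<close>
  define \<epsilon> where "\<epsilon> = e / 2 * (s ^ DIM('a) * \<eta>)"
  have "\<epsilon> > 0" using e s \<eta> by (simp add: \<epsilon>_def)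
  then have "\<forall>\<^sub>F r in at_right 0. (\<integral>\<^sup>+x. ennreal \<bar>blow_up u x0 r x - f x\<bar> \<partial>lebesgue_on ?K) < ennreal \<epsilon>"
    using limit K unfolding L1_loc_limit_def by (intro order_tendstoD(2)[of _ 0]) auto
  then show ?thesis
    using eventually_inside[OF compact_imp_bounded[OF K]] eventually_at_right_less[of 0]
  proof eventually_elim
    case (elim r)
    note small = elim(1) and inside = elim(2) and r = elim(3)
    have mem: "x0 + r *\<^sub>R z \<in> ball (x0 + r *\<^sub>R y) (t * r) \<longleftrightarrow> z \<in> ball y t" for z t
      using r by (simp add: dist_norm scaleR_diff_right[symmetric])
    have to_z: "\<exists>z. x = x0 + r *\<^sub>R z" for x
      using r by (intro exI[of _ "(1 / r) *\<^sub>R (x - x0)"]) simp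
    let ?B = "ball (x0 + r *\<^sub>R y) (D * s * r)"
    have B\<Omega>: "?B \<subseteq> \<Omega>"
    proof
      fix x assume x: "x \<in> ?B"
      obtain z where "x = x0 + r *\<^sub>R z" using to_z by blast
      then show "x \<in> \<Omega>" using x mem[of z "D * s"] inside by auto
    qed
    define E where "E = ball y (D * s) \<inter> {z. g (x0 + r *\<^sub>R z) > \<kappa> + e / 2}"
    have E [measurable]: "E \<in> sets borel" unfolding E_def by measurable
    have "AE z in lborel. x0 + r *\<^sub>R z \<in> \<Omega> \<longrightarrow> u (x0 + r *\<^sub>R z) = g (x0 + r *\<^sub>R z)"
      using r by (intro AE_lborel_affine[OF ug]) auto
    then have "AE z in lborel. ennreal (e / 2) * indicator E z \<le> ennreal \<bar>blow_up u x0 r z - f z\<bar> * indicator ?K z"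
    proof eventually_elim
      case (elim z)
      show ?case
      proof (cases "z \<in> E")
        case True
        then have z: "z \<in> ?K" "z \<in> ball y (D * s)" "g (x0 + r *\<^sub>R z) > \<kappa> + e / 2" by (auto simp: E_def)
        have "u (x0 + r *\<^sub>R z) = g (x0 + r *\<^sub>R z)" using elim inside z(1) by blast
        moreover have "f z \<le> \<kappa>" using f z(2) by (simp add: D_def)
        ultimately have "e / 2 \<le> blow_up u x0 r z - f z"
          using z(3) by (simp add: blow_up_def add.commute)
        then have "e / 2 \<le> \<bar>blow_up u x0 r z - f z\<bar>" using abs_ge_self order_trans by blast
        then show ?thesis using True z(1) by (simp add: ennreal_leI)
      qed simp
    qed
    then have "AE z in lebesgue. ennreal (e / 2) * indicator E z \<le> ennreal \<bar>blow_up u x0 r z - f z\<bar> * indicator ?K z"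
      by (simp add: AE_completion_iff)
    then have "(\<integral>\<^sup>+z. ennreal (e / 2) * indicator E z \<partial>lebesgue)
       \<le> (\<integral>\<^sup>+z. ennreal \<bar>blow_up u x0 r z - f z\<bar> * indicator ?K z \<partial>lebesgue)"
      by (rule nn_integral_mono_AE)
    also have "\<dots> = (\<integral>\<^sup>+x. ennreal \<bar>blow_up u x0 r x - f x\<bar> \<partial>lebesgue_on ?K)"
      by (simp add: nn_integral_restrict_space)
    also have "\<dots> \<le> ennreal \<epsilon>" using small by simp
    finally have "ennreal (e / 2) * emeasure lborel E \<le> ennreal (e / 2) * ennreal (s ^ DIM('a) * \<eta>)"
      using e s \<eta> by (simp add: nn_integral_cmult_indicator \<epsilon>_def ennreal_mult[symmetric])
    then have E_small: "emeasure lborel E \<le> ennreal (s ^ DIM('a) * \<eta>)"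
      using e by (subst (asm) ennreal_mult_le_mult_iff) auto
    have "emeasure lborel (?B \<inter> {x. g x > \<kappa> + e / 2}) = (\<integral>\<^sup>+x. indicator (?B \<inter> {x. g x > \<kappa> + e / 2}) x \<partial>lborel)"
      by (rule nn_integral_indicator[symmetric]) measurable
    also have "\<dots> = ennreal (\<bar>r\<bar> ^ DIM('a)) * (\<integral>\<^sup>+z. indicator (?B \<inter> {x. g x > \<kappa> + e / 2}) (x0 + r *\<^sub>R z) \<partial>lborel)"
    proof (rule nn_integral_lborel_affine)
      have "{x. g x > \<kappa> + e / 2} \<in> sets borel" by measurable
      then show "indicator (?B \<inter> {x. g x > \<kappa> + e / 2}) \<in> borel_measurable borel"
        by (intro borel_measurable_indicator sets.Int) auto
    qed (use r in simp)
    also have "(\<integral>\<^sup>+z. indicator (?B \<inter> {x. g x > \<kappa> + e / 2}) (x0 + r *\<^sub>R z) \<partial>lborel) = (\<integral>\<^sup>+z. indicator E z \<partial>lborel)"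
      by (intro nn_integral_cong) (use mem in \<open>auto simp: indicator_def E_def\<close>)
    also have "\<dots> = emeasure lborel E" by simp
    finally have "emeasure lborel (?B \<inter> {x. g x > \<kappa> + e / 2}) \<le> ennreal (r ^ DIM('a)) * ennreal (s ^ DIM('a) * \<eta>)"
      using r E_small by (simp add: mult_left_mono)
    also have "\<dots> = ennreal ((s * r) ^ DIM('a)) * ennreal \<eta>"
      using r s \<eta> by (simp add: ennreal_mult[symmetric] power_mult_distrib mult_ac)
    finally have "AE x in lborel. x \<in> ball (x0 + r *\<^sub>R y) (s * r) \<longrightarrow> g x \<le> \<kappa> + e"
      using r s B\<Omega> by (intro bound) (simp_all add: mult.assoc)
    with ug show ?case
    proof eventually_elim
      case (elim x)
      have "ball (x0 + r *\<^sub>R y) (s * r) \<subseteq> ?B"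
        using D r s by (intro subset_ball) (simp add: mult_le_cancel_right)
      then show ?case using elim B\<Omega> by (auto simp: mult.commute)
    qed
  qed
qed

text \<open>The part of the closed unit ball at height at least \<delta> is compact, so finitely
  many balls cover it and the finitely many eventual bounds hold simultaneously.\<close>

lemma upper_bound_on_cone:
  assumes \<kappa>: "\<kappa> \<in> I" and e: "e > 0" and m: "norm m = 1" and \<delta>: "\<delta> > 0" and f: "\<And>z. z \<bullet> m > 0 \<Longrightarrow> f z \<le> \<kappa>"
  shows "\<forall>\<^sub>F r in at_right 0. AE x in lborel. norm (x - x0) < r \<longrightarrow> (x - x0) \<bullet> m > \<delta> * r \<longrightarrow> u x \<le> \<kappa> + e"
proof -
  \<comment> \<open>The hypothesis of \<open>upper_bound_on_ball\<close> concerns the enlarged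
    balls. With this \<open>s\<close> their radius is \<delta>, so those centred at height at least
    \<delta> stay in the open half space.\<close>
  define s where "s = \<delta> / (3 * DIM('a))"
  have s: "s > 0" "3 * DIM('a) * s = \<delta>" using \<delta> by (simp_all add: s_def)
  let ?C = "cball 0 1 \<inter> {z. z \<bullet> m \<ge> \<delta>}"
  have "compact ?C"
    by (intro compact_Int_closed closed_Collect_le continuous_intros) simp
  moreover have "?C \<subseteq> (\<Union>y\<in>?C. ball y s)" using s by auto
  ultimately obtain T where T: "finite T" "T \<subseteq> ?C" "?C \<subseteq> (\<Union>y\<in>T. ball y s)"
    using compactE_image[of ?C ?C "\<lambda>y. ball y s"] by (metis (no_types, lifting) open_ball)
  have pos: "f z \<le> \<kappa>" if y: "y \<in> T" and z: "z \<in> ball y (3 * DIM('a) * s)" for y z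
  proof (rule f)
    have "\<bar>(y - z) \<bullet> m\<bar> \<le> norm (y - z) * norm m" by (rule Cauchy_Schwarz_ineq2)
    also have "\<dots> < \<delta>" using z m unfolding s(2) by (simp add: dist_norm)
    finally show "z \<bullet> m > 0" using y T(2) by (auto simp: inner_diff_left)
  qed
  have "\<forall>\<^sub>F r in at_right 0. \<forall>y\<in>T. AE x in lborel. x \<in> ball (x0 + r *\<^sub>R y) (r * s) \<longrightarrow> u x \<le> \<kappa> + e"
    by (rule eventually_ball_finite[OF T(1)]) (use upper_bound_on_ball[OF \<kappa> e s(1)] pos in blast)
  then show ?thesis
    using eventually_at_right_less[of 0]
  proof eventually_elim
    case (elim r)
    have "AE x in lborel. \<forall>y\<in>T. x \<in> ball (x0 + r *\<^sub>R y) (r * s) \<longrightarrow> u x \<le> \<kappa> + e"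
      by (rule eventually_ball_finite[OF T(1)]) (use elim in blast)
    then show ?case
    proof eventually_elim
      case (elim x)
      show ?case
      proof (intro impI)
        assume x: "norm (x - x0) < r" "(x - x0) \<bullet> m > \<delta> * r"
        define z where "z = (1 / r) *\<^sub>R (x - x0)"
        have "norm z = norm (x - x0) / r" "z \<bullet> m = (x - x0) \<bullet> m / r"
          using \<open>0 < r\<close> by (simp_all only: z_def norm_scaleR inner_scaleR_left) simp_all
        then have "z \<in> ?C" using x \<open>0 < r\<close> by (simp add: pos_le_divide_eq)
        then obtain y where y: "y \<in> T" "z \<in> ball y s" using T(3) by blast
        have "x = x0 + r *\<^sub>R z" using \<open>0 < r\<close> by (simp add: z_def)
        then have "x \<in> ball (x0 + r *\<^sub>R y) (r * s)"
          using y(2) \<open>0 < r\<close> by (simp add: dist_norm scaleR_diff_right[symmetric])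
        then show "u x \<le> \<kappa> + e" using elim y(1) by blast
      qed
    qed
  qed
qed

lemma lower_bound_on_cone:
  assumes \<kappa>: "\<kappa> \<in> I" and e: "e > 0" and m: "norm m = 1" and \<delta>: "\<delta> > 0" and f: "\<And>z. z \<bullet> m > 0 \<Longrightarrow> f z \<ge> \<kappa>"
  shows "\<forall>\<^sub>F r in at_right 0. AE x in lborel. norm (x - x0) < r \<longrightarrow> (x - x0) \<bullet> m > \<delta> * r \<longrightarrow> \<kappa> - e \<le> u x"
proof -
  interpret R: blow_up_limit "\<lambda>v. - A (- v)" "\<lambda>v. a (- v)" \<Omega> "\<lambda>x. - u x" "{v. - v \<in> I}" x0 "\<lambda>z. - f z"
    by (rule blow_up_limit_reflect) (rule blow_up_limit_axioms)
  have "\<forall>\<^sub>F r in at_right 0. AE x in lborel. norm (x - x0) < r \<longrightarrow> (x - x0) \<bullet> m > \<delta> * r \<longrightarrow> - u x \<le> - \<kappa> + e"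
    by (rule R.upper_bound_on_cone) (use assms in auto)
  then show ?thesis
    by (rule eventually_mono) (auto elim: eventually_mono)
qed

lemma upper_bound_near:
  assumes \<kappa>: "\<kappa> \<in> I" and e: "e > 0" and f: "\<And>z. f z \<le> \<kappa>"
  shows "\<forall>\<^sub>F r in at_right 0. AE x in lborel. x \<in> ball x0 r \<longrightarrow> u x \<le> \<kappa> + e"
  using upper_bound_on_ball[OF \<kappa> e, of 1 0] f by simp

lemma lower_bound_near:
  assumes \<kappa>: "\<kappa> \<in> I" and e: "e > 0" and f: "\<And>z. f z \<ge> \<kappa>"
  shows "\<forall>\<^sub>F r in at_right 0. AE x in lborel. x \<in> ball x0 r \<longrightarrow> \<kappa> - e \<le> u x"
proof -
  interpret R: blow_up_limit "\<lambda>v. - A (- v)" "\<lambda>v. a (- v)" \<Omega> "\<lambda>x. - u x" "{v. - v \<in> I}" x0 "\<lambda>z. - f z"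
    by (rule blow_up_limit_reflect) (rule blow_up_limit_axioms)
  have "\<forall>\<^sub>F r in at_right 0. AE x in lborel. x \<in> ball x0 r \<longrightarrow> - u x \<le> - \<kappa> + e"
    by (rule R.upper_bound_near) (use assms in auto)
  then show ?thesis
    by (rule eventually_mono) (auto elim: eventually_mono)
qed

end

text \<open>
  Rational radii suffice, so that only countably many null sets occur.
\<close>

lemma ess_cone_limit:
  fixes u :: "'a::euclidean_space \<Rightarrow> real"
  assumes near: "\<And>\<delta> e. \<delta> > 0 \<Longrightarrow> e > 0 \<Longrightarrow>
      \<forall>\<^sub>F r in at_right 0. AE x in lborel. norm (x - x0) < r \<longrightarrow> (x - x0) \<bullet> m > \<delta> * r \<longrightarrow> \<bar>u x - \<kappa>\<bar> \<le> e"
    and \<delta>: "\<delta> > 0"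
  shows "((\<lambda>y. ereal (u y)) \<longlongrightarrow> ereal \<kappa>) (ess_at_within x0 {y \<in> \<Omega>. (y - x0) \<bullet> m > \<delta> * norm (y - x0)})"
proof -
  let ?S = "{y \<in> \<Omega>. (y - x0) \<bullet> m > \<delta> * norm (y - x0)}"
  have "(u \<longlongrightarrow> \<kappa>) (ess_at_within x0 ?S)"
  proof (rule tendstoI)
    fix e :: real assume e: "e > 0"
    obtain b where b: "b > 0" and ae: "\<And>r. 0 < r \<Longrightarrow> r < b \<Longrightarrow>
        AE x in lborel. norm (x - x0) < r \<longrightarrow> (x - x0) \<bullet> m > (\<delta> / 2) * r \<longrightarrow> \<bar>u x - \<kappa>\<bar> \<le> e / 2"
      using near[of "\<delta> / 2" "e / 2"] \<delta> e unfolding eventually_at_right_field by auto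
    define R where "R = {r \<in> \<rat>. 0 < r \<and> r < b}"
    have "countable R" unfolding R_def by (rule countable_subset[OF _ countable_rat]) auto
    then have "AE x in lborel. \<forall>r\<in>R. norm (x - x0) < r \<longrightarrow> (x - x0) \<bullet> m > (\<delta> / 2) * r \<longrightarrow> \<bar>u x - \<kappa>\<bar> \<le> e / 2"
      using ae by (subst AE_ball_countable) (auto simp: R_def)
    then have ae': "\<forall>\<^sub>F x in ae_filter lebesgue. \<forall>r\<in>R. norm (x - x0) < r \<longrightarrow> (x - x0) \<bullet> m > (\<delta> / 2) * r \<longrightarrow> \<bar>u x - \<kappa>\<bar> \<le> e / 2"
      by (simp add: AE_completion_iff)
    have "\<forall>\<^sub>F y in at x0 within ?S. y \<in> ?S \<and> y \<noteq> x0 \<and> dist y x0 < b / 2"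
      using b unfolding eventually_at by (intro exI[of _ "b / 2"]) auto
    then show "\<forall>\<^sub>F y in ess_at_within x0 ?S. dist (u y) \<kappa> < e"
      unfolding ess_at_within_def eventually_inf
    proof (intro exI conjI)
      show "\<forall>y. (y \<in> ?S \<and> y \<noteq> x0 \<and> dist y x0 < b / 2) \<and>
          (\<forall>r\<in>R. norm (y - x0) < r \<longrightarrow> (y - x0) \<bullet> m > (\<delta> / 2) * r \<longrightarrow> \<bar>u y - \<kappa>\<bar> \<le> e / 2)
          \<longrightarrow> dist (u y) \<kappa> < e"
      proof (intro allI impI)
        fix y
        assume y: "(y \<in> ?S \<and> y \<noteq> x0 \<and> dist y x0 < b / 2) \<and>
          (\<forall>r\<in>R. norm (y - x0) < r \<longrightarrow> (y - x0) \<bullet> m > (\<delta> / 2) * r \<longrightarrow> \<bar>u y - \<kappa>\<bar> \<le> e / 2)"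
        define t where "t = norm (y - x0)"
        have t: "t > 0" "t < b / 2" using y by (auto simp: t_def dist_norm)
        \<comment> \<open>For t < r < 2 t the point \<open>y\<close> lies in the ball of radius
          \<open>r\<close>, and its height exceeds \<delta> * t and hence (\<delta> / 2) * r; this
          is why the bound was requested with \<delta> / 2.\<close>
        obtain r where r: "r \<in> \<rat>" "t < r" "r < 2 * t"
          using Rats_dense_in_real[of t "2 * t"] t by auto
        have "r \<in> R" using r t by (auto simp: R_def)
        moreover have "(\<delta> / 2) * r < \<delta> * t" using r \<delta> by simp
        moreover have "\<delta> * t < (y - x0) \<bullet> m" using y by (simp add: t_def)
        ultimately have "\<bar>u y - \<kappa>\<bar> \<le> e / 2" using y r by (auto simp: t_def)
        then show "dist (u y) \<kappa> < e" using e by (simp add: dist_real_def)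
      qed
    qed (use ae' in simp_all)
  qed
  then show ?thesis by simp
qed

text \<open>The bound from below is known on a cone only. This suffices for the essential supremum,
  because the truncated cone is open and nonempty at every radius and therefore not a null
  set.\<close>

lemma esssup_envelope:
  fixes u :: "'a::euclidean_space \<Rightarrow> real"
  assumes \<Omega>: "open \<Omega>" "x0 \<in> \<Omega>" and u: "u \<in> borel_measurable (lebesgue_on \<Omega>)"
    and upper: "\<And>e. e > 0 \<Longrightarrow> \<forall>\<^sub>F r in at_right 0. AE x in lborel. x \<in> ball x0 r \<longrightarrow> u x \<le> \<kappa> + e"
    and lower: "\<And>e. e > 0 \<Longrightarrow>
      \<forall>\<^sub>F r in at_right 0. AE x in lborel. norm (x - x0) < r \<longrightarrow> (x - x0) \<bullet> m > (1/2) * r \<longrightarrow> \<kappa> - e \<le> u x"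
    and m: "norm m = 1"
  shows "((\<lambda>r. esssup (lebesgue_on (\<Omega> \<inter> ball x0 r)) (\<lambda>y. ereal (u y))) \<longlongrightarrow> ereal \<kappa>) (at_right 0)"
proof -
  let ?e = "\<lambda>r. esssup (lebesgue_on (\<Omega> \<inter> ball x0 r)) (\<lambda>y. ereal (u y))"
  obtain \<rho> where \<rho>: "\<rho> > 0" "ball x0 \<rho> \<subseteq> \<Omega>" using \<Omega> openE by blast
  have L: "\<Omega> \<inter> ball x0 r \<in> sets lebesgue" for r using \<Omega>(1) by auto
  have um: "(\<lambda>y. ereal (u y)) \<in> borel_measurable (lebesgue_on (\<Omega> \<inter> ball x0 r))" for r
    using measurable_restrict_mono[OF u, of "\<Omega> \<inter> ball x0 r"] by simp
  have small: "\<forall>\<^sub>F r in at_right 0. r < \<rho>"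
    using \<rho> by (auto intro!: eventually_at_rightI[of 0 \<rho>])
  have up: "\<forall>\<^sub>F r in at_right 0. ?e r \<le> ereal (\<kappa> + e)" if "e > 0" for e
    using upper[OF that]
  proof eventually_elim
    case (elim r)
    then have "AE x in lebesgue_on (\<Omega> \<inter> ball x0 r). ereal (u x) \<le> ereal (\<kappa> + e)"
      using L by (subst AE_restrict_space_iff) (auto simp: AE_completion_iff elim: eventually_mono)
    then show ?case by (rule esssup_I[OF um])
  qed
  have low: "\<forall>\<^sub>F r in at_right 0. ereal (\<kappa> - e) \<le> ?e r" if "e > 0" for e
    using lower[OF that] small eventually_at_right_less[of 0]
  proof eventually_elim
    case (elim r)
    show ?case
    proof (rule ccontr)
      assume "\<not> ereal (\<kappa> - e) \<le> ?e r"
      then have less: "?e r < ereal (\<kappa> - e)" by simp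
      have "AE x in lborel. x \<in> \<Omega> \<inter> ball x0 r \<longrightarrow> ereal (u x) \<le> ?e r"
        using esssup_AE[of "\<lambda>y. ereal (u y)" "lebesgue_on (\<Omega> \<inter> ball x0 r)"] L
        by (subst (asm) AE_restrict_space_iff) (auto simp: AE_completion_iff)
      then have "AE x in lborel. \<not> (norm (x - x0) < r \<and> (x - x0) \<bullet> m > (1/2) * r)"
        using elim(1)
      proof eventually_elim
        case (elim x)
        show ?case
        proof
          assume x: "norm (x - x0) < r \<and> (x - x0) \<bullet> m > (1/2) * r"
          then have "x \<in> ball x0 r" by (simp add: dist_norm norm_minus_commute)
          moreover have "x \<in> \<Omega>" using \<rho> \<open>r < \<rho>\<close> subset_ball[of r \<rho> x0] calculation by auto
          ultimately have "ereal (u x) \<le> ?e r" using elim(1) by blast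
          moreover have "\<kappa> - e \<le> u x" using elim(2) x by blast
          ultimately show False using less by (meson ereal_less_eq(3) leD order_trans)
        qed
      qed
      moreover define V where "V = {x. norm (x - x0) < r \<and> (x - x0) \<bullet> m > (1/2) * r}"
      have V: "open V" unfolding V_def
        by (intro open_Collect_conj open_Collect_less continuous_intros)
      have "V \<noteq> {}"
      proof -
        have "m \<bullet> m = 1" using m by (simp add: dot_square_norm)
        \<comment> \<open>On the axis, 3/4 lies strictly between the aperture 1/2 and the radius
          1.\<close>
        then have "x0 + (3 / 4 * r) *\<^sub>R m \<in> V" using m \<open>0 < r\<close> by (simp add: V_def)
        then show ?thesis by blast
      qed
      ultimately have "AE x in lborel. x \<notin> V" by (simp add: V_def)
      then have "V \<in> null_sets lborel" using V by (subst (asm) AE_iff_null_sets[symmetric]) auto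
      then have "negligible V" using V by (simp add: negligible_iff_null_sets null_sets_completion_iff)
      then show False using open_not_negligible[OF V \<open>V \<noteq> {}\<close>] by blast
    qed
  qed
  show ?thesis
  proof (rule order_tendstoI)
    fix c assume "c < ereal \<kappa>"
    then obtain q where q: "c < ereal q" "ereal q < ereal \<kappa>" using ereal_dense2 by blast
    then show "\<forall>\<^sub>F r in at_right 0. c < ?e r"
      using low[of "\<kappa> - q"] by (auto elim!: eventually_mono intro: less_le_trans)
  next
    fix c assume "ereal \<kappa> < c"
    then obtain q where q: "ereal \<kappa> < ereal q" "ereal q < c" using ereal_dense2 by blast
    then show "\<forall>\<^sub>F r in at_right 0. ?e r < c"
      using up[of "q - \<kappa>"] by (auto elim!: eventually_mono intro: le_less_trans)
  qed
qed

text \<open>\<open>up\<close> is the largest value of the limit and \<open>um\<close> the smallest,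
  so the outer bounds hold on full balls around \<open>x0\<close>. The inner bounds hold on cones
  inside the two half spaces. The envelopes and both kinds of limit are read off from these four
  bounds.\<close>

theorem proposition11p1:
  fixes A a :: "real \<Rightarrow> 'a::euclidean_space"
    and \<Omega> :: "'a set" and u :: "'a \<Rightarrow> real" and I :: "real set"
    and \<mu> :: "('a \<times> real) measure" and x0 n :: 'a and up um :: real
  assumes "\<And>v. (A has_vector_derivative a v) (at v)"
    and "open \<Omega>"
    and "entropy_solution a \<Omega> u"
    and "closed I" and "is_interval I" and "AE x in lebesgue_on \<Omega>. u x \<in> I"
    and "genuinely_nonlinear I a"
    and "kinetic_measure a \<Omega> u \<mu>"
    and "x0 \<in> jump_set \<Omega> \<mu>"
    and "norm n = 1" and "up > um"
    and "L1_loc_limit (blow_up u x0) (shock n up um) (at_right 0)"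
  shows "ereal up = upper_envelope \<Omega> u x0 \<and> ereal um = lower_envelope \<Omega> u x0 \<and>
    (\<forall>\<delta>>0. ess_uniform_limit (ball 0 1 \<inter> {x. \<bar>x \<bullet> n\<bar> > \<delta>})
       (blow_up u x0) (shock n up um) (at_right 0)) \<and>
    (\<forall>\<delta>>0.
       ((\<lambda>y. ereal (u y)) \<longlongrightarrow> upper_envelope \<Omega> u x0)
         (ess_at_within x0 {y \<in> \<Omega>. (y - x0) \<bullet> n > \<delta> * norm (y - x0)}) \<and>
       ((\<lambda>y. ereal (u y)) \<longlongrightarrow> lower_envelope \<Omega> u x0)
         (ess_at_within x0 {y \<in> \<Omega>. (y - x0) \<bullet> n < - \<delta> * norm (y - x0)}))"
proof -
  have x0: "x0 \<in> \<Omega>" using assms(9) by (simp add: jump_set_def)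
  interpret blow_up_limit A a \<Omega> u I x0 "shock n up um"
    by standard (use assms x0 in auto)
  have n: "norm n = 1" "norm (- n) = 1" using assms(10) by auto
  have um_up: "um < up" by fact
  have nn: "n \<bullet> n = 1" using n by (simp add: dot_square_norm)
  \<comment> \<open>\<open>value_in_I\<close> needs a ball on which the limit is constant; the ball
    around \<open>n\<close> of radius 1/2 and its reflection provide one for each value.\<close>
  have plus: "z \<bullet> n > 0" if "z \<in> cball n (1/2)" for z
  proof -
    have "\<bar>(n - z) \<bullet> n\<bar> \<le> norm (n - z) * norm n" by (rule Cauchy_Schwarz_ineq2)
    then show ?thesis using that n nn by (simp add: inner_diff_left dist_norm)
  qed
  have up_I: "up \<in> I"
    by (rule value_in_I[of "1/2" n]) (use plus in \<open>auto simp: shock_def\<close>)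
  have um_I: "um \<in> I"
  proof (rule value_in_I[of "1/2" "- n"])
    fix z assume "z \<in> cball (- n) (1/2)"
    then have "- z \<in> cball n (1/2)" by (simp add: dist_norm norm_minus_commute add.commute)
    then show "shock n up um z = um" using plus[of "- z"] by (simp add: shock_def)
  qed simp
  have upper: "\<forall>\<^sub>F r in at_right 0. AE x in lborel. x \<in> ball x0 r \<longrightarrow> u x \<le> up + e" if "e > 0" for e
    by (rule upper_bound_near[OF up_I that]) (use um_up in \<open>auto simp: shock_def\<close>)
  have lower: "\<forall>\<^sub>F r in at_right 0. AE x in lborel. x \<in> ball x0 r \<longrightarrow> um - e \<le> u x" if "e > 0" for e
    by (rule lower_bound_near[OF um_I that]) (use um_up in \<open>auto simp: shock_def\<close>)
  have cone_up: "\<forall>\<^sub>F r in at_right 0. AE x in lborel. norm (x - x0) < r \<longrightarrow> (x - x0) \<bullet> n > \<delta> * r \<longrightarrow> up - e \<le> u x"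
    if "\<delta> > 0" "e > 0" for \<delta> e
    by (rule lower_bound_on_cone[OF up_I that(2) n(1) that(1)]) (auto simp: shock_def)
  have cone_um: "\<forall>\<^sub>F r in at_right 0. AE x in lborel. norm (x - x0) < r \<longrightarrow> (x - x0) \<bullet> (- n) > \<delta> * r \<longrightarrow> u x \<le> um + e"
    if "\<delta> > 0" "e > 0" for \<delta> e
    by (rule upper_bound_on_cone[OF um_I that(2) n(2) that(1)]) (auto simp: shock_def)
  have near_up: "\<forall>\<^sub>F r in at_right 0. AE x in lborel. norm (x - x0) < r \<longrightarrow> (x - x0) \<bullet> n > \<delta> * r \<longrightarrow> \<bar>u x - up\<bar> \<le> e"
    if "\<delta> > 0" "e > 0" for \<delta> e
    using cone_up[OF that] upper[OF that(2)]
  proof eventually_elim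
    case (elim r)
    then show ?case
      by eventually_elim (auto simp: dist_norm norm_minus_commute abs_le_iff)
  qed
  have near_um: "\<forall>\<^sub>F r in at_right 0. AE x in lborel. norm (x - x0) < r \<longrightarrow> (x - x0) \<bullet> (- n) > \<delta> * r \<longrightarrow> \<bar>u x - um\<bar> \<le> e"
    if "\<delta> > 0" "e > 0" for \<delta> e
    using cone_um[OF that] lower[OF that(2)]
  proof eventually_elim
    case (elim r)
    then show ?case
      by eventually_elim (auto simp: dist_norm norm_minus_commute abs_le_iff)
  qed
  have um_meas: "u \<in> borel_measurable (lebesgue_on \<Omega>)"
    using assms(3) by (simp add: entropy_solution_def L_infinity_def)
  have env_up: "ereal up = upper_envelope \<Omega> u x0"
    unfolding upper_envelope_def
    by (rule tendsto_Lim[symmetric])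
      (auto intro!: esssup_envelope[OF assms(2) x0 um_meas upper cone_up n(1)])
  \<comment> \<open>The essential infimum is defined through \<open>-u\<close>, so the lower
    envelope is the upper one of \<open>-u\<close>, with the cone around \<open>-n\<close> as the
    place where the inner bound is known.\<close>
  have "((\<lambda>r. esssup (lebesgue_on (\<Omega> \<inter> ball x0 r)) (\<lambda>y. ereal (- u y))) \<longlongrightarrow> ereal (- um)) (at_right 0)"
  proof (rule esssup_envelope[OF assms(2) x0 _ _ _ n(2)])
    fix e :: real assume e: "e > 0"
    show "\<forall>\<^sub>F r in at_right 0. AE x in lborel. x \<in> ball x0 r \<longrightarrow> - u x \<le> - um + e"
      using lower[OF e] by (rule eventually_mono) (auto elim: eventually_mono)
    show "\<forall>\<^sub>F r in at_right 0. AE x in lborel. norm (x - x0) < r \<longrightarrow> (1/2) * r < (x - x0) \<bullet> (- n) \<longrightarrow> - um - e \<le> - u x"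
      using cone_um[OF _ e, of "1/2"] by (auto elim!: eventually_mono)
  qed (use um_meas in simp)
  then have "((\<lambda>r. essinf (lebesgue_on (\<Omega> \<inter> ball x0 r)) (\<lambda>y. ereal (u y))) \<longlongrightarrow> - ereal (- um)) (at_right 0)"
    unfolding essinf_def by (intro tendsto_uminus_ereal) simp
  then have env_um: "ereal um = lower_envelope \<Omega> u x0"
    unfolding lower_envelope_def by (intro tendsto_Lim[symmetric]) auto
  have uniform: "ess_uniform_limit (ball 0 1 \<inter> {x. \<bar>x \<bullet> n\<bar> > \<delta>}) (blow_up u x0) (shock n up um) (at_right 0)"
    if \<delta>: "\<delta> > 0" for \<delta>
    unfolding ess_uniform_limit_def
  proof (intro allI impI)
    fix e :: real assume e: "e > 0"
    let ?S = "ball 0 1 \<inter> {x. \<bar>x \<bullet> n\<bar> > \<delta>}"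
    have "open {x. \<bar>x \<bullet> n\<bar> > \<delta>}" by (intro open_Collect_less continuous_intros)
    then have S: "?S \<in> sets lebesgue" by auto
    \<comment> \<open>The cone bounds are not strict, whereas \<open>ess_uniform_limit\<close> asks
      for a strict inequality; half of \<open>e\<close> bridges this.\<close>
    have e2: "e / 2 > 0" using e by simp
    show "\<forall>\<^sub>F r in at_right 0. AE x in lebesgue_on ?S. \<bar>blow_up u x0 r x - shock n up um x\<bar> < e"
      using near_up[OF \<delta> e2] near_um[OF \<delta> e2] eventually_at_right_less[of 0]
    proof eventually_elim
      case (elim r)
      have r: "r \<noteq> 0" using elim(3) by simp
      have "AE z in lborel. z \<in> ?S \<longrightarrow> \<bar>blow_up u x0 r z - shock n up um z\<bar> < e"
        using AE_lborel_affine[OF elim(1) r, of x0] AE_lborel_affine[OF elim(2) r, of x0]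
      proof eventually_elim
        case (elim z)
        show ?case
        proof
          assume z: "z \<in> ?S"
          have 1: "norm (x0 + r *\<^sub>R z - x0) < r" using z \<open>0 < r\<close> by simp
          have bu: "blow_up u x0 r z = u (x0 + r *\<^sub>R z)" by (simp add: blow_up_def add.commute)
          show "\<bar>blow_up u x0 r z - shock n up um z\<bar> < e"
          proof (cases "z \<bullet> n > 0")
            case True
            then have "(x0 + r *\<^sub>R z - x0) \<bullet> n > \<delta> * r" using z \<open>0 < r\<close> by simp
            then have "\<bar>u (x0 + r *\<^sub>R z) - up\<bar> \<le> e / 2" using elim(1) 1 by blast
            then show ?thesis using True e by (simp add: bu shock_def)
          next
            case False
            then have "\<delta> < z \<bullet> (- n)" using z by simp
            then have "(x0 + r *\<^sub>R z - x0) \<bullet> (- n) > \<delta> * r"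
              using mult_strict_left_mono[OF _ \<open>0 < r\<close>] by (simp only: add_diff_cancel_left' inner_scaleR_left mult.commute[of \<delta>])
            then have "\<bar>u (x0 + r *\<^sub>R z) - um\<bar> \<le> e / 2" using elim(2) 1 by blast
            then show ?thesis using False e by (simp add: bu shock_def)
          qed
        qed
      qed
      then show ?case using S by (subst AE_restrict_space_iff) (auto simp: AE_completion_iff)
    qed
  qed
  have lim_up: "((\<lambda>y. ereal (u y)) \<longlongrightarrow> ereal up) (ess_at_within x0 {y \<in> \<Omega>. (y - x0) \<bullet> n > \<delta> * norm (y - x0)})"
    if "\<delta> > 0" for \<delta>
    by (rule ess_cone_limit[OF near_up that])
  have lim_um: "((\<lambda>y. ereal (u y)) \<longlongrightarrow> ereal um) (ess_at_within x0 {y \<in> \<Omega>. (y - x0) \<bullet> n < - \<delta> * norm (y - x0)})"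
    if "\<delta> > 0" for \<delta>
  proof -
    have "{y \<in> \<Omega>. (y - x0) \<bullet> n < - \<delta> * norm (y - x0)} = {y \<in> \<Omega>. (y - x0) \<bullet> (- n) > \<delta> * norm (y - x0)}"
      by auto
    then show ?thesis using ess_cone_limit[OF near_um that, of \<Omega>] by simp
  qed
  show ?thesis
    using env_up env_um uniform lim_up lim_um by auto
qed

end
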